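(* Let $\alpha>0$, let $\mathcal{G}\in\mathcal{K}(\alpha)$, and let $\Lambda,\Gamma\subset\mathbb{R}$ be separated sets, with $\Gamma$ relatively dense. Assume that the $\Gamma$-shifts of $\mathcal{G}$ are stable and that $$D^-(\Lambda)>\frac{q(\mathcal{G})}{k(\mathcal{G})}D^+(\Gamma).$$ Then $\Gamma$ is an interpolation set for $V^p_\Lambda(\mathcal{G})$, for every $1\le p\le\infty$; that is, for every $\{c_\gamma\}\in l^p(\Gamma)$ there is a function $f\in V^p_\Lambda(\mathcal{G})$ such that $f(\gamma)=c_\gamma$ for all $\gamma\in\Gamma$.
   Context: A countable set $\Gamma\subset\mathbb{R}$ is separated if $\inf_{\gamma\ne\gamma'}|\gamma-\gamma'|>0$. Its lower and upper uniform densities are $D^-(\Gamma)=\lim_{R\to\infty}\inf_{x\in\mathbb{R}}\frac{\#(\Gamma\cap[x-R,x+R])}{2R}$ and $D^+(\Gamma)=\lim_{R\to\infty}\sup_{x\in\mathbb{R}}\frac{\#(\Gamma\cap[x-R,x+R])}{2R}$. $\Gamma$ is relatively dense if $D^-(\Gamma)>0$. Class $\mathcal{K}(\alpha)$: all functions $\mathcal{G}(z)=\mathcal{R}(e^{\alpha z})$, $\mathcal{R}=P/Q$, where $P,Q$ are non-trivial complex polynomials without common zeros such that (A) $1\le\deg P<\deg Q$; (B) $P(0)=0$; (C) $Q(x)\ne0$ for all real $x\ge0$. For such $\mathcal{G}$, $q(\mathcal{G}):=\deg Q$, and $k(\mathcal{G})$ is the greatest integer $k$ such that $\mathcal{G}(z+2\pi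 i/(k\alpha))=c\,\mathcal{G}(z)$, $z\in\mathbb{C}$, for some constant $c\in\mathbb{C}$. For a separated set $\Lambda$, $V^p_\Lambda(\mathcal{G})$ is the space of all functions $f(x)=\sum_{\lambda\in\Lambda}d_\lambda\mathcal{G}(x-\lambda)$, $x\in\mathbb{R}$, with $\{d_\lambda\}\in l^p(\Lambda)$. The $\Gamma$-shifts of $\mathcal{G}$ are stable if for every $p\in[1,\infty]$ there are constants $C_1,C_2>0$ with $C_1\|\mathbf{c}\|_p\le\|\sum_{\gamma\in\Gamma}c_\gamma\mathcal{G}(\cdot-\gamma)\|_{L^p(\mathbb{R})}\le C_2\|\mathbf{c}\|_p$ for all $\mathbf{c}=\{c_\gamma\}\in l^p(\Gamma)$. *)

theory Defs
  imports
    "HOL-Probability.Essential_Supremum"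
    "HOL-Computational_Algebra.Fundamental_Theorem_Algebra"
begin

definition separated :: "real set \<Rightarrow> bool" where
  "separated \<Gamma> \<longleftrightarrow> countable \<Gamma> \<and> uniform_discrete \<Gamma>"

text \<open>
  For separated sets the intersections below are finite, the real infima and suprema are taken
  over bounded families, and the limits exist by sub- and superadditivity, so none of \<^const>\<open>card\<close>,
  \<^const>\<open>Inf\<close>, \<^const>\<open>Sup\<close>, \<^const>\<open>Lim\<close> takes a junk value. All uses are for separated sets.
\<close>

definition lower_density :: "real set \<Rightarrow> real" where
  "lower_density \<Gamma> =
     Lim at_top (\<lambda>R::real. INF x::real. real (card (\<Gamma> \<inter> {x - R..x + R})) / (2 * R))"

definition upper_density :: "real set \<Rightarrow> real" where
  "upper_density \<Gamma> =
     Lim at_top (\<lambda>R::real. SUP x::real. real (card (\<Gamma> \<inter> {x - R..x + R})) / (2 * R))"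

definition relatively_dense :: "real set \<Rightarrow> bool" where
  "relatively_dense \<Gamma> \<longleftrightarrow> lower_density \<Gamma> > 0"

text \<open>
  A meromorphic function \<open>G\<close> is encoded as a total function with value \<open>0\<close> at its poles, which is
  what HOL division yields below since \<open>P\<close> and \<open>Q\<close> have no common zeros. There are no poles
  on the real axis, by the last condition on \<open>Q\<close>.
\<close>

definition represents :: "real \<Rightarrow> complex poly \<Rightarrow> complex poly \<Rightarrow> (complex \<Rightarrow> complex) \<Rightarrow> bool" where
  "represents \<alpha> P Q G \<longleftrightarrow>
     P \<noteq> 0 \<and> Q \<noteq> 0 \<and> (\<nexists>w. poly P w = 0 \<and> poly Q w = 0) \<and>
     1 \<le> degree P \<and> degree P < degree Q \<and>
     poly P 0 = 0 \<and>
     (\<forall>x::real. x \<ge> 0 \<longrightarrow> poly Q (of_real x) \<noteq> 0) \<and>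
     (\<forall>z. G z = poly P (exp (of_real \<alpha> * z)) / poly Q (exp (of_real \<alpha> * z)))"

definition class_K :: "real \<Rightarrow> (complex \<Rightarrow> complex) set" where
  "class_K \<alpha> = {G. \<exists>P Q. represents \<alpha> P Q G}"

text \<open>
  The numbers \<open>q(G)\<close> and \<open>k(G)\<close> are relative to \<open>\<alpha>\<close>: for instance
  \<open>class_K \<alpha>\<close> is contained in \<open>class_K (\<alpha> / 2)\<close>, with both numbers doubled.
\<close>

definition q_num :: "real \<Rightarrow> (complex \<Rightarrow> complex) \<Rightarrow> nat" where
  "q_num \<alpha> G = (THE q. \<exists>P Q. represents \<alpha> P Q G \<and> q = degree Q)"

lemma represents_degree_unique:
  assumes "\<alpha> > 0" and 1: "represents \<alpha> P1 Q1 G" and 2: "represents \<alpha> P2 Q2 G"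
  shows "degree Q1 = degree Q2"
proof -
  have "poly ((P1 * Q2 - P2 * Q1) * (Q1 * Q2 * [:0, 1:])) w = 0" for w
  proof (cases "w = 0 \<or> poly Q1 w = 0 \<or> poly Q2 w = 0")
    case False
    define z where "z = Ln w / of_real \<alpha>"
    have "exp (of_real \<alpha> * z) = w" using False \<open>\<alpha> > 0\<close> by (simp add: z_def)
    then have "poly P1 w / poly Q1 w = poly P2 w / poly Q2 w"
      using 1 2 unfolding represents_def by metis
    then show ?thesis using False by (auto simp: field_simps)
  qed auto
  then have "(P1 * Q2 - P2 * Q1) * (Q1 * Q2 * [:0, 1:]) = 0"
    using poly_all_0_iff_0 by blast
  then have "P1 * Q2 = P2 * Q1"
    using 1 2 unfolding represents_def by auto
  moreover have "P1 \<noteq> 0" "P2 \<noteq> 0" "Q1 \<noteq> 0" "Q2 \<noteq> 0"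
    using 1 2 unfolding represents_def by auto
  ultimately have o: "order a P1 + order a Q2 = order a P2 + order a Q1" for a
    using order_mult[of P1 Q2 a] order_mult[of P2 Q1 a] by simp
  have "order a P = 0 \<or> order a Q = 0" if "represents \<alpha> P Q G" for P Q a
    using that by (auto simp: represents_def order_root)
  from this[OF 1] this[OF 2] have "order a Q1 = order a Q2" for a
    using o[of a] by (metis add.right_neutral add_0 add_is_0)
  then have "proots Q1 = proots Q2"
    using \<open>Q1 \<noteq> 0\<close> \<open>Q2 \<noteq> 0\<close> by (intro multiset_eqI) simp
  then show ?thesis by (metis size_proots_complex)
qed

lemma q_num_eq:
  assumes "\<alpha> > 0" and "represents \<alpha> P Q G"
  shows "q_num \<alpha> G = degree Q"
  unfolding q_num_def using assms represents_degree_unique by blast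

text \<open>
  Here \<open>k = 1\<close> always qualifies, and every admissible \<open>k\<close> divides \<open>degree Q\<close>, so the maximum exists.
  With the value \<open>0\<close> at poles, the pointwise equation for all \<open>z\<close> is equivalent to the identity
  of meromorphic functions, since \<open>c = 0\<close> is impossible.
\<close>

definition k_num :: "real \<Rightarrow> (complex \<Rightarrow> complex) \<Rightarrow> nat" where
  "k_num \<alpha> G = (GREATEST k::nat. 0 < k \<and>
     (\<exists>c::complex. \<forall>z::complex.
        G (z + 2 * of_real pi * \<i> / (of_nat k * of_real \<alpha>)) = c * G z))"

text \<open>Extended real root of \<open>x\<close> of order \<open>r\<close>, for real \<open>r > 0\<close>.\<close>

definition ennroot :: "real \<Rightarrow> ennreal \<Rightarrow> ennreal" where
  "ennroot r x = (if x = \<infinity> then \<infinity> else ennreal (enn2real x powr (1 / r)))"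

text \<open>The exponent ranges over \<open>[1,\<infinity>]\<close>; the \<open>l\<^sup>p\<close> norm is the instance with counting measure.\<close>

definition Lp_norm :: "ennreal \<Rightarrow> 'a measure \<Rightarrow> ('a \<Rightarrow> complex) \<Rightarrow> ennreal" where
  "Lp_norm p M f =
     (if f \<notin> borel_measurable M then \<infinity>
      else if p = \<infinity> then esssup M (\<lambda>x. ennreal (norm (f x)))
      else ennroot (enn2real p) (\<integral>\<^sup>+x. ennreal (norm (f x) powr enn2real p) \<partial>M))"

abbreviation lp_norm :: "ennreal \<Rightarrow> real set \<Rightarrow> (real \<Rightarrow> complex) \<Rightarrow> ennreal" where
  "lp_norm p \<Gamma> c \<equiv> Lp_norm p (count_space \<Gamma>) c"

text \<open>A family indexed by \<open>\<Gamma>\<close> is a function on \<^typ>\<open>real\<close> whose values off \<open>\<Gamma>\<close> are irrelevant.\<close>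

definition lp :: "ennreal \<Rightarrow> real set \<Rightarrow> (real \<Rightarrow> complex) set" where
  "lp p \<Gamma> = {c. lp_norm p \<Gamma> c < \<infinity>}"

text \<open>
  For \<open>G\<close> in \<open>class_K \<alpha>\<close>, separated \<open>\<Lambda>\<close> and bounded \<open>d\<close> the series converges absolutely, because
  \<open>G\<close> decays exponentially along the real axis in both directions.
\<close>

definition shift_sum :: "real set \<Rightarrow> (complex \<Rightarrow> complex) \<Rightarrow> (real \<Rightarrow> complex) \<Rightarrow> real \<Rightarrow> complex" where
  "shift_sum \<Lambda> G d = (\<lambda>x::real. \<Sum>\<^sub>\<infinity>l\<in>\<Lambda>. d l * G (of_real (x - l)))"

definition V_space :: "ennreal \<Rightarrow> real set \<Rightarrow> (complex \<Rightarrow> complex) \<Rightarrow> (real \<Rightarrow> complex) set" where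
  "V_space p \<Lambda> G = shift_sum \<Lambda> G ` lp p \<Lambda>"

definition stable_shifts :: "real set \<Rightarrow> (complex \<Rightarrow> complex) \<Rightarrow> bool" where
  "stable_shifts \<Gamma> G \<longleftrightarrow>
     (\<forall>p\<ge>1. \<exists>C1 C2::real. C1 > 0 \<and> C2 > 0 \<and>
        (\<forall>c\<in>lp p \<Gamma>.
           ennreal C1 * lp_norm p \<Gamma> c \<le> Lp_norm p lborel (shift_sum \<Gamma> G c) \<and>
           Lp_norm p lborel (shift_sum \<Gamma> G c) \<le> ennreal C2 * lp_norm p \<Gamma> c))"

definition interpolation_set ::
  "real set \<Rightarrow> ennreal \<Rightarrow> real set \<Rightarrow> (complex \<Rightarrow> complex) \<Rightarrow> bool" where
  "interpolation_set \<Gamma> p \<Lambda> G \<longleftrightarrow>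
     (\<forall>c\<in>lp p \<Gamma>. \<exists>f\<in>V_space p \<Lambda> G. \<forall>\<gamma>\<in>\<Gamma>. f \<gamma> = c \<gamma>)"

end

theory Submission
  imports Defs "HOL-Probability.Distributions"
begin

text \<open>
  Finding \<open>d\<close> with \<open>\<Sum>l. d l * G (g - l) = c g\<close> for all \<open>g \<in> \<Gamma>\<close> means finding a right inverse of the matrix
  \<open>T = (G (g - l))\<close> with rows \<open>g \<in> \<Gamma>\<close> and columns \<open>l \<in> \<Lambda>\<close>. The entries of \<open>T\<close> decay exponentially off the
  diagonal. If the Gram matrix \<open>A = T T\<^sup>*\<close> is bounded from below on \<open>l\<^sup>2(\<Gamma>)\<close>, its inverse inherits exponential
  decay, and \<open>T\<^sup>* A\<^sup>-\<^sup>1\<close> is a right inverse that acts on all \<open>l\<^sup>p\<close> at once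
  (\<open>exp_decay_right_inverse\<close>, \<open>interpolation_of_stable_gram\<close>).

  The lower bound is a sampling inequality for finite sums \<open>f x = \<Sum>g. v g * G (g - x)\<close>. Its core is the pointwise
  estimate \<open>\<bar>f x\<bar> \<le> M * (\<Sum>l. exp (- \<bar>x - l\<bar>) * \<bar>f l\<bar>)\<close> with \<open>l\<close> ranging over \<open>\<Lambda>\<close>
  (\<open>sampling_reconstruction_bound\<close>). Consider the shifts with \<open>g\<close> in a window around \<open>x\<close>. Up to an
  exponential factor their sum is a rational function of a single variable in which each \<open>g\<close> contributes
  \<open>m = q(G) / k(G)\<close> poles, since \<open>G\<close> is essentially a function of \<open>exp (\<alpha> k(G) z)\<close>
  (\<open>rotation_number_structure\<close>). The density condition provides more points of \<open>\<Lambda>\<close> in the window than there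
  are poles, so Lagrange interpolation at these points recovers the function exactly. The logarithm of an
  interpolation coefficient is a difference of two potentials, one of the nodes and one of the poles. The excess of
  nodes makes this difference quadratically large in the distance from \<open>x\<close>
  (\<open>window_potential\<close>), which outweighs all other contributions: these are at most linear, as
  \<open>\<Lambda>\<close> and \<open>\<Gamma>\<close> are separated. Hence the coefficients decay uniformly in the size of the window
  (\<open>interpolation_coefficient_decay\<close>).

  Stability enters through \<open>L\<^sup>2\<close>. The functions \<open>G\<close> and \<open>x \<mapsto> cnj (G (- x))\<close> have the same autocorrelation,
  so stability passes to the reflected shifts (\<open>reflection_preserves_L2\<close>). Integrating the square of the pointwise
  estimate then bounds the \<open>l\<^sup>2\<close> norm of the coefficients by that of the samples
  (\<open>gram_kernel_lower_bound\<close>).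
\<close>

section \<open>Separated sets\<close>

definition gap :: "real \<Rightarrow> real set \<Rightarrow> bool" where
  "gap \<delta> S \<longleftrightarrow> 0 < \<delta> \<and> (\<forall>x\<in>S. \<forall>y\<in>S. x \<noteq> y \<longrightarrow> \<delta> \<le> \<bar>x - y\<bar>)"

lemma separated_gap:
  assumes "separated S" obtains \<delta> where "gap \<delta> S"
  using assms unfolding separated_def uniform_discrete_def gap_def
  by (metis dist_real_def not_less)

lemma gap_uminus: "gap \<delta> S \<Longrightarrow> gap \<delta> (uminus ` S)"
  unfolding gap_def by fastforce

lemma gap_subset: "gap \<delta> S \<Longrightarrow> T \<subseteq> S \<Longrightarrow> gap \<delta> T"
  unfolding gap_def by blast

lemma gap_floor_inj:
  assumes "gap \<delta> S" "\<And>y. y \<in> S \<Longrightarrow> a \<le> y"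
  shows "inj_on (\<lambda>y. nat \<lfloor>(y - a) / \<delta>\<rfloor>) S"
proof (rule inj_onI, rule ccontr)
  fix y z assume yz: "y \<in> S" "z \<in> S" "nat \<lfloor>(y - a) / \<delta>\<rfloor> = nat \<lfloor>(z - a) / \<delta>\<rfloor>" "y \<noteq> z"
  have d: "0 < \<delta>" and ge: "\<delta> \<le> \<bar>y - z\<bar>" using assms(1) yz unfolding gap_def by blast+
  have "0 \<le> (y - a) / \<delta>" "0 \<le> (z - a) / \<delta>" using assms(2) yz d by auto
  then have "\<lfloor>(y - a) / \<delta>\<rfloor> = \<lfloor>(z - a) / \<delta>\<rfloor>" using yz(3) by (simp add: eq_nat_nat_iff)
  then have "\<bar>(y - a) / \<delta> - (z - a) / \<delta>\<bar> < 1" by linarith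
  then have "\<bar>y - z\<bar> < \<delta>" using d by (simp add: diff_divide_distrib[symmetric] abs_divide)
  with ge show False by simp
qed

lemma gap_count:
  assumes "gap \<delta> S" "a \<le> b"
  shows "finite (S \<inter> {a..b})" "real (card (S \<inter> {a..b})) \<le> (b - a) / \<delta> + 1"
proof -
  let ?f = "\<lambda>y. nat \<lfloor>(y - a) / \<delta>\<rfloor>"
  have d: "0 < \<delta>" using assms gap_def by blast
  have inj: "inj_on ?f (S \<inter> {a..b})"
    by (rule gap_floor_inj) (use assms gap_subset in auto)
  have sub: "?f ` (S \<inter> {a..b}) \<subseteq> {..nat \<lfloor>(b - a) / \<delta>\<rfloor>}"
    using d by (auto intro!: nat_mono floor_mono divide_right_mono)
  show fin: "finite (S \<inter> {a..b})" using inj_on_finite[OF inj sub] by simp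
  have "card (S \<inter> {a..b}) \<le> nat \<lfloor>(b - a) / \<delta>\<rfloor> + 1"
    using card_inj_on_le[OF inj sub] by simp
  moreover have "real (nat \<lfloor>(b - a) / \<delta>\<rfloor>) \<le> (b - a) / \<delta>"
    using assms(2) d by (simp add: of_nat_floor)
  ultimately show "real (card (S \<inter> {a..b})) \<le> (b - a) / \<delta> + 1" by linarith
qed

text \<open>
  Rounding \<open>(y - x) / \<delta>\<close> down is injective on a set with gap \<open>\<delta>\<close>, which compares the sum with a
  geometric series. The resulting bound depends on neither the finite set nor its position.
\<close>

lemma gap_exp_sum_right:
  assumes "gap \<delta> F" "finite F" "\<And>y. y \<in> F \<Longrightarrow> x \<le> y" "0 < \<beta>"
  shows "(\<Sum>y\<in>F. exp (- \<beta> * \<bar>x - y\<bar>)) \<le> 1 / (1 - exp (- \<beta> * \<delta>))"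
proof -
  let ?f = "\<lambda>y. nat \<lfloor>(y - x) / \<delta>\<rfloor>" let ?r = "exp (- \<beta> * \<delta>)"
  have d: "0 < \<delta>" using assms gap_def by blast
  have r: "0 < ?r" "?r < 1" using d assms(4) by auto
  have "(\<Sum>y\<in>F. exp (- \<beta> * \<bar>x - y\<bar>)) \<le> (\<Sum>y\<in>F. ?r ^ ?f y)"
  proof (rule sum_mono)
    fix y assume y: "y \<in> F"
    have "real (?f y) \<le> (y - x) / \<delta>" using assms(3)[OF y] d by (simp add: of_nat_floor)
    then have "real (?f y) * \<delta> \<le> y - x" using d by (simp add: field_simps)
    then have "\<beta> * (real (?f y) * \<delta>) \<le> \<beta> * (y - x)" using assms(4) by (intro mult_left_mono) auto
    then have "- \<beta> * \<bar>x - y\<bar> \<le> real (?f y) * (- \<beta> * \<delta>)" using assms(3)[OF y] by (simp add: algebra_simps)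
    then show "exp (- \<beta> * \<bar>x - y\<bar>) \<le> ?r ^ ?f y" by (metis exp_le_cancel_iff exp_of_nat_mult)
  qed
  also have "\<dots> = (\<Sum>n\<in>?f ` F. ?r ^ n)"
    by (subst sum.reindex[OF gap_floor_inj[OF assms(1)]]) (use assms in auto)
  also have "\<dots> \<le> (\<Sum>n. ?r ^ n)"
    by (rule sum_le_suminf) (use r assms in \<open>auto intro: summable_geometric\<close>)
  also have "\<dots> = 1 / (1 - ?r)" using r by (intro suminf_geometric) auto
  finally show ?thesis .
qed

lemma gap_exp_sum_bound:
  assumes "gap \<delta> S" "0 < \<beta>"
  obtains C where "0 < C" "\<And>x F. finite F \<Longrightarrow> F \<subseteq> S \<Longrightarrow> (\<Sum>y\<in>F. exp (- \<beta> * \<bar>x - y\<bar>)) \<le> C"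
proof
  let ?C = "1 / (1 - exp (- \<beta> * \<delta>))"
  have d: "0 < \<delta>" using assms gap_def by blast
  show "0 < 2 * ?C" using d assms by simp
  fix x F assume F: "finite F" "F \<subseteq> S"
  let ?A = "{y\<in>F. x \<le> y}" and ?B = "{y\<in>F. y < x}"
  have 1: "(\<Sum>y\<in>?A. exp (- \<beta> * \<bar>x - y\<bar>)) \<le> ?C"
    by (rule gap_exp_sum_right) (use F assms in \<open>auto intro: gap_subset\<close>)
  have "(\<Sum>y\<in>?B. exp (- \<beta> * \<bar>x - y\<bar>)) = (\<Sum>y\<in>uminus ` ?B. exp (- \<beta> * \<bar>- x - y\<bar>))"
    by (subst sum.reindex) (auto simp: abs_minus_commute intro!: sum.cong)
  also have "\<dots> \<le> ?C"
    by (rule gap_exp_sum_right) (use F assms in \<open>auto intro!: gap_uminus intro: gap_subset\<close>)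
  finally have 2: "(\<Sum>y\<in>?B. exp (- \<beta> * \<bar>x - y\<bar>)) \<le> ?C" .
  have "(\<Sum>y\<in>F. exp (- \<beta> * \<bar>x - y\<bar>))
      = (\<Sum>y\<in>?A. exp (- \<beta> * \<bar>x - y\<bar>)) + (\<Sum>y\<in>?B. exp (- \<beta> * \<bar>x - y\<bar>))"
    using F by (subst sum.union_disjoint[symmetric]) (auto intro!: sum.cong)
  with 1 2 show "(\<Sum>y\<in>F. exp (- \<beta> * \<bar>x - y\<bar>)) \<le> 2 * ?C" by linarith
qed

section \<open>Uniform densities\<close>

text \<open>
  Fekete's lemma for a real parameter: the ratio converges to its supremum, because the second
  assumption makes every value \<open>h R0 / R0\<close> an asymptotic lower bound.
\<close>

lemma tendsto_Sup_ratio: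
  fixes h :: "real \<Rightarrow> real"
  assumes bdd: "\<And>R. 1 \<le> R \<Longrightarrow> h R \<le> M * R"
    and super: "\<And>R0. 1 \<le> R0 \<Longrightarrow> \<exists>K. \<forall>R\<ge>1. h R \<ge> R / R0 * h R0 - K"
  shows "\<exists>l. ((\<lambda>R. h R / R) \<longlongrightarrow> l) at_top"
proof -
  let ?T = "(\<lambda>R. h R / R) ` {1..}"
  define l where "l = Sup ?T"
  have ba: "bdd_above ?T" using bdd by (intro bdd_aboveI[of _ M]) (auto simp: field_simps)
  have up: "h R / R \<le> l" if "1 \<le> R" for R
    unfolding l_def by (rule cSup_upper[OF _ ba]) (use that in auto)
  have "((\<lambda>R. h R / R) \<longlongrightarrow> l) at_top"
  proof (rule tendstoI)
    fix e :: real assume e: "0 < e"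
    have "\<exists>y\<in>?T. l - e / 2 < y"
      using e unfolding l_def by (intro less_cSup_iff[THEN iffD1] ba) auto
    then obtain R0 where R0: "1 \<le> R0" "l - e / 2 < h R0 / R0" by auto
    obtain K where K: "\<And>R. 1 \<le> R \<Longrightarrow> h R \<ge> R / R0 * h R0 - K" using super[OF R0(1)] by blast
    have "dist (h R / R) l < e" if R: "R \<ge> max 1 (2 * \<bar>K\<bar> / e + 1)" for R
    proof -
      have R1: "1 \<le> R" "2 * \<bar>K\<bar> / e < R" using R by auto
      have "\<bar>K\<bar> < e / 2 * R" using R1 e by (simp add: field_simps)
      moreover have "K \<le> \<bar>K\<bar>" by simp
      ultimately have "K / R < e / 2" using R1 by (simp add: field_simps)
      moreover have "h R / R \<ge> h R0 / R0 - K / R"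
        using divide_right_mono[OF K[OF R1(1)], of R] R1 by (simp add: diff_divide_distrib)
      ultimately have "l - e < h R / R" using R0 by linarith
      then show ?thesis using up[OF R1(1)] e by (simp add: dist_real_def)
    qed
    then show "\<forall>\<^sub>F R in at_top. dist (h R / R) l < e"
      unfolding eventually_at_top_linorder by blast
  qed
  then show ?thesis by blast
qed

text \<open>
  Adjacent closed windows share an end point, so each window may lose one point of its count; this
  is why \<open>n - 1\<close> appears, and why it is the count minus one that is superadditive.
\<close>

lemma window_card_lower:
  fixes n :: real
  assumes "gap \<delta> S" "0 \<le> R0" "\<And>x. n \<le> real (card (S \<inter> {x - R0..x + R0}))"
  shows "real j * (n - 1) \<le> real (card (S \<inter> {a..a + 2 * real j * R0}))"
proof (induction j)
  case (Suc j)
  let ?p = "a + 2 * real j * R0"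
  let ?A = "S \<inter> {a..?p}" and ?B = "S \<inter> {?p..?p + 2 * R0}"
  have fin: "finite ?A" "finite ?B"
    using assms(2) by (auto intro!: gap_count[OF assms(1)])
  have eq: "S \<inter> {a..a + 2 * real (Suc j) * R0} = ?A \<union> ?B"
  proof -
    have "a \<le> ?p" using assms(2) by simp
    moreover have "a + 2 * real (Suc j) * R0 = ?p + 2 * R0" by (simp add: algebra_simps)
    moreover have "?p \<le> ?p + 2 * R0" using assms(2) by simp
    ultimately show ?thesis by (metis Int_Un_distrib ivl_disj_un_two_touch(4))
  qed
  have "card (?A \<inter> ?B) \<le> card {?p}" by (rule card_mono) auto
  then have "real (card ?A) + real (card ?B) \<le> real (card (?A \<union> ?B)) + 1"
    using card_Un_Int[OF fin] by simp
  moreover have "n \<le> real (card ?B)"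
    using assms(3)[of "?p + R0"] by (simp add: algebra_simps)
  ultimately show ?case using Suc unfolding eq by (simp add: algebra_simps)
qed simp

text \<open>
  The surplus window accounts for a point at \<open>a\<close> when \<open>j = 0\<close>.
\<close>

lemma window_card_upper:
  fixes n :: real
  assumes "gap \<delta> S" "0 \<le> R0" "\<And>x. real (card (S \<inter> {x - R0..x + R0})) \<le> n"
  shows "real (card (S \<inter> {a..a + 2 * real j * R0})) \<le> (real j + 1) * n"
proof (induction j)
  case 0
  have "card (S \<inter> {a..a}) \<le> card (S \<inter> {a - R0..a + R0})"
    by (rule card_mono) (use assms(2) gap_count[OF assms(1)] in auto)
  then show ?case using assms(3)[of a] by simp
next
  case (Suc j)
  let ?p = "a + 2 * real j * R0"
  let ?A = "S \<inter> {a..?p}" and ?B = "S \<inter> {?p..?p + 2 * R0}"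
  have eq: "S \<inter> {a..a + 2 * real (Suc j) * R0} = ?A \<union> ?B"
  proof -
    have "a \<le> ?p" using assms(2) by simp
    moreover have "a + 2 * real (Suc j) * R0 = ?p + 2 * R0" by (simp add: algebra_simps)
    moreover have "?p \<le> ?p + 2 * R0" using assms(2) by simp
    ultimately show ?thesis by (metis Int_Un_distrib ivl_disj_un_two_touch(4))
  qed
  have "real (card (?A \<union> ?B)) \<le> real (card ?A) + real (card ?B)"
    using card_Un_le[of ?A ?B] by linarith
  moreover have "real (card ?B) \<le> n"
    using assms(3)[of "?p + R0"] by (simp add: algebra_simps)
  ultimately show ?case using Suc unfolding eq by (simp add: algebra_simps)
qed

text \<open>
  A \<^const>\<open>Lim\<close> carries information only once the limit is known to exist; both densities exist by
  Fekete's lemma. For the lower density it is applied to half of the minimal count diminished by one.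
\<close>

lemma lower_density_tendsto:
  assumes "gap \<delta> S"
  shows "((\<lambda>R. INF x::real. real (card (S \<inter> {x - R..x + R})) / (2 * R)) \<longlongrightarrow> lower_density S) at_top"
proof -
  let ?N = "\<lambda>x R. real (card (S \<inter> {x - R..x + R}))"
  define \<phi> where "\<phi> R = (INF x::real. ?N x R / (2 * R))" for R
  have d: "0 < \<delta>" using assms gap_def by blast
  have lo: "\<phi> R \<le> ?N x R / (2 * R)" if "1 \<le> R" for x R
    unfolding \<phi>_def by (rule cINF_lower[OF bdd_belowI[of _ 0]]) (use that in auto)
  have "\<exists>l. ((\<lambda>R. (R * \<phi> R - 1/2) / R) \<longlongrightarrow> l) at_top"
  proof (rule tendsto_Sup_ratio)
    fix R :: real assume R: "1 \<le> R"
    have "R * \<phi> R \<le> R * (?N 0 R / (2 * R))" using lo[OF R, of 0] R by (intro mult_left_mono) auto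
    also have "\<dots> = ?N 0 R / 2" using R by simp
    also have "\<dots> \<le> (2 * R / \<delta> + 1) / 2"
      using gap_count(2)[OF assms, of "- R" R] R by simp
    also have "\<dots> \<le> (1 / \<delta> + 1) * R"
      using R d by (simp add: field_simps)
    finally show "R * \<phi> R - 1/2 \<le> (1 / \<delta> + 1) * R" by simp
  next
    fix R0 :: real assume R0: "1 \<le> R0"
    define h where "h = R0 * \<phi> R0 - 1/2"
    have n: "2 * h + 1 \<le> ?N x R0" for x
      using lo[OF R0, of x] R0 by (simp add: h_def field_simps)
    have "R / R0 * h - (\<bar>h\<bar> + 1/2) \<le> R * \<phi> R - 1/2" if R: "1 \<le> R" for R
    proof -
      define j where "j = nat \<lfloor>R / R0\<rfloor>"
      have "0 \<le> R / R0" using R R0 by simp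
      then have j: "real j \<le> R / R0" "R / R0 - 1 \<le> real j" unfolding j_def by linarith+
      have jR: "real j * R0 \<le> R" using j R0 by (simp add: field_simps)
      have jh: "R / R0 * h - \<bar>h\<bar> \<le> real j * h"
      proof (cases "0 \<le> h")
        case True then show ?thesis using mult_right_mono[OF j(2) True] by (simp add: algebra_simps)
      next
        case False then show ?thesis using mult_right_mono_neg[OF j(1), of h] by simp
      qed
      have "(R / R0 * h - \<bar>h\<bar>) / R \<le> \<phi> R"
        unfolding \<phi>_def
      proof (rule cINF_greatest)
        fix x
        have "real j * (2 * h + 1 - 1) \<le> real (card (S \<inter> {x - R..x - R + 2 * real j * R0}))"
          by (rule window_card_lower[OF assms]) (use R0 n in auto)
        also have "\<dots> \<le> ?N x R"
          using jR R by (auto intro!: card_mono gap_count[OF assms])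
        finally have "2 * (real j * h) \<le> ?N x R" by (simp add: algebra_simps)
        then have "2 * (R / R0 * h - \<bar>h\<bar>) \<le> ?N x R" using jh by (smt (verit))
        then show "(R / R0 * h - \<bar>h\<bar>) / R \<le> ?N x R / (2 * R)"
        proof -
          have "u / R = (2 * u) / (2 * R)" for u by simp
          then show ?thesis using R \<open>2 * (R / R0 * h - \<bar>h\<bar>) \<le> ?N x R\<close>
            by (metis divide_right_mono mult_nonneg_nonneg order_trans zero_le_numeral zero_le_one)
        qed
      qed simp
      then show ?thesis using R by (simp add: pos_divide_le_eq mult.commute)
    qed
    then show "\<exists>K. \<forall>R\<ge>1. R / R0 * (R0 * \<phi> R0 - 1/2) - K \<le> R * \<phi> R - 1/2"
      unfolding h_def by blast
  qed
  then obtain l where l: "((\<lambda>R. (R * \<phi> R - 1/2) / R) \<longlongrightarrow> l) at_top" by blast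
  have "((\<lambda>R::real. 1/2 / R) \<longlongrightarrow> 0) at_top"
    by (intro tendsto_divide_0[OF tendsto_const] filterlim_at_top_imp_at_infinity filterlim_ident)
  from tendsto_add[OF l this] have "((\<lambda>R. (R * \<phi> R - 1/2) / R + 1/2 / R) \<longlongrightarrow> l) at_top" by simp
  moreover have "\<forall>\<^sub>F R in at_top. (R * \<phi> R - 1/2) / R + 1/2 / R = \<phi> R"
    using eventually_gt_at_top[of 0] by eventually_elim (simp add: field_simps)
  ultimately have "(\<phi> \<longlongrightarrow> l) at_top" by (rule Lim_transform_eventually)
  then show ?thesis
    unfolding lower_density_def \<phi>_def[symmetric] using tendsto_Lim[of at_top \<phi> l] by simp
qed

lemma upper_density_tendsto:
  assumes "gap \<delta> S"
  shows "((\<lambda>R. SUP x::real. real (card (S \<inter> {x - R..x + R})) / (2 * R)) \<longlongrightarrow> upper_density S) at_top"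
proof -
  let ?N = "\<lambda>x R. real (card (S \<inter> {x - R..x + R}))"
  define \<phi> where "\<phi> R = (SUP x::real. ?N x R / (2 * R))" for R
  have d: "0 < \<delta>" using assms gap_def by blast
  have up: "?N x R / (2 * R) \<le> \<phi> R" if "1 \<le> R" for x R
  proof -
    have "?N y R / (2 * R) \<le> (2 * R / \<delta> + 1) / (2 * R)" for y
      using gap_count(2)[OF assms, of "y - R" "y + R"] that by (intro divide_right_mono) auto
    then show ?thesis
      unfolding \<phi>_def by (intro cSUP_upper bdd_aboveI) auto
  qed
  have \<phi>0: "0 \<le> \<phi> R" if "1 \<le> R" for R
    using order_trans[OF _ up[OF that, of 0]] that by simp
  have "\<exists>l. ((\<lambda>R. (- (R * \<phi> R)) / R) \<longlongrightarrow> l) at_top"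
  proof (rule tendsto_Sup_ratio[where M = 0])
    fix R :: real assume "1 \<le> R"
    then show "- (R * \<phi> R) \<le> 0 * R" using \<phi>0 by simp
  next
    fix R0 :: real assume R0: "1 \<le> R0"
    have n: "?N x R0 \<le> 2 * R0 * \<phi> R0" for x
      using up[OF R0, of x] R0 by (simp add: field_simps)
    have "R / R0 * - (R0 * \<phi> R0) - 2 * R0 * \<phi> R0 \<le> - (R * \<phi> R)" if R: "1 \<le> R" for R
    proof -
      define j where "j = nat \<lfloor>R / R0\<rfloor> + 1"
      have "0 \<le> R / R0" using R R0 by simp
      then have j: "R / R0 \<le> real j" "real j \<le> R / R0 + 1" unfolding j_def by linarith+
      have jR: "R \<le> real j * R0" using j R0 by (simp add: field_simps)
      have jR0: "0 \<le> real j * R0" using R0 by simp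
      have jR': "x + R \<le> x - R + 2 * real j * R0" for x using jR by simp
      have "\<phi> R \<le> \<phi> R0 + 2 * R0 * \<phi> R0 / R"
        unfolding \<phi>_def[of R]
      proof (rule cSUP_least)
        fix x
        have "x - R \<le> x - R + 2 * real j * R0" using jR0 by linarith
        then have "?N x R \<le> real (card (S \<inter> {x - R..x - R + 2 * real j * R0}))"
          using jR'[of x] by (intro of_nat_mono card_mono gap_count(1)[OF assms]) auto
        also have "\<dots> \<le> (real j + 1) * (2 * R0 * \<phi> R0)"
          by (rule window_card_upper[OF assms]) (use R0 n in auto)
        also have "\<dots> \<le> (R / R0 + 1 + 1) * (2 * R0 * \<phi> R0)"
          using j R0 \<phi>0[OF R0] by (intro mult_right_mono) auto
        also have "\<dots> = 2 * R * \<phi> R0 + 4 * R0 * \<phi> R0" using R0 by (simp add: field_simps)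
        finally show "?N x R / (2 * R) \<le> \<phi> R0 + 2 * R0 * \<phi> R0 / R" using R by (simp add: field_simps)
      qed simp
      then have "R * \<phi> R \<le> R * (\<phi> R0 + 2 * R0 * \<phi> R0 / R)" using R by (intro mult_left_mono) auto
      also have "\<dots> = R * \<phi> R0 + 2 * R0 * \<phi> R0" using R by (simp add: distrib_left)
      finally show ?thesis using R0 by simp
    qed
    then show "\<exists>K. \<forall>R\<ge>1. R / R0 * - (R0 * \<phi> R0) - K \<le> - (R * \<phi> R)" by blast
  qed
  then obtain l where l: "((\<lambda>R. (- (R * \<phi> R)) / R) \<longlongrightarrow> l) at_top" by blast
  have "\<forall>\<^sub>F R in at_top. - ((- (R * \<phi> R)) / R) = \<phi> R"
    using eventually_gt_at_top[of 0] by eventually_elim simp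
  with tendsto_minus[OF l] have "(\<phi> \<longlongrightarrow> - l) at_top" by (rule Lim_transform_eventually)
  then show ?thesis
    unfolding upper_density_def \<phi>_def[symmetric] using tendsto_Lim[of at_top \<phi> "- l"] by simp
qed

lemma lower_density_card:
  assumes "gap \<delta> S" "d < lower_density S"
  obtains R1 where "1 \<le> R1" "\<And>a b. 2 * R1 \<le> b - a \<Longrightarrow> d * (b - a) \<le> real (card (S \<inter> {a..b}))"
proof -
  obtain R1 where R1: "\<And>R. R1 \<le> R \<Longrightarrow> d < (INF x::real. real (card (S \<inter> {x - R..x + R})) / (2 * R))"
    using order_tendstoD(1)[OF lower_density_tendsto[OF assms(1)] assms(2)]
    unfolding eventually_at_top_linorder by blast
  show thesis
  proof (rule that[of "max 1 R1"])
    fix a b :: real assume ab: "2 * max 1 R1 \<le> b - a"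
    define R where "R = (b - a) / 2"
    define x where "x = (a + b) / 2"
    have R: "R1 \<le> R" "1 \<le> R" using ab by (auto simp: R_def)
    have "(INF x::real. real (card (S \<inter> {x - R..x + R})) / (2 * R))
        \<le> real (card (S \<inter> {x - R..x + R})) / (2 * R)"
      by (rule cINF_lower[OF bdd_belowI[of _ 0]]) (use R in auto)
    with R1[OF R(1)] have "d < real (card (S \<inter> {x - R..x + R})) / (2 * R)" by linarith
    moreover have "x - R = a" "x + R = b" "2 * R = b - a" by (simp_all add: x_def R_def field_simps)
    ultimately show "d * (b - a) \<le> real (card (S \<inter> {a..b}))" using R by (simp add: pos_less_divide_eq)
  qed simp
qed

lemma upper_density_card:
  assumes "gap \<delta> S" "upper_density S < d"
  obtains R1 where "1 \<le> R1" "\<And>a b. 2 * R1 \<le> b - a \<Longrightarrow> real (card (S \<inter> {a..b})) \<le> d * (b - a)"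
proof -
  obtain R1 where R1: "\<And>R. R1 \<le> R \<Longrightarrow> (SUP x::real. real (card (S \<inter> {x - R..x + R})) / (2 * R)) < d"
    using order_tendstoD(2)[OF upper_density_tendsto[OF assms(1)] assms(2)]
    unfolding eventually_at_top_linorder by blast
  show thesis
  proof (rule that[of "max 1 R1"])
    fix a b :: real assume ab: "2 * max 1 R1 \<le> b - a"
    define R where "R = (b - a) / 2"
    define x where "x = (a + b) / 2"
    have R: "R1 \<le> R" "1 \<le> R" using ab by (auto simp: R_def)
    have "real (card (S \<inter> {y - R..y + R})) / (2 * R) \<le> (2 * R / \<delta> + 1) / (2 * R)" for y
      using gap_count(2)[OF assms(1), of "y - R" "y + R"] R by (intro divide_right_mono) auto
    then have "real (card (S \<inter> {x - R..x + R})) / (2 * R)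
        \<le> (SUP x::real. real (card (S \<inter> {x - R..x + R})) / (2 * R))"
      by (intro cSUP_upper bdd_aboveI) auto
    with R1[OF R(1)] have "real (card (S \<inter> {x - R..x + R})) / (2 * R) < d" by linarith
    moreover have "x - R = a" "x + R = b" "2 * R = b - a" by (simp_all add: x_def R_def field_simps)
    ultimately show "real (card (S \<inter> {a..b})) \<le> d * (b - a)" using R by (simp add: pos_divide_less_eq)
  qed simp
qed

text \<open>
  The only form in which the densities are used below: up to an additive constant, every interval
  contains more than \<open>m\<close> times as many points of \<open>\<Lambda>\<close> as of \<open>\<Gamma>\<close>, with a surplus proportional to its
  length. Long intervals obey the densities, and the constant absorbs the short ones.
\<close>

lemma density_excess:
  fixes m :: nat
  assumes "gap \<delta> \<Lambda>" "gap \<eta> \<Gamma>" "real m * upper_density \<Gamma> < lower_density \<Lambda>"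
  obtains c C where "0 < c" "\<And>a b. a \<le> b \<Longrightarrow>
    real m * real (card (\<Gamma> \<inter> {a..b})) + c * (b - a) - C \<le> real (card (\<Lambda> \<inter> {a..b}))"
proof -
  define \<epsilon> where "\<epsilon> = (lower_density \<Lambda> - real m * upper_density \<Gamma>) / (real m + 2)"
  have \<epsilon>: "0 < \<epsilon>" using assms(3) by (simp add: \<epsilon>_def)
  define c where "c = (lower_density \<Lambda> - \<epsilon>) - real m * (upper_density \<Gamma> + \<epsilon>)"
  have "\<epsilon> * (real m + 2) = lower_density \<Lambda> - real m * upper_density \<Gamma>" by (simp add: \<epsilon>_def)
  then have "c = \<epsilon>" unfolding c_def by (simp add: algebra_simps)
  then have c: "0 < c" using \<epsilon> by simp
  obtain R1 where R1: "1 \<le> R1"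
    "\<And>a b. 2 * R1 \<le> b - a \<Longrightarrow> (lower_density \<Lambda> - \<epsilon>) * (b - a) \<le> real (card (\<Lambda> \<inter> {a..b}))"
    using lower_density_card[OF assms(1), of "lower_density \<Lambda> - \<epsilon>"] \<epsilon> by auto
  obtain R2 where R2: "1 \<le> R2"
    "\<And>a b. 2 * R2 \<le> b - a \<Longrightarrow> real (card (\<Gamma> \<inter> {a..b})) \<le> (upper_density \<Gamma> + \<epsilon>) * (b - a)"
    using upper_density_card[OF assms(2), of "upper_density \<Gamma> + \<epsilon>"] \<epsilon> by auto
  have \<eta>: "0 < \<eta>" using assms(2) gap_def by blast
  define T where "T = 2 * (R1 + R2)"
  define C where "C = real m * (T / \<eta> + 1) + c * T"
  have C0: "0 \<le> C" using c R1 R2 \<eta> by (simp add: C_def T_def)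
  show thesis
  proof (rule that[OF c, of C])
    fix a b :: real assume ab: "a \<le> b"
    show "real m * real (card (\<Gamma> \<inter> {a..b})) + c * (b - a) - C \<le> real (card (\<Lambda> \<inter> {a..b}))"
    proof (cases "T \<le> b - a")
      case True
      have "real m * real (card (\<Gamma> \<inter> {a..b})) \<le> real m * ((upper_density \<Gamma> + \<epsilon>) * (b - a))"
        using R2(2)[of b a] True R1 R2 by (intro mult_left_mono) (auto simp: T_def)
      moreover have "(lower_density \<Lambda> - \<epsilon>) * (b - a) \<le> real (card (\<Lambda> \<inter> {a..b}))"
        using R1(2)[of b a] True R1 R2 by (auto simp: T_def)
      moreover have "c * (b - a) = (lower_density \<Lambda> - \<epsilon>) * (b - a) - real m * ((upper_density \<Gamma> + \<epsilon>) * (b - a))"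
        by (simp add: c_def algebra_simps)
      ultimately show ?thesis using C0 by linarith
    next
      case False
      have "real (card (\<Gamma> \<inter> {a..b})) \<le> (b - a) / \<eta> + 1" by (rule gap_count[OF assms(2) ab])
      also have "\<dots> \<le> T / \<eta> + 1" using False \<eta> by (intro add_right_mono divide_right_mono) auto
      finally have "real m * real (card (\<Gamma> \<inter> {a..b})) \<le> real m * (T / \<eta> + 1)" by (intro mult_left_mono) auto
      moreover have "c * (b - a) \<le> c * T" using False c by (intro mult_left_mono) auto
      ultimately show ?thesis unfolding C_def by linarith
    qed
  qed
qed

section \<open>The structure of the generator\<close>

text \<open>
  Two reduced fractions that agree up to a constant have the same poles with the same orders.
\<close>

lemma coprime_denominators_proportional:
  fixes P Q :: "complex poly"
  assumes "P * Q' = smult c (P' * Q)" "c \<noteq> 0" "P \<noteq> 0" "Q \<noteq> 0" "P' \<noteq> 0" "Q' \<noteq> 0"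
    and "\<nexists>w. poly P w = 0 \<and> poly Q w = 0" "\<nexists>w. poly P' w = 0 \<and> poly Q' w = 0"
  shows "smult (lead_coeff Q) Q' = smult (lead_coeff Q') Q"
proof -
  have "order a (P * Q') = order a (P' * Q)" for a unfolding assms(1) using assms(2) by (rule order_smult)
  moreover have "P * Q' \<noteq> 0" "P' * Q \<noteq> 0" using assms by auto
  ultimately have o: "order a P + order a Q' = order a P' + order a Q" for a
    by (metis order_mult)
  have "order a P = 0 \<or> order a Q = 0" "order a P' = 0 \<or> order a Q' = 0" for a
    using assms by (auto simp: order_root)
  then have "order a Q = order a Q'" for a
    using o[of a] by (metis add.right_neutral add_0 add_is_0)
  then have "proots Q = proots Q'"
    using assms by (intro multiset_eqI) simp
  then have "\<exists>R. smult (lead_coeff Q) R = Q \<and> smult (lead_coeff Q') R = Q'"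
    by (metis complex_poly_decompose_multiset)
  then show ?thesis by (metis mult.commute smult_smult)
qed

lemma exp_surj:
  assumes "0 < \<alpha>" "w \<noteq> 0"
  obtains z where "exp (complex_of_real \<alpha> * z) = w"
  by (rule that[of "Ln w / of_real \<alpha>"]) (use assms in simp)

text \<open>
  Write \<open>R = P / Q\<close>. The symmetry of \<open>G\<close> says \<open>R (\<zeta> w) = c R w\<close> with a primitive \<open>k\<close>-th root of unity
  \<open>\<zeta>\<close>. Both sides are reduced fractions, hence \<open>Q (\<zeta> w)\<close> is a multiple of \<open>Q w\<close>, and it equals \<open>Q w\<close>
  because \<open>Q 0 \<noteq> 0\<close>; consequently \<open>P (\<zeta> w) = c P w\<close>. Now compare coefficients.
\<close>

lemma rotation_invariance:
  assumes \<alpha>: "0 < \<alpha>" and rep: "represents \<alpha> P Q G" and k: "0 < (k::nat)"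
    and sym: "\<And>z. G (z + 2 * of_real pi * \<i> / (of_nat k * of_real \<alpha>)) = c * G z"
  defines "\<zeta> \<equiv> exp (2 * of_real pi * \<i> / of_nat k)"
  shows "\<And>i. coeff Q i \<noteq> 0 \<Longrightarrow> k dvd i" "\<And>i. coeff P i \<noteq> 0 \<Longrightarrow> \<zeta> ^ i = c"
proof -
  define P' where "P' = P \<circ>\<^sub>p [:0, \<zeta>:]"
  define Q' where "Q' = Q \<circ>\<^sub>p [:0, \<zeta>:]"
  have \<zeta>0: "\<zeta> \<noteq> 0" by (simp add: \<zeta>_def)
  have r: "P \<noteq> 0" "Q \<noteq> 0" "\<nexists>w. poly P w = 0 \<and> poly Q w = 0" "poly P 0 = 0"
    and G: "\<And>z. G z = poly P (exp (of_real \<alpha> * z)) / poly Q (exp (of_real \<alpha> * z))"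
    using rep unfolding represents_def by auto
  have p': "poly P' w = poly P (\<zeta> * w)" "poly Q' w = poly Q (\<zeta> * w)" for w
    by (simp_all add: P'_def Q'_def poly_pcompose mult.commute)
  have nz: "P' \<noteq> 0" "Q' \<noteq> 0"
    unfolding P'_def Q'_def using r \<zeta>0 by (simp_all add: pcompose_eq_0_iff)
  have eq: "poly P (\<zeta> * w) / poly Q (\<zeta> * w) = c * (poly P w / poly Q w)" if w: "w \<noteq> 0" for w
  proof -
    obtain z where z: "exp (of_real \<alpha> * z) = w" using exp_surj[OF \<alpha> w] by blast
    have "exp (of_real \<alpha> * (z + 2 * of_real pi * \<i> / (of_nat k * of_real \<alpha>))) = \<zeta> * w"
    proof -
      have "of_real \<alpha> * (z + 2 * of_real pi * \<i> / (of_nat k * of_real \<alpha>))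
          = 2 * of_real pi * \<i> / of_nat k + of_real \<alpha> * z"
        using \<alpha> k by (simp add: field_simps)
      then show ?thesis using z by (simp add: exp_add \<zeta>_def)
    qed
    then show ?thesis using sym[of z] z unfolding G by simp
  qed
  \<comment> \<open>The extra factor removes the points where a quotient takes its default value or \<open>w\<close> is not an exponential.\<close>
  have "poly ((P' * Q - smult c (P * Q')) * (Q * Q' * [:0, 1:])) w = 0" for w
  proof (cases "w = 0 \<or> poly Q w = 0 \<or> poly Q' w = 0")
    case False
    then show ?thesis using eq[of w] by (auto simp: p' field_simps)
  qed auto
  then have "(P' * Q - smult c (P * Q')) * (Q * Q' * [:0, 1:]) = 0" using poly_all_0_iff_0 by blast
  then have PQ: "P' * Q = smult c (P * Q')" using r nz by auto
  have c0: "c \<noteq> 0" using PQ r nz by auto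
  have nc: "\<nexists>w. poly P' w = 0 \<and> poly Q' w = 0" using r(3) by (auto simp: p')
  have Q0: "poly Q 0 \<noteq> 0" using r by metis
  have "smult (lead_coeff Q') Q = smult (lead_coeff Q) Q'"
    by (rule coprime_denominators_proportional[OF PQ c0]) (use r nz nc in auto)
  then have "lead_coeff Q' * poly Q 0 = lead_coeff Q * poly Q' 0" by (metis poly_smult)
  then have "lead_coeff Q' = lead_coeff Q" using Q0 by (simp add: p')
  with \<open>smult (lead_coeff Q') Q = smult (lead_coeff Q) Q'\<close> have QQ: "Q' = Q"
    using r by (metis leading_coeff_0_iff smult_cancel)
  have "Q * (P' - smult c P) = 0" using PQ QQ by (simp add: algebra_simps)
  then have PP: "P' = smult c P" using r by simp
  have co: "coeff (R \<circ>\<^sub>p [:0, \<zeta>:]) i = \<zeta> ^ i * coeff R i" for R i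
    by (simp add: coeff_pcompose_linear mult.commute)
  show "\<zeta> ^ i = c" if "coeff P i \<noteq> 0" for i
    using co[of P i] PP that unfolding P'_def by simp
  show "k dvd i" if "coeff Q i \<noteq> 0" for i
  proof -
    have "\<zeta> ^ i = 1" using co[of Q i] QQ that unfolding Q'_def by simp
    then have "exp (2 * of_real pi * \<i> * (of_nat i / of_nat k)) = 1"
      unfolding \<zeta>_def exp_of_nat_mult[symmetric] by (simp add: field_simps)
    then obtain n :: int where "2 * pi * (real i / real k) = real_of_int (2 * n) * pi"
      unfolding exp_eq_1 by auto
    then have "real i = real_of_int n * real k" using k by (simp add: field_simps)
    then have "int i = n * int k" by (metis of_int_eq_iff of_int_mult of_int_of_nat_eq)
    then show ?thesis by (metis dvd_triv_right int_dvd_int_iff)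
  qed
qed

lemma poly_residue_class:
  fixes R :: "complex poly"
  assumes "0 < k" "a < k" "\<And>i. coeff R i \<noteq> 0 \<Longrightarrow> i mod k = a" "degree R < k * N"
  defines "R1 \<equiv> (\<Sum>j<N. monom (coeff R (a + k * j)) j)"
  shows "poly R w = w ^ a * poly R1 (w ^ k)"
proof -
  have "poly R w = (\<Sum>i<k * N. coeff R i * w ^ i)"
    unfolding poly_altdef
    by (rule sum.mono_neutral_left) (use assms(4) le_degree in \<open>auto intro: le_less_trans\<close>)
  also have "\<dots> = (\<Sum>i\<in>(\<lambda>j. a + k * j) ` {..<N}. coeff R i * w ^ i)"
  proof (rule sum.mono_neutral_right)
    have "a + k * j < k * N" if "j < N" for j
    proof -
      have "k * Suc j \<le> k * N" using that by (intro mult_left_mono) auto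
      then show ?thesis using assms(2) by simp
    qed
    then show "(\<lambda>j. a + k * j) ` {..<N} \<subseteq> {..<k * N}" by auto
    show "\<forall>i\<in>{..<k * N} - (\<lambda>j. a + k * j) ` {..<N}. coeff R i * w ^ i = 0"
    proof
      fix i assume i: "i \<in> {..<k * N} - (\<lambda>j. a + k * j) ` {..<N}"
      have "coeff R i = 0"
      proof (rule ccontr)
        assume "coeff R i \<noteq> 0"
        then have "i mod k = a" using assms(3) by blast
        then have "i = a + k * (i div k)" by (metis mod_mult_div_eq)
        moreover have "i div k < N" using i assms(1) by (simp add: less_mult_imp_div_less mult.commute)
        ultimately show False using i by blast
      qed
      then show "coeff R i * w ^ i = 0" by simp
    qed
  qed auto
  also have "\<dots> = (\<Sum>j<N. coeff R (a + k * j) * w ^ (a + k * j))"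
    by (subst sum.reindex) (use assms(1) in \<open>auto simp: inj_on_def\<close>)
  also have "\<dots> = w ^ a * poly R1 (w ^ k)"
  proof -
    have "w ^ (a + k * j) = w ^ a * (w ^ k) ^ j" for j by (simp add: power_add power_mult)
    then show ?thesis by (simp add: R1_def poly_sum poly_monom sum_distrib_left mult_ac)
  qed
  finally show ?thesis .
qed

text \<open>
  Up to the factor \<open>w ^ a\<close>, the function \<open>P / Q\<close> depends on \<open>w ^ k\<close> only, with \<open>k = k_num \<alpha> G\<close>. In the
  variable \<open>w ^ k\<close> it has only \<open>m = q_num \<alpha> G / k\<close> poles, and this is where the quotient in
  the density condition comes from. The maximum that defines \<^const>\<open>k_num\<close> exists since every admissible
  number divides \<open>degree Q\<close>.
\<close>

lemma rotation_number_structure: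
  assumes \<alpha>: "0 < \<alpha>" and rep: "represents \<alpha> P Q G"
  obtains m a P1 Q1 where "0 < k_num \<alpha> G" "degree Q = k_num \<alpha> G * m" "0 < m" "degree Q1 = m" "degree P1 < m"
    "\<And>s::real. 0 \<le> s \<Longrightarrow> poly Q1 (of_real s) \<noteq> 0"
    "\<And>w. poly P w = w ^ a * poly P1 (w ^ k_num \<alpha> G)" "\<And>w. poly Q w = poly Q1 (w ^ k_num \<alpha> G)"
proof -
  let ?S = "\<lambda>k::nat. 0 < k \<and> (\<exists>c::complex. \<forall>z::complex.
        G (z + 2 * of_real pi * \<i> / (of_nat k * of_real \<alpha>)) = c * G z)"
  define k where "k = k_num \<alpha> G"
  have r: "P \<noteq> 0" "Q \<noteq> 0" "degree P < degree Q"
    and Qpos: "\<And>x::real. 0 \<le> x \<Longrightarrow> poly Q (of_real x) \<noteq> 0"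
    and G: "\<And>z. G z = poly P (exp (of_real \<alpha> * z)) / poly Q (exp (of_real \<alpha> * z))"
    using rep unfolding represents_def by auto
  have S1: "?S 1"
  proof -
    have "exp (of_real \<alpha> * (z + 2 * of_real pi * \<i> / of_real \<alpha>)) = exp (of_real \<alpha> * z)" for z
      using \<alpha> by (simp add: distrib_left exp_add)
    then show ?thesis unfolding G by (auto intro!: exI[of _ 1])
  qed
  have bound: "j \<le> degree Q" if "?S j" for j
  proof -
    from that obtain c where j: "0 < j" "\<forall>z. G (z + 2 * of_real pi * \<i> / (of_nat j * of_real \<alpha>)) = c * G z"
      by blast
    have "j dvd degree Q"
      by (rule rotation_invariance(1)[OF \<alpha> rep j(1) j(2)[rule_format]]) (use r in simp)
    then show ?thesis using r(3) by (intro dvd_imp_le) auto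
  qed
  have Sk: "?S k"
    unfolding k_def k_num_def using GreatestI_nat[of ?S 1 "degree Q"] S1 bound by blast
  then obtain c where k: "0 < k"
    and "\<forall>z. G (z + 2 * of_real pi * \<i> / (of_nat k * of_real \<alpha>)) = c * G z" by blast
  then have c: "\<And>z. G (z + 2 * of_real pi * \<i> / (of_nat k * of_real \<alpha>)) = c * G z" by blast
  define \<zeta> :: complex where "\<zeta> = exp (2 * of_real pi * \<i> / of_nat k)"
  have Qk: "k dvd i" if "coeff Q i \<noteq> 0" for i
    using rotation_invariance(1)[OF \<alpha> rep k c] that by blast
  have Pk: "\<zeta> ^ i = c" if "coeff P i \<noteq> 0" for i
    using rotation_invariance(2)[OF \<alpha> rep k c] that unfolding \<zeta>_def by blast
  have \<zeta>k: "\<zeta> ^ k = 1"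
    unfolding \<zeta>_def exp_of_nat_mult[symmetric] using k by simp
  obtain m where m: "degree Q = k * m" using Qk[of "degree Q"] r by (auto simp: leading_coeff_neq_0)
  have m0: "0 < m" using r(3) m by (cases m) auto
  define a where "a = degree P mod k"
  have Pa: "i mod k = a" if "coeff P i \<noteq> 0" for i
  proof -
    have red: "\<zeta> ^ j = \<zeta> ^ (j mod k)" for j
      by (metis \<zeta>k mod_mult_div_eq mult.right_neutral power_add power_mult power_one)
    have e: "\<zeta> ^ j = exp (\<i> * of_real (2 * pi * real j / real k))" for j
      unfolding \<zeta>_def exp_of_nat_mult[symmetric] by (simp add: field_simps)
    have "\<zeta> ^ (i mod k) = \<zeta> ^ (degree P mod k)"
      using Pk[OF that] Pk[of "degree P"] r red by (metis leading_coeff_0_iff)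
    then have "cis (2 * pi * real (i mod k) / real k) = cis (2 * pi * real a / real k)"
      unfolding e a_def cis_conv_exp .
    then have "sin (2 * pi * real (i mod k) / real k) = sin (2 * pi * real a / real k)"
        "cos (2 * pi * real (i mod k) / real k) = cos (2 * pi * real a / real k)"
      by (metis cis.sel)+
    then have "\<exists>n::int. 2 * pi * real (i mod k) / real k = 2 * pi * real a / real k + 2 * pi * n"
      using sin_cos_eq_iff[THEN iffD1, OF conjI] by blast
    then obtain n :: int where n: "2 * pi * real (i mod k) / real k = 2 * pi * real a / real k + 2 * pi * n" ..
    have "real (i mod k) = real a + of_int n * real k"
    proof -
      have "2 * pi * real (i mod k) = (2 * pi) * (real a + of_int n * real k)"
        using n k by (simp add: field_simps)
      then show ?thesis by (metis (no_types) mult_cancel_left mult_eq_0_iff pi_neq_zero zero_neq_numeral)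
    qed
    then have n': "int (i mod k) = int a + n * int k"
      by (metis (mono_tags, lifting) of_int_add of_int_eq_iff of_int_mult of_int_of_nat_eq)
    have "int (i mod k) mod int k = int a mod int k" unfolding n' by simp
    moreover have "i mod k < k" "a < k" using k by (auto simp: a_def)
    ultimately show ?thesis by simp
  qed
  define P1 where "P1 = (\<Sum>j<m. monom (coeff P (a + k * j)) j)"
  define Q1 where "Q1 = (\<Sum>j<Suc m. monom (coeff Q (0 + k * j)) j)"
  have Pw: "poly P w = w ^ a * poly P1 (w ^ k)" for w
    unfolding P1_def by (rule poly_residue_class[OF k _ Pa]) (use k r m in \<open>auto simp: a_def\<close>)
  have Qw: "poly Q w = poly Q1 (w ^ k)" for w
  proof -
    have "poly Q w = w ^ 0 * poly Q1 (w ^ k)"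
      unfolding Q1_def by (rule poly_residue_class) (use k Qk r m in auto)
    then show ?thesis by simp
  qed
  have dP1: "degree P1 < m"
    unfolding P1_def using m0
    by (intro degree_sum_less) (auto intro: order.strict_trans1[OF degree_monom_le])
  have cQ1: "coeff Q1 n = (if n < Suc m then coeff Q (k * n) else 0)" for n
    unfolding Q1_def coeff_sum coeff_monom by (subst sum.delta) auto
  have dQ1: "degree Q1 = m"
  proof (rule antisym)
    show "degree Q1 \<le> m" by (rule degree_le) (simp add: cQ1)
    have "coeff Q (k * m) \<noteq> 0" using r(2) m by (metis leading_coeff_neq_0)
    then show "m \<le> degree Q1" by (intro le_degree) (simp add: cQ1)
  qed
  have Q1pos: "poly Q1 (of_real s) \<noteq> 0" if "0 \<le> s" for s :: real
  proof -
    have "root k s ^ k = s" using k that by simp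
    then have "poly Q1 (of_real s) = poly Q (of_real (root k s))" by (metis Qw of_real_power)
    then show ?thesis using Qpos[of "root k s"] that k by simp
  qed
  show thesis
    by (rule that[of m Q1 P1 a]) (use k m m0 dQ1 dP1 Q1pos Pw Qw in \<open>auto simp: k_def\<close>)
qed

lemma poly_log_lipschitz:
  fixes p :: "complex poly"
  assumes nz: "\<And>s::real. 0 \<le> s \<Longrightarrow> s \<le> 1 \<Longrightarrow> poly p (of_real s) \<noteq> 0"
  obtains C where "0 \<le> C" "\<And>s::real. 0 \<le> s \<Longrightarrow> s \<le> 1 \<Longrightarrow>
    \<bar>ln (norm (poly p (of_real s))) - ln (norm (poly p 0))\<bar> \<le> C * s"
proof -
  obtain p0 q where p: "p = pCons p0 q" by (cases p)
  obtain M where M: "0 < M" "\<And>z. norm z \<le> 1 \<Longrightarrow> norm (poly q z) \<le> M" using poly_bound_exists by metis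
  have "continuous_on {0..1} (\<lambda>s::real. norm (poly p (of_real s)))" by (intro continuous_intros)
  then obtain s0 where s0: "0 \<le> s0" "s0 \<le> 1"
    "\<And>s::real. 0 \<le> s \<Longrightarrow> s \<le> 1 \<Longrightarrow> norm (poly p (of_real s0)) \<le> norm (poly p (of_real s))"
    using continuous_attains_inf[of "{0..1::real}" "\<lambda>s::real. norm (poly p (of_real s))"] by force
  define b where "b = norm (poly p (of_real s0))"
  have b: "0 < b" using nz s0 by (simp add: b_def)
  have ln_diff: "ln u - ln v \<le> \<bar>u - v\<bar> / b" if "b \<le> u" "b \<le> v" for u v
  proof -
    have "ln u - ln v = ln (u / v)" using that b by (simp add: ln_div)
    also have "\<dots> \<le> u / v - 1" using that b by (intro ln_le_minus_one) auto
    also have "\<dots> = (u - v) / v" using that b by (simp add: field_simps)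
    also have "\<dots> \<le> \<bar>u - v\<bar> / v" using that b by (intro divide_right_mono) auto
    also have "\<dots> \<le> \<bar>u - v\<bar> / b" using that b by (intro divide_left_mono) auto
    finally show ?thesis .
  qed
  show thesis
  proof (rule that[of "M / b"])
    show "0 \<le> M / b" using M b by simp
    fix s :: real assume s: "0 \<le> s" "s \<le> 1"
    let ?u = "norm (poly p (of_real s))" and ?v = "norm (poly p 0)"
    have u: "b \<le> ?u" "b \<le> ?v" using s0(3)[OF s] s0(3)[of 0] by (auto simp: b_def)
    have "\<bar>?u - ?v\<bar> \<le> norm (poly p (of_real s) - poly p 0)" by (rule norm_triangle_ineq3)
    also have "\<dots> = s * norm (poly q (of_real s))" using s by (simp add: p norm_mult)
    also have "\<dots> \<le> s * M" using M(2)[of "of_real s"] s by (intro mult_left_mono) auto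
    finally have d: "\<bar>?u - ?v\<bar> \<le> s * M" .
    have "\<bar>ln ?u - ln ?v\<bar> \<le> \<bar>?u - ?v\<bar> / b"
      using ln_diff[OF u] ln_diff[OF u(2,1)] by (simp add: abs_minus_commute abs_le_iff)
    also have "\<dots> \<le> s * M / b" using d b by (intro divide_right_mono) auto
    finally show "\<bar>ln ?u - ln ?v\<bar> \<le> M / b * s" by (simp add: mult.commute)
  qed
qed

text \<open>
  Along the positive axis \<open>\<bar>Q\<bar>\<close> behaves like a constant near \<open>0\<close> and like another constant times the
  leading power near infinity. The exponentially small error is what matters: summed over the
  translates by a separated set it stays bounded, so that a product over arbitrarily many
  translates is controlled.
\<close>

lemma poly_exp_log_asymptotics:
  fixes Q :: "complex poly"
  assumes nz: "\<And>s::real. 0 \<le> s \<Longrightarrow> poly Q (of_real s) \<noteq> 0"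
  obtains C A B where "0 \<le> C" "\<And>t::real.
    \<bar>ln (norm (poly Q (of_real (exp t)))) - real (degree Q) * max t 0 - (if 0 < t then A else B)\<bar>
      \<le> C * exp (- \<bar>t\<bar>)"
proof -
  obtain C1 where C1: "0 \<le> C1" "\<And>s::real. 0 \<le> s \<Longrightarrow> s \<le> 1 \<Longrightarrow>
    \<bar>ln (norm (poly Q (of_real s))) - ln (norm (poly Q 0))\<bar> \<le> C1 * s"
    using poly_log_lipschitz[of Q] nz by blast
  have Q0: "Q \<noteq> 0" using nz[of 0] by auto
  have rev: "poly (reflect_poly Q) (of_real s) = of_real s ^ degree Q * poly Q (of_real (inverse s))"
    if "s \<noteq> 0" for s :: real using that by (simp add: poly_reflect_poly_nz)
  have "poly (reflect_poly Q) (of_real s) \<noteq> 0" if "0 \<le> s" for s :: real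
    using that rev[of s] nz[of "inverse s"] Q0 by (cases "s = 0") auto
  then obtain C2 where C2: "0 \<le> C2" "\<And>s::real. 0 \<le> s \<Longrightarrow> s \<le> 1 \<Longrightarrow>
    \<bar>ln (norm (poly (reflect_poly Q) (of_real s))) - ln (norm (poly (reflect_poly Q) 0))\<bar> \<le> C2 * s"
    using poly_log_lipschitz[of "reflect_poly Q"] by blast
  show thesis
  proof (rule that[of "C1 + C2" "ln (norm (poly (reflect_poly Q) 0))" "ln (norm (poly Q 0))"])
    show "0 \<le> C1 + C2" using C1 C2 by simp
    fix t :: real
    show "\<bar>ln (norm (poly Q (of_real (exp t)))) - real (degree Q) * max t 0
        - (if 0 < t then ln (norm (poly (reflect_poly Q) 0)) else ln (norm (poly Q 0)))\<bar>
      \<le> (C1 + C2) * exp (- \<bar>t\<bar>)"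
    proof (cases "0 < t")
      case True
      have "poly (reflect_poly Q) (of_real (exp (- t)))
          = of_real (exp (- t)) ^ degree Q * poly Q (of_real (exp t))"
        using rev[of "exp (- t)"] by (simp add: exp_minus)
      then have "norm (poly (reflect_poly Q) (of_real (exp (- t))))
          = exp (- (real (degree Q) * t)) * norm (poly Q (of_real (exp t)))"
        by (simp only: norm_mult norm_power norm_of_real abs_exp_cancel exp_of_nat_mult[symmetric]) simp
      then have "ln (norm (poly (reflect_poly Q) (of_real (exp (- t)))))
          = - (real (degree Q) * t) + ln (norm (poly Q (of_real (exp t))))"
        using nz[of "exp t"] by (simp add: ln_mult)
      moreover have "0 \<le> C1 * exp (- t)" using C1 by simp
      ultimately show ?thesis using C2(2)[of "exp (- t)"] True by (simp add: distrib_right)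
    next
      case False
      have "0 \<le> C2 * exp t" using C2 by simp
      then show ?thesis using C1(2)[of "exp t"] False by (simp add: distrib_right)
    qed
  qed
qed

lemma poly_exp_bound:
  fixes R :: "complex poly"
  obtains C where "0 \<le> C" "\<And>t::real. norm (poly R (of_real (exp t))) \<le> C * exp (real (degree R) * max t 0)"
proof
  let ?C = "\<Sum>i\<le>degree R. norm (coeff R i)"
  show "0 \<le> ?C" by (simp add: sum_nonneg)
  fix t :: real
  have "norm (poly R (of_real (exp t))) \<le> (\<Sum>i\<le>degree R. norm (coeff R i) * exp (real i * t))"
    unfolding poly_altdef by (rule sum_norm_le) (simp add: norm_mult norm_power exp_of_nat_mult)
  also have "\<dots> \<le> (\<Sum>i\<le>degree R. norm (coeff R i) * exp (real (degree R) * max t 0))"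
  proof (intro sum_mono mult_left_mono)
    fix i assume "i \<in> {..degree R}"
    then have "real i * max t 0 \<le> real (degree R) * max t 0" by (intro mult_right_mono) auto
    moreover have "real i * t \<le> real i * max t 0" by (intro mult_left_mono) auto
    ultimately have "real i * t \<le> real (degree R) * max t 0" by linarith
    then show "exp (real i * t) \<le> exp (real (degree R) * max t 0)" by simp
  qed auto
  finally show "norm (poly R (of_real (exp t))) \<le> ?C * exp (real (degree R) * max t 0)"
    by (simp add: sum_distrib_right)
qed

text \<open>
  The numerator vanishes at \<open>0\<close>, which gives decay to the left, and has smaller degree than the
  denominator, which gives decay to the right.
\<close>

lemma generator_decay:
  assumes \<alpha>: "0 < \<alpha>" and rep: "represents \<alpha> P Q G"
  obtains K where "0 \<le> K" "\<And>x::real. norm (G (of_real x)) \<le> K * exp (- \<alpha> * \<bar>x\<bar>)"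
proof -
  have r: "P \<noteq> 0" "degree P < degree Q" "1 \<le> degree P" "poly P 0 = 0"
    and Qpos: "\<And>x::real. 0 \<le> x \<Longrightarrow> poly Q (of_real x) \<noteq> 0"
    and G: "\<And>z. G z = poly P (exp (of_real \<alpha> * z)) / poly Q (exp (of_real \<alpha> * z))"
    using rep unfolding represents_def by auto
  obtain C A B where C: "0 \<le> C" "\<And>t::real.
    \<bar>ln (norm (poly Q (of_real (exp t)))) - real (degree Q) * max t 0 - (if 0 < t then A else B)\<bar>
      \<le> C * exp (- \<bar>t\<bar>)" by (rule poly_exp_log_asymptotics[OF Qpos]) (assumption | rule that)+
  obtain R where R: "P = pCons 0 R" using r(4) by (cases P) auto
  have dR: "degree P = Suc (degree R)" using r R by (auto simp: degree_pCons_eq_if split: if_splits)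
  obtain D where D: "0 \<le> D" "\<And>t::real. norm (poly R (of_real (exp t))) \<le> D * exp (real (degree R) * max t 0)"
    by (rule poly_exp_bound[of R]) (assumption | rule that)+
  define E where "E = C + \<bar>A\<bar> + \<bar>B\<bar>"
  show thesis
  proof (rule that[of "D * exp E"])
    show "0 \<le> D * exp E" using D by simp
    fix x :: real
    define t where "t = \<alpha> * x"
    have g: "G (of_real x) = of_real (exp t) * poly R (of_real (exp t)) / poly Q (of_real (exp t))"
    proof -
      have "exp (complex_of_real \<alpha> * of_real x) = of_real (exp t)"
        unfolding t_def by (metis exp_of_real of_real_mult)
      then show ?thesis unfolding G R by simp
    qed
    have "C * exp (- \<bar>t\<bar>) \<le> C * 1" using C by (intro mult_left_mono) auto
    then have "real (degree Q) * max t 0 - E \<le> ln (norm (poly Q (of_real (exp t))))"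
      using C(2)[of t] unfolding E_def by (auto split: if_splits)
    then have "exp (real (degree Q) * max t 0 - E) \<le> norm (poly Q (of_real (exp t)))"
      using Qpos[of "exp t"] by (simp add: ln_ge_iff)
    then have "norm (G (of_real x))
        \<le> exp t * (D * exp (real (degree R) * max t 0)) / exp (real (degree Q) * max t 0 - E)"
      unfolding g norm_divide norm_mult norm_of_real abs_exp_cancel using D
      by (intro frac_le mult_left_mono) auto
    also have "\<dots> = D * exp E * exp (t + real (degree R) * max t 0 - real (degree Q) * max t 0)"
      unfolding exp_add exp_diff by simp
    also have "\<dots> \<le> D * exp E * exp (- \<bar>t\<bar>)"
    proof (intro mult_left_mono)
      have "(real (degree R) + 2) * max t 0 \<le> real (degree Q) * max t 0"
        using r(2) dR by (intro mult_right_mono) auto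
      then show "exp (t + real (degree R) * max t 0 - real (degree Q) * max t 0) \<le> exp (- \<bar>t\<bar>)"
        by (cases "0 \<le> t") (auto simp: distrib_right)
    qed (use D in auto)
    also have "\<bar>t\<bar> = \<alpha> * \<bar>x\<bar>" using \<alpha> by (simp add: t_def abs_mult)
    finally show "norm (G (of_real x)) \<le> D * exp E * exp (- \<alpha> * \<bar>x\<bar>)" by simp
  qed
qed

lemma generator_continuous:
  assumes "represents \<alpha> P Q G"
  shows "continuous_on UNIV (\<lambda>x::real. G (of_real x))"
proof -
  have "(\<lambda>x::real. G (of_real x)) = (\<lambda>x. poly P (of_real (exp (\<alpha> * x))) / poly Q (of_real (exp (\<alpha> * x))))"
  proof
    fix x :: real
    have "exp (complex_of_real \<alpha> * of_real x) = of_real (exp (\<alpha> * x))"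
      by (metis exp_of_real of_real_mult)
    then show "G (of_real x) = poly P (of_real (exp (\<alpha> * x))) / poly Q (of_real (exp (\<alpha> * x)))"
      using assms by (simp add: represents_def)
  qed
  moreover have "poly Q (of_real (exp (\<alpha> * x))) \<noteq> 0" for x
    using assms by (auto simp: represents_def)
  ultimately show ?thesis by (simp only:) (intro continuous_intros ballI)
qed

section \<open>Lagrange interpolation of the shifts\<close>

lemma lagrange_interpolation:
  fixes F :: "complex poly" and s :: "'a \<Rightarrow> complex"
  assumes "finite X" "inj_on s X" "degree F < card X"
  shows "poly F z = (\<Sum>l\<in>X. poly F (s l) * (\<Prod>n\<in>X - {l}. (z - s n) / (s l - s n)))"
proof -
  define T where "T l = (\<Prod>n\<in>X - {l}. smult (inverse (s l - s n)) [:- s n, 1:])" for l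
  define H where "H = (\<Sum>l\<in>X. smult (poly F (s l)) (T l))"
  have T: "poly (T l) w = (\<Prod>n\<in>X - {l}. (w - s n) / (s l - s n))" for l w
    by (simp add: T_def poly_prod divide_inverse algebra_simps)
  have degT: "degree (T l) < card X" if "l \<in> X" for l
  proof -
    have "degree (T l) \<le> (\<Sum>n\<in>X - {l}. degree (smult (inverse (s l - s n)) [:- s n, 1:]))"
      unfolding T_def by (rule degree_prod_sum_le[unfolded o_def]) (use assms in auto)
    also have "\<dots> \<le> (\<Sum>n\<in>X - {l}. 1)"
      by (rule sum_mono) (rule order_trans[OF degree_smult_le], simp)
    also have "\<dots> = card (X - {l})" by simp
    also have "\<dots> < card X" using assms(1) that by (rule card_Diff1_less)
    finally show ?thesis .
  qed
  have degH: "degree H < card X"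
    unfolding H_def using assms(3)
    by (intro degree_sum_less) (auto intro: le_less_trans[OF degree_smult_le] degT)
  have "poly F w = poly H w" if "w \<in> s ` X" for w
  proof -
    from that obtain i where i: "i \<in> X" "w = s i" by blast
    have "poly (T l) w = (if l = i then 1 else 0)" if "l \<in> X" for l
    proof (cases "l = i")
      case True
      have "(\<Prod>n\<in>X - {l}. (s l - s n) / (s l - s n)) = (\<Prod>n\<in>X - {l}. 1)"
        by (rule prod.cong) (use \<open>l \<in> X\<close> assms(2) in \<open>auto dest: inj_onD\<close>)
      then show ?thesis using True i by (simp add: T)
    next
      case False
      then have "\<exists>n\<in>X - {l}. (w - s n) / (s l - s n) = 0" using i by auto
      then show ?thesis unfolding T using False assms(1) by (simp add: prod_zero)
    qed
    then have "poly H w = (\<Sum>l\<in>X. poly F (s l) * (if l = i then 1 else 0))"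
      by (simp add: H_def poly_sum)
    also have "\<dots> = poly F w" using i assms(1) by (simp add: if_distrib cong: if_cong)
    finally show ?thesis by simp
  qed
  then have "F = H"
    by (rule poly_eqI_degree[of "s ` X"]) (use assms degH in \<open>auto simp: card_image\<close>)
  then have "poly F z = poly H z" by simp
  then show ?thesis by (simp add: H_def poly_sum T)
qed

text \<open>
  Multiplying the sum by the common denominator \<open>V\<close> gives a polynomial \<open>U\<close> of degree less than
  \<open>m * card Y\<close>. With at least \<open>m * card Y + j\<close> nodes, Lagrange interpolation is still exact for
  \<open>z ^ j * U z\<close>. The free exponent \<open>j\<close> will balance the surplus nodes to the left of \<open>z\<close>; without
  it their influence on the coefficients would not be bounded.
\<close>

lemma rational_interpolation:
  fixes P Q :: "'b \<Rightarrow> complex poly" and s :: "'a \<Rightarrow> complex"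
  assumes fin: "finite X" "finite Y" and inj: "inj_on s X"
    and P: "\<And>g. g \<in> Y \<Longrightarrow> degree (P g) < m" and Q: "\<And>g. g \<in> Y \<Longrightarrow> degree (Q g) \<le> m"
    and card: "m * card Y + j \<le> card X"
    and nz: "\<And>g l. g \<in> Y \<Longrightarrow> l \<in> X \<Longrightarrow> poly (Q g) (s l) \<noteq> 0" "\<And>g. g \<in> Y \<Longrightarrow> poly (Q g) z \<noteq> 0" "z \<noteq> 0"
  shows "(\<Sum>g\<in>Y. c g * (poly (P g) z / poly (Q g) z)) =
    (\<Sum>l\<in>X. (s l / z) ^ j * (\<Prod>g\<in>Y. poly (Q g) (s l) / poly (Q g) z)
        * (\<Prod>n\<in>X - {l}. (z - s n) / (s l - s n))
        * (\<Sum>g\<in>Y. c g * (poly (P g) (s l) / poly (Q g) (s l))))"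
proof (cases "Y = {}")
  case False
  define V where "V = (\<Prod>g\<in>Y. Q g)"
  define U where "U = (\<Sum>g\<in>Y. smult (c g) (P g * (\<Prod>h\<in>Y - {g}. Q h)))"
  define R where "R w = (\<Sum>g\<in>Y. c g * (poly (P g) w / poly (Q g) w))" for w
  have UV: "poly U w = poly V w * R w" if "\<And>g. g \<in> Y \<Longrightarrow> poly (Q g) w \<noteq> 0" for w
  proof -
    have "c g * (poly (P g) w * (\<Prod>h\<in>Y - {g}. poly (Q h) w))
        = (\<Prod>h\<in>Y. poly (Q h) w) * (c g * (poly (P g) w / poly (Q g) w))" if g: "g \<in> Y" for g
      unfolding prod.remove[OF fin(2) g] using \<open>\<And>g. g \<in> Y \<Longrightarrow> poly (Q g) w \<noteq> 0\<close>[OF g] by simp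
    then show ?thesis
      by (simp add: U_def V_def R_def poly_sum poly_prod sum_distrib_left)
  qed
  have degU: "degree U < m * card Y"
    unfolding U_def
  proof (rule degree_sum_less)
    fix g assume g: "g \<in> Y"
    have "degree (smult (c g) (P g * (\<Prod>h\<in>Y - {g}. Q h))) \<le> degree (P g * (\<Prod>h\<in>Y - {g}. Q h))"
      by (rule degree_smult_le)
    also have "\<dots> \<le> degree (P g) + degree (\<Prod>h\<in>Y - {g}. Q h)" by (rule degree_mult_le)
    also have "degree (\<Prod>h\<in>Y - {g}. Q h) \<le> (\<Sum>h\<in>Y - {g}. degree (Q h))"
      by (rule degree_prod_sum_le[unfolded o_def]) (use fin in auto)
    also have "\<dots> \<le> (\<Sum>h\<in>Y - {g}. m)" by (rule sum_mono) (use Q in auto)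
    also have "\<dots> = m * (card Y - 1)" using g fin by (simp add: card_Diff_singleton)
    also have "degree (P g) + m * (card Y - 1) < m + m * (card Y - 1)" using P[OF g] by simp
    also have "\<dots> = m * card Y" using g fin by (cases "card Y") auto
    finally show "degree (smult (c g) (P g * (\<Prod>h\<in>Y - {g}. Q h))) < m * card Y" by simp
  next
    from False obtain g where "g \<in> Y" by blast
    then show "0 < m * card Y" using P[of g] fin by (auto simp: card_gt_0_iff)
  qed
  define F where "F = monom 1 j * U"
  have "degree F \<le> degree (monom 1 j :: complex poly) + degree U" unfolding F_def by (rule degree_mult_le)
  also have "\<dots> < card X" using degU card degree_monom_le[of "1::complex" j] by simp
  finally have degF: "degree F < card X" .
  have F: "poly F w = w ^ j * (poly V w * R w)" if "\<And>g. g \<in> Y \<Longrightarrow> poly (Q g) w \<noteq> 0" for w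
    using UV[OF that] by (simp add: F_def poly_monom)
  have Vz: "poly V z \<noteq> 0" using nz(2) fin by (simp add: V_def poly_prod)
  have VV: "poly V w / poly V z = (\<Prod>g\<in>Y. poly (Q g) w / poly (Q g) z)" for w
    by (simp add: V_def poly_prod prod_dividef)
  have "z ^ j * (poly V z * R z) = (\<Sum>l\<in>X. poly F (s l) * (\<Prod>n\<in>X - {l}. (z - s n) / (s l - s n)))"
    using lagrange_interpolation[OF fin(1) inj degF] F[of z] nz(2) by metis
  also have "\<dots> = (\<Sum>l\<in>X. (s l ^ j * (poly V (s l) * R (s l))) * (\<Prod>n\<in>X - {l}. (z - s n) / (s l - s n)))"
    by (rule sum.cong) (use F nz(1) in auto)
  finally have "R z = (\<Sum>l\<in>X. (s l ^ j * (poly V (s l) * R (s l))) * (\<Prod>n\<in>X - {l}. (z - s n) / (s l - s n))) / (z ^ j * poly V z)"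
    using Vz nz(3) by (simp add: field_simps)
  also have "\<dots> = (\<Sum>l\<in>X. (s l / z) ^ j * (poly V (s l) / poly V z) * (\<Prod>n\<in>X - {l}. (z - s n) / (s l - s n)) * R (s l))"
    unfolding sum_divide_distrib by (rule sum.cong) (simp_all add: power_divide mult_ac)
  finally show ?thesis unfolding VV by (simp add: R_def)
qed auto

section \<open>Decay of the interpolation coefficients\<close>

text \<open>
  The distance of \<open>exp (\<kappa> x)\<close> and \<open>exp (\<kappa> n)\<close> is the larger of the two, up to a factor that is
  exponentially close to \<open>1\<close> in \<open>\<bar>x - n\<bar>\<close>. So its logarithm is \<open>\<kappa> * max x n\<close> up to a summable error.
\<close>

lemma exp_node_ratio:
  assumes "0 < \<kappa>" "0 < \<delta>" "\<delta> \<le> \<bar>l - n\<bar>"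
  shows "norm ((of_real (exp (\<kappa> * x)) - of_real (exp (\<kappa> * n)) :: complex)
            / (of_real (exp (\<kappa> * l)) - of_real (exp (\<kappa> * n))))
     \<le> exp (\<kappa> * (max x n - max l n) + exp (- \<kappa> * \<bar>l - n\<bar>) / (1 - exp (- \<kappa> * \<delta>)))"
proof -
  have diff: "\<bar>exp (\<kappa> * u) - exp (\<kappa> * v)\<bar> = exp (\<kappa> * max u v) * (1 - exp (- \<kappa> * \<bar>u - v\<bar>))" for u v
  proof (cases "u \<le> v")
    case True
    then have "exp (\<kappa> * u) \<le> exp (\<kappa> * v)" using assms by simp
    then show ?thesis using True by (simp add: right_diff_distrib' exp_add[symmetric] algebra_simps)
  next
    case False
    then have "exp (\<kappa> * v) \<le> exp (\<kappa> * u)" using assms by simp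
    then show ?thesis using False by (simp add: right_diff_distrib' exp_add[symmetric] algebra_simps)
  qed
  define y where "y = exp (- \<kappa> * \<bar>l - n\<bar>)"
  define y0 where "y0 = exp (- \<kappa> * \<delta>)"
  have y: "0 < y" "y \<le> y0" "y0 < 1" using assms by (auto simp: y_def y0_def)
  have "1 / (1 - y) = 1 + y / (1 - y)" using y by (simp add: field_simps)
  also have "\<dots> \<le> exp (y / (1 - y))" by (rule exp_ge_add_one_self)
  also have "\<dots> \<le> exp (y / (1 - y0))" using y by (simp add: frac_le)
  finally have yb: "1 / (1 - y) \<le> exp (y / (1 - y0))" .
  have "norm ((of_real (exp (\<kappa> * x)) - of_real (exp (\<kappa> * n)) :: complex)
            / (of_real (exp (\<kappa> * l)) - of_real (exp (\<kappa> * n))))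
      = \<bar>exp (\<kappa> * x) - exp (\<kappa> * n)\<bar> / \<bar>exp (\<kappa> * l) - exp (\<kappa> * n)\<bar>"
    by (simp only: norm_divide of_real_diff[symmetric] norm_of_real)
  also have "\<dots> \<le> exp (\<kappa> * max x n) / (exp (\<kappa> * max l n) * (1 - y))"
    unfolding diff y_def[symmetric] using y by (intro divide_right_mono) (auto simp: mult_le_cancel_left1)
  also have "\<dots> = exp (\<kappa> * (max x n - max l n)) * (1 / (1 - y))"
    by (simp add: right_diff_distrib exp_diff)
  also have "\<dots> \<le> exp (\<kappa> * (max x n - max l n)) * exp (y / (1 - y0))"
    using yb by (intro mult_left_mono) auto
  finally show ?thesis by (simp add: exp_add y_def y0_def)
qed

text \<open>
  A surplus of the counts of superlevel sets is summed over the levels \<open>1, ..., \<lfloor>D\<rfloor>\<close>. A surplus that is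
  linear in \<open>D - n\<close> turns into one that is quadratic in \<open>D\<close>.
\<close>

lemma layer_cake_excess:
  fixes u :: "'a \<Rightarrow> real" and m :: nat
  assumes fin: "finite A" "finite B" and D: "0 \<le> D" and C: "0 \<le> C" "0 < c"
    and u: "\<And>y. y \<in> A \<Longrightarrow> 0 \<le> u y" "\<And>y. y \<in> B \<Longrightarrow> 0 \<le> u y" "\<And>y. y \<in> B \<Longrightarrow> u y \<le> D"
    and B: "real (card {y\<in>B. 0 < u y}) \<le> K"
    and excess: "\<And>n::nat. real n \<le> D \<Longrightarrow>
      real m * real (card {y\<in>B. real n < u y}) + c * (D - real n) - C \<le> real (card {y\<in>A. real n < u y})"
  shows "c / 2 * (D\<^sup>2 - 3 * D) - C * D - real m * K \<le> (\<Sum>y\<in>A. u y) - real m * (\<Sum>y\<in>B. u y)"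
proof -
  define N where "N = nat \<lfloor>D\<rfloor>"
  define T where "T y = card {n\<in>{1..N}. real n < u y}" for y
  have N: "real N \<le> D" "D < real N + 1" using D by (auto simp: N_def)
  have lower: "real (T y) \<le> u y" if "0 \<le> u y" for y
  proof -
    have "{n\<in>{1..N}. real n < u y} \<subseteq> {1..nat \<lfloor>u y\<rfloor>}" by (auto simp: le_nat_floor)
    then have "T y \<le> card {1..nat \<lfloor>u y\<rfloor>}" unfolding T_def by (intro card_mono) auto
    then have "T y \<le> nat \<lfloor>u y\<rfloor>" by simp
    also have "real (nat \<lfloor>u y\<rfloor>) \<le> u y" using that by (simp add: of_nat_floor)
    finally show ?thesis by simp
  qed
  have upper: "u y \<le> real (T y) + (if 0 < u y then 1 else 0)" if "y \<in> B" for y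
  proof (cases "0 < u y")
    case True
    have "n \<in> {1..N} \<and> real n < u y" if n: "1 \<le> n" "n \<le> nat \<lceil>u y\<rceil> - 1" for n
    proof -
      have "real n < u y" using n by linarith
      moreover have "u y \<le> D" using u(3) \<open>y \<in> B\<close> by blast
      ultimately show ?thesis using n(1) by (simp add: N_def le_nat_floor)
    qed
    then have "{1..nat \<lceil>u y\<rceil> - 1} \<subseteq> {n\<in>{1..N}. real n < u y}" by auto
    then have "card {1..nat \<lceil>u y\<rceil> - 1} \<le> T y" unfolding T_def by (intro card_mono) auto
    then show ?thesis using True by simp linarith
  qed (use u(2)[OF that] in auto)
  have count: "real (\<Sum>y\<in>S. T y) = (\<Sum>n=1..N. real (card {y\<in>S. real n < u y}))" if "finite S" for S
  proof -
    have "(\<Sum>y\<in>S. T y) = (\<Sum>y\<in>S. \<Sum>n=1..N. if real n < u y then 1 else 0)"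
      unfolding T_def by (intro sum.cong refl) (simp add: sum.If_cases Int_def)
    also have "\<dots> = (\<Sum>n=1..N. \<Sum>y\<in>S. if real n < u y then 1 else 0)" by (rule sum.swap)
    also have "\<dots> = (\<Sum>n=1..N. card {y\<in>S. real n < u y})"
      using that by (intro sum.cong refl) (simp add: sum.If_cases Int_def)
    finally show ?thesis by simp
  qed
  have "(\<Sum>y\<in>B. u y) \<le> (\<Sum>y\<in>B. real (T y) + (if 0 < u y then 1 else 0))" by (rule sum_mono) (rule upper)
  also have "\<dots> = real (\<Sum>y\<in>B. T y) + real (card {y\<in>B. 0 < u y})"
    using fin by (simp add: sum.distrib sum.If_cases Int_def)
  finally have "(\<Sum>y\<in>B. u y) \<le> (\<Sum>n=1..N. real (card {y\<in>B. real n < u y})) + K"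
    using B count[OF fin(2)] by linarith
  then have Bs: "real m * (\<Sum>y\<in>B. u y) \<le> (\<Sum>n=1..N. real m * real (card {y\<in>B. real n < u y})) + real m * K"
    by (simp add: distrib_left sum_distrib_left[symmetric] mult_left_mono flip: distrib_left)
  have "(\<Sum>n=1..N. real (card {y\<in>A. real n < u y})) \<le> (\<Sum>y\<in>A. u y)"
    unfolding count[OF fin(1), symmetric] of_nat_sum by (rule sum_mono) (use lower u in auto)
  moreover have "(\<Sum>n=1..N. real m * real (card {y\<in>B. real n < u y}) + c * (D - real n) - C)
      \<le> (\<Sum>n=1..N. real (card {y\<in>A. real n < u y}))"
    by (rule sum_mono) (use N in \<open>auto intro!: excess\<close>)
  ultimately have "(\<Sum>n=1..N. real m * real (card {y\<in>B. real n < u y})) + (\<Sum>n=1..N. c * (D - real n) - C)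
      \<le> (\<Sum>y\<in>A. u y)" by (simp add: sum.distrib sum_subtractf algebra_simps)
  moreover have "c / 2 * (D\<^sup>2 - 3 * D) - C * D \<le> (\<Sum>n=1..N. c * (D - real n) - C)"
  proof -
    have "(\<Sum>n=1..N. c * (real N - real n) - C) = c * (real N * (real N - 1) / 2) - C * real N"
      by (induction N) (simp_all add: sum_subtractf algebra_simps flip: sum_distrib_left)
    moreover have "(\<Sum>n=1..N. c * (real N - real n) - C) \<le> (\<Sum>n=1..N. c * (D - real n) - C)"
      using N C by (intro sum_mono) (simp add: mult_left_mono)
    moreover have "C * real N \<le> C * D" using N C by (intro mult_left_mono)
    moreover have "c * ((D\<^sup>2 - 3 * D) / 2) \<le> c * (real N * (real N - 1) / 2)"
    proof (intro mult_left_mono divide_right_mono)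
      \<comment> \<open>Since \<open>N > D - 1\<close>; for \<open>D \<le> 3\<close> the left hand side is not positive.\<close>
      show "D\<^sup>2 - 3 * D \<le> real N * (real N - 1)"
      proof (cases "D \<le> 3")
        case True
        have "D * (D - 3) \<le> 0" using True D by (intro mult_nonneg_nonpos) auto
        moreover have "0 \<le> real N * (real N - 1)" by (cases N) auto
        ultimately show ?thesis by (simp add: power2_eq_square algebra_simps)
      next
        case False
        have "(D - 1) * (D - 2) \<le> real N * (real N - 1)" using False N by (intro mult_mono) auto
        then show ?thesis by (simp add: power2_eq_square algebra_simps)
      qed
    qed (use C in auto)
    ultimately show ?thesis by simp
  qed
  ultimately show ?thesis using Bs by linarith
qed

lemma max_sum_split_right:
  fixes x l :: real
  assumes "finite S" "x \<le> l"
  shows "(\<Sum>y\<in>S. max l y - max x y)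
    = real (card {y\<in>S. y < x}) * (l - x) + (\<Sum>y\<in>{y\<in>S. x \<le> y}. max 0 (l - y))"
proof -
  have "(\<Sum>y\<in>S. max l y - max x y) = (\<Sum>y\<in>S. (if y < x then l - x else 0) + (if x \<le> y then max 0 (l - y) else 0))"
    by (rule sum.cong) (use assms(2) in auto)
  then show ?thesis using assms(1) by (simp add: sum.distrib sum.If_cases Int_def)
qed

lemma max_sum_split_left:
  fixes x l :: real
  assumes "finite S" "l \<le> x"
  shows "(\<Sum>y\<in>S. max l y - max x y)
    = real (card {y\<in>S. y < x}) * (l - x) + (\<Sum>y\<in>{y\<in>S. y < x}. max 0 (y - l))"
proof -
  have "(\<Sum>y\<in>S. max l y - max x y) = (\<Sum>y\<in>S. (if y < x then l - x else 0) + (if y < x then max 0 (y - l) else 0))"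
    by (rule sum.cong) (use assms(2) in auto)
  then show ?thesis using assms(1) by (simp add: sum.distrib sum.If_cases Int_def)
qed

text \<open>
  The logarithmic potential of the nodes \<open>X\<close> minus \<open>m\<close> times that of the poles \<open>Y\<close>, compared at \<open>l\<close>
  and at \<open>x\<close>. The points to the left of \<open>x\<close> contribute a linear function of \<open>l\<close> with slope equal to
  their net number, and the last term subtracts just this slope. What remains only involves the
  points between \<open>x\<close> and \<open>l\<close>, of which there is a surplus of nodes, and therefore grows
  quadratically. In particular the bound is independent of the window size \<open>L\<close>.
\<close>

lemma window_potential:
  fixes m :: nat
  assumes \<Lambda>: "gap \<delta> \<Lambda>" and \<Gamma>: "gap \<eta> \<Gamma>" and c: "0 < c" and C: "0 \<le> C"
    and cnt: "\<And>a b. a \<le> b \<Longrightarrow>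
      real m * real (card (\<Gamma> \<inter> {a..b})) + c * (b - a) - C \<le> real (card (\<Lambda> \<inter> {a..b}))"
    and l: "\<bar>l - x\<bar> \<le> L"
  defines "X \<equiv> \<Lambda> \<inter> {x - L..x + L}" and "Y \<equiv> \<Gamma> \<inter> {x - L..x + L}" and "D \<equiv> \<bar>l - x\<bar>"
  shows "c / 2 * (D\<^sup>2 - 3 * D) - (C + 2) * D - real m * (D / \<eta> + 1)
    \<le> (\<Sum>y\<in>X. max l y - max x y) - real m * (\<Sum>y\<in>Y. max l y - max x y)
       - (real (card {y\<in>X. y < x}) - real m * real (card {y\<in>Y. y < x})) * (l - x)"
proof -
  have L: "0 \<le> L" using l by linarith
  have fin: "finite X" "finite Y"
    unfolding X_def Y_def using gap_count(1)[OF \<Lambda>] gap_count(1)[OF \<Gamma>] L by auto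
  have D: "0 \<le> D" by (simp add: D_def)
  have card2: "real (card S) \<le> real (card T) + 2" if "S \<subseteq> insert u (insert v T)" "finite T" for S T :: "real set" and u v
  proof -
    have "card S \<le> card (insert u (insert v T))" using that by (intro card_mono) auto
    also have "\<dots> \<le> Suc (Suc (card T))" using card_insert_le_m1 that(2) by (simp add: card_insert_if)
    finally show ?thesis by simp
  qed
  \<comment> \<open>The points of a superlevel set of \<open>u\<close> fill an interval, up to its two end points.\<close>
  have one_sided: "c / 2 * (D\<^sup>2 - 3 * D) - (C + 2) * D - real m * (D / \<eta> + 1)
      \<le> (\<Sum>y\<in>A. u y) - real m * (\<Sum>y\<in>B. u y)"
    if AB: "finite A" "finite B" and u: "\<And>y. 0 \<le> u y" "\<And>y. y \<in> B \<Longrightarrow> u y \<le> D"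
      and J: "\<And>n::nat. real n \<le> D \<Longrightarrow> \<exists>p r. r - p = D - real n \<and> {y\<in>B. real n < u y} \<subseteq> \<Gamma> \<inter> {p..r}
        \<and> \<Lambda> \<inter> {p..r} \<subseteq> insert p (insert r {y\<in>A. real n < u y})" for A B and u :: "real \<Rightarrow> real"
  proof (rule layer_cake_excess)
    obtain p r where pr: "r - p = D" "{y\<in>B. 0 < u y} \<subseteq> \<Gamma> \<inter> {p..r}" using J[of 0] D by auto
    have "card {y\<in>B. 0 < u y} \<le> card (\<Gamma> \<inter> {p..r})"
      by (rule card_mono) (use pr D gap_count(1)[OF \<Gamma>, of p r] in auto)
    then show "real (card {y\<in>B. 0 < u y}) \<le> D / \<eta> + 1" using gap_count(2)[OF \<Gamma>, of p r] pr D by simp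
    fix n :: nat assume n: "real n \<le> D"
    obtain p r where pr: "r - p = D - real n" "{y\<in>B. real n < u y} \<subseteq> \<Gamma> \<inter> {p..r}"
      "\<Lambda> \<inter> {p..r} \<subseteq> insert p (insert r {y\<in>A. real n < u y})" using J[OF n] by blast
    have "p \<le> r" using pr(1) n by linarith
    have "card {y\<in>B. real n < u y} \<le> card (\<Gamma> \<inter> {p..r})"
      by (rule card_mono[OF gap_count(1)[OF \<Gamma> \<open>p \<le> r\<close>] pr(2)])
    then have "real m * real (card {y\<in>B. real n < u y}) \<le> real m * real (card (\<Gamma> \<inter> {p..r}))"
      by (intro mult_left_mono) auto
    moreover have "real (card (\<Lambda> \<inter> {p..r})) \<le> real (card {y\<in>A. real n < u y}) + 2"
      by (rule card2[OF pr(3)]) (use AB in simp)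
    ultimately show "real m * real (card {y\<in>B. real n < u y}) + c * (D - real n) - (C + 2)
        \<le> real (card {y\<in>A. real n < u y})" using cnt[OF \<open>p \<le> r\<close>] pr(1) by simp
  qed (use AB u D c C in auto)
  show ?thesis
  proof (cases "x \<le> l")
    case True
    then have Dl: "D = l - x" by (simp add: D_def)
    have "c / 2 * (D\<^sup>2 - 3 * D) - (C + 2) * D - real m * (D / \<eta> + 1)
        \<le> (\<Sum>y\<in>{y\<in>X. x \<le> y}. max 0 (l - y)) - real m * (\<Sum>y\<in>{y\<in>Y. x \<le> y}. max 0 (l - y))"
    proof (rule one_sided)
      fix n :: nat assume "real n \<le> D"
      then show "\<exists>p r. r - p = D - real n \<and> {y\<in>{y\<in>Y. x \<le> y}. real n < max 0 (l - y)} \<subseteq> \<Gamma> \<inter> {p..r}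
        \<and> \<Lambda> \<inter> {p..r} \<subseteq> insert p (insert r {y\<in>{y\<in>X. x \<le> y}. real n < max 0 (l - y)})"
        by (intro exI[of _ x] exI[of _ "l - real n"]) (use l in \<open>auto simp: X_def Y_def Dl\<close>)
    qed (use fin True in \<open>auto simp: Dl\<close>)
    then show ?thesis
      unfolding max_sum_split_right[OF fin(1) True] max_sum_split_right[OF fin(2) True]
      by (simp add: algebra_simps)
  next
    case False
    then have lx: "l \<le> x" and Dl: "D = x - l" by (auto simp: D_def)
    have "c / 2 * (D\<^sup>2 - 3 * D) - (C + 2) * D - real m * (D / \<eta> + 1)
        \<le> (\<Sum>y\<in>{y\<in>X. y < x}. max 0 (y - l)) - real m * (\<Sum>y\<in>{y\<in>Y. y < x}. max 0 (y - l))"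
    proof (rule one_sided)
      fix n :: nat assume "real n \<le> D"
      then show "\<exists>p r. r - p = D - real n \<and> {y\<in>{y\<in>Y. y < x}. real n < max 0 (y - l)} \<subseteq> \<Gamma> \<inter> {p..r}
        \<and> \<Lambda> \<inter> {p..r} \<subseteq> insert p (insert r {y\<in>{y\<in>X. y < x}. real n < max 0 (y - l)})"
        by (intro exI[of _ "l + real n"] exI[of _ x]) (use l in \<open>auto simp: X_def Y_def Dl\<close>)
    qed (use fin lx in \<open>auto simp: Dl\<close>)
    then show ?thesis
      unfolding max_sum_split_left[OF fin(1) lx] max_sum_split_left[OF fin(2) lx]
      by (simp add: algebra_simps)
  qed
qed

lemma exp_poly_ratio:
  fixes Q :: "complex poly"
  assumes nz: "\<And>s::real. 0 \<le> s \<Longrightarrow> poly Q (of_real s) \<noteq> 0"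
  obtains C E where "0 \<le> C" "0 \<le> E" "\<And>t u::real.
    norm (poly Q (of_real (exp t)) / poly Q (of_real (exp u)))
      \<le> exp (real (degree Q) * (max t 0 - max u 0) + (if (0 < t) = (0 < u) then 0 else E)
            + C * (exp (- \<bar>t\<bar>) + exp (- \<bar>u\<bar>)))"
proof -
  obtain C A B where C: "0 \<le> C" "\<And>t::real.
    \<bar>ln (norm (poly Q (of_real (exp t)))) - real (degree Q) * max t 0 - (if 0 < t then A else B)\<bar>
      \<le> C * exp (- \<bar>t\<bar>)" by (rule poly_exp_log_asymptotics[OF nz]) (assumption | rule that)+
  show thesis
  proof (rule that[of C "\<bar>A - B\<bar>"])
    fix t u :: real
    have pos: "0 < norm (poly Q (of_real (exp v)))" for v using nz[of "exp v"] by simp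
    have "norm (poly Q (of_real (exp t)) / poly Q (of_real (exp u)))
        = exp (ln (norm (poly Q (of_real (exp t)))) - ln (norm (poly Q (of_real (exp u)))))"
      unfolding norm_divide exp_diff using pos[of t] pos[of u] by simp
    also have "\<dots> \<le> exp (real (degree Q) * (max t 0 - max u 0) + (if (0 < t) = (0 < u) then 0 else \<bar>A - B\<bar>)
            + C * (exp (- \<bar>t\<bar>) + exp (- \<bar>u\<bar>)))"
      using C(2)[of t] C(2)[of u] unfolding exp_le_cancel_iff right_diff_distrib distrib_left
      by (auto split: if_splits)
    finally show "norm (poly Q (of_real (exp t)) / poly Q (of_real (exp u))) \<le> \<dots>" .
  qed (use C in auto)
qed

text \<open>
  The coefficients of \<open>rational_interpolation\<close>, for the
  poles generated by \<open>\<Gamma>\<close>, the nodes generated by \<open>\<Lambda>\<close>, and \<open>j\<close> the surplus of nodes to the left of \<open>x\<close>.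
  Their logarithm is \<open>- \<kappa>\<close> times the potential difference of \<open>window_potential\<close>, up to
  errors that are at most linear in \<open>\<bar>x - l\<bar>\<close>. The quadratic growth dominates, so the coefficients
  decay, with a constant that depends on neither the point nor the size of the window.
\<close>

lemma interpolation_coefficient_decay:
  fixes m :: nat and Q :: "complex poly"
  assumes \<kappa>: "0 < \<kappa>" and nz: "\<And>s::real. 0 \<le> s \<Longrightarrow> poly Q (of_real s) \<noteq> 0" and dQ: "degree Q = m"
    and \<Lambda>: "gap \<delta> \<Lambda>" and \<Gamma>: "gap \<eta> \<Gamma>" and c: "0 < c" and C: "0 \<le> C"
    and cnt: "\<And>a b. a \<le> b \<Longrightarrow>
      real m * real (card (\<Gamma> \<inter> {a..b})) + c * (b - a) - C \<le> real (card (\<Lambda> \<inter> {a..b}))"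
  defines "X \<equiv> \<lambda>x L. \<Lambda> \<inter> {x - L..x + L}" and "Y \<equiv> \<lambda>x L. \<Gamma> \<inter> {x - L..x + L}"
    and "s \<equiv> \<lambda>x. complex_of_real (exp (\<kappa> * x))"
  obtains K where "0 \<le> K" "\<And>x L l j. l \<in> X x L \<Longrightarrow>
    card {y\<in>X x L. y < x} = j + m * card {y\<in>Y x L. y < x} \<Longrightarrow>
    norm (of_real (exp (a * (x - l))) * (s l / s x) ^ j
       * (\<Prod>g\<in>Y x L. poly Q (of_real (exp (\<kappa> * (l - g)))) / poly Q (of_real (exp (\<kappa> * (x - g)))))
       * (\<Prod>n\<in>X x L - {l}. (s x - s n) / (s l - s n))) \<le> K * exp (- \<bar>x - l\<bar>)"
proof -
  obtain Cq E where q: "0 \<le> Cq" "0 \<le> E" "\<And>t u::real.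
    norm (poly Q (of_real (exp t)) / poly Q (of_real (exp u)))
      \<le> exp (real m * (max t 0 - max u 0) + (if (0 < t) = (0 < u) then 0 else E)
            + Cq * (exp (- \<bar>t\<bar>) + exp (- \<bar>u\<bar>)))"
    by (rule exp_poly_ratio[OF nz, unfolded dQ]) (assumption, rule that)
  have \<delta>: "0 < \<delta>" and \<eta>: "0 < \<eta>" using \<Lambda> \<Gamma> gap_def by blast+
  obtain S where S: "0 < S" "\<And>x F. finite F \<Longrightarrow> F \<subseteq> \<Gamma> \<Longrightarrow> (\<Sum>y\<in>F. exp (- \<kappa> * \<bar>x - y\<bar>)) \<le> S"
    using gap_exp_sum_bound[OF \<Gamma> \<kappa>] by metis
  obtain S' where S': "0 < S'" "\<And>x F. finite F \<Longrightarrow> F \<subseteq> \<Lambda> \<Longrightarrow> (\<Sum>y\<in>F. exp (- \<kappa> * \<bar>x - y\<bar>)) \<le> S'"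
    using gap_exp_sum_bound[OF \<Lambda> \<kappa>] by metis
  define y0 where "y0 = 1 - exp (- \<kappa> * \<delta>)"
  have y0: "0 < y0" using \<kappa> \<delta> by (simp add: y0_def)
  \<comment> \<open>The logarithm of a coefficient at distance \<open>D\<close> will be at most \<open>- p * D\<^sup>2 + qq * D + r\<close>.\<close>
  define p where "p = \<kappa> * c / 2"
  define qq where "qq = 3 * \<kappa> * c / 2 + \<kappa> * (C + 2) + \<kappa> * real m / \<eta> + \<bar>a\<bar> + E / \<eta>"
  define r where "r = \<kappa> * real m + E + 2 * Cq * S + S' / y0"
  have p: "0 < p" using \<kappa> c by (simp add: p_def)
  define K where "K = exp (r + (qq + 1)\<^sup>2 / (4 * p))"
  show thesis
  proof (rule that[of K])
    show "0 \<le> K" by (simp add: K_def)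
    fix x L l j
    assume l: "l \<in> X x L" and j: "card {y\<in>X x L. y < x} = j + m * card {y\<in>Y x L. y < x}"
    define D where "D = \<bar>l - x\<bar>"
    have lL: "\<bar>l - x\<bar> \<le> L" "l \<in> \<Lambda>" using l by (auto simp: X_def)
    have L: "0 \<le> L" using lL by linarith
    have fin: "finite (X x L)" "finite (Y x L)"
      unfolding X_def Y_def using gap_count(1)[OF \<Lambda>] gap_count(1)[OF \<Gamma>] L by auto
    have n1: "norm (of_real (exp (a * (x - l))) :: complex) \<le> exp (\<bar>a\<bar> * D)"
    proof -
      have "a * (x - l) \<le> \<bar>a\<bar> * D" unfolding D_def abs_mult[symmetric] by (simp add: algebra_simps abs_le_iff)
      then show ?thesis by simp
    qed
    have n2: "norm ((s l / s x) ^ j) = exp (\<kappa> * real j * (l - x))"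
    proof -
      have "norm ((s l / s x) ^ j) = exp (\<kappa> * (l - x)) ^ j"
        by (simp add: s_def norm_power norm_divide right_diff_distrib exp_diff del: of_real_exp)
      then show ?thesis by (simp add: mult_ac flip: exp_of_nat_mult)
    qed
    have n3: "norm (\<Prod>g\<in>Y x L. poly Q (of_real (exp (\<kappa> * (l - g)))) / poly Q (of_real (exp (\<kappa> * (x - g)))))
        \<le> exp (\<kappa> * (real m * (\<Sum>g\<in>Y x L. max l g - max x g)) + E * (D / \<eta> + 1) + 2 * Cq * S)" (is "?V \<le> _")
    proof -
      have mx: "max (\<kappa> * (v - g)) 0 = \<kappa> * (max v g - g)" for v g
        using \<kappa> by (auto simp: max_def mult_le_0_iff)
      have ab: "\<bar>\<kappa> * (v - g)\<bar> = \<kappa> * \<bar>v - g\<bar>" for v g using \<kappa> by (simp add: abs_mult)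
      have "?V
         \<le> (\<Prod>g\<in>Y x L. exp (real m * (max (\<kappa> * (l - g)) 0 - max (\<kappa> * (x - g)) 0)
              + (if (0 < \<kappa> * (l - g)) = (0 < \<kappa> * (x - g)) then 0 else E)
              + Cq * (exp (- \<bar>\<kappa> * (l - g)\<bar>) + exp (- \<bar>\<kappa> * (x - g)\<bar>))))"
        unfolding prod_norm[symmetric] by (rule prod_mono) (use q in auto)
      also have "\<dots> = exp ((\<Sum>g\<in>Y x L. \<kappa> * (real m * (max l g - max x g)))
          + (\<Sum>g\<in>Y x L. if (g < l) = (g < x) then 0 else E)
          + (\<Sum>g\<in>Y x L. Cq * exp (- \<kappa> * \<bar>l - g\<bar>)) + (\<Sum>g\<in>Y x L. Cq * exp (- \<kappa> * \<bar>x - g\<bar>)))"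
        unfolding exp_sum[OF fin(2), symmetric] mx ab sum.distrib[symmetric]
        using \<kappa> by (intro arg_cong[where f = exp] sum.cong refl)
          (simp add: zero_less_mult_iff algebra_simps)
      also have "\<dots> \<le> exp (\<kappa> * (real m * (\<Sum>g\<in>Y x L. max l g - max x g)) + E * (D / \<eta> + 1) + 2 * Cq * S)"
      proof -
        have "(\<Sum>g\<in>Y x L. if (g < l) = (g < x) then 0 else E) = E * real (card {g\<in>Y x L. (g < l) \<noteq> (g < x)})"
          using fin by (simp add: sum.If_cases Int_def)
        also have "\<dots> \<le> E * (D / \<eta> + 1)"
        proof (rule mult_left_mono)
          have "card {g\<in>Y x L. (g < l) \<noteq> (g < x)} \<le> card (\<Gamma> \<inter> {min l x..max l x})"
            by (rule card_mono) (use gap_count(1)[OF \<Gamma>] in \<open>auto simp: Y_def\<close>)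
          also have "real \<dots> \<le> (max l x - min l x) / \<eta> + 1" by (rule gap_count[OF \<Gamma>]) auto
          finally show "real (card {g\<in>Y x L. (g < l) \<noteq> (g < x)}) \<le> D / \<eta> + 1"
            by (simp add: D_def max_def min_def abs_if split: if_splits)
        qed (use q in auto)
        finally have e1: "(\<Sum>g\<in>Y x L. if (g < l) = (g < x) then 0 else E) \<le> E * (D / \<eta> + 1)" .
        have e2: "(\<Sum>g\<in>Y x L. Cq * exp (- \<kappa> * \<bar>v - g\<bar>)) \<le> Cq * S" for v
          unfolding sum_distrib_left[symmetric] using S(2)[OF fin(2), of v] q by (intro mult_left_mono) (auto simp: Y_def)
        have "(\<Sum>g\<in>Y x L. \<kappa> * (real m * (max l g - max x g))) = \<kappa> * (real m * (\<Sum>g\<in>Y x L. max l g - max x g))"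
          by (simp only: sum_distrib_left)
        with e1 e2[of l] e2[of x] show ?thesis by simp
      qed
      finally show ?thesis .
    qed
    have n4: "norm (\<Prod>n\<in>X x L - {l}. (s x - s n) / (s l - s n))
        \<le> exp (- \<kappa> * (\<Sum>n\<in>X x L. max l n - max x n) + S' / y0)"
    proof -
      have "norm (\<Prod>n\<in>X x L - {l}. (s x - s n) / (s l - s n))
          \<le> (\<Prod>n\<in>X x L - {l}. exp (\<kappa> * (max x n - max l n) + exp (- \<kappa> * \<bar>l - n\<bar>) / y0))"
        unfolding prod_norm[symmetric]
      proof (rule prod_mono, intro conjI)
        fix n assume n: "n \<in> X x L - {l}"
        have "\<delta> \<le> \<bar>l - n\<bar>" using n lL \<Lambda> unfolding gap_def X_def by auto
        then show "norm ((s x - s n) / (s l - s n)) \<le> exp (\<kappa> * (max x n - max l n) + exp (- \<kappa> * \<bar>l - n\<bar>) / y0)"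
          unfolding s_def y0_def by (rule exp_node_ratio[OF \<kappa> \<delta>])
      qed simp
      also have "\<dots> = exp (\<kappa> * (\<Sum>n\<in>X x L - {l}. max x n - max l n) + (\<Sum>n\<in>X x L - {l}. exp (- \<kappa> * \<bar>l - n\<bar>)) / y0)"
        using fin(1) by (simp add: exp_sum[symmetric] sum.distrib sum_distrib_left sum_divide_distrib)
      also have "\<dots> \<le> exp (- \<kappa> * (\<Sum>n\<in>X x L. max l n - max x n) + S' / y0)"
      proof -
        have "(\<Sum>n\<in>X x L. max x n - max l n) = (max x l - l) + (\<Sum>n\<in>X x L - {l}. max x n - max l n)"
          using sum.remove[OF fin(1) l, of "\<lambda>n. max x n - max l n"] by simp
        then have "(\<Sum>n\<in>X x L - {l}. max x n - max l n) \<le> (\<Sum>n\<in>X x L. max x n - max l n)" by simp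
        also have "\<dots> = - (\<Sum>n\<in>X x L. max l n - max x n)" by (simp add: sum_subtractf)
        finally have "\<kappa> * (\<Sum>n\<in>X x L - {l}. max x n - max l n) \<le> - \<kappa> * (\<Sum>n\<in>X x L. max l n - max x n)"
          using mult_left_mono[of "(\<Sum>n\<in>X x L - {l}. max x n - max l n)" _ \<kappa>] \<kappa> by fastforce
        moreover have "(\<Sum>n\<in>X x L - {l}. exp (- \<kappa> * \<bar>l - n\<bar>)) / y0 \<le> S' / y0"
          using S'(2)[of "X x L - {l}" l] fin y0 by (intro divide_right_mono) (auto simp: X_def)
        ultimately show ?thesis by simp
      qed
      finally show ?thesis .
    qed
    define \<Phi> where "\<Phi> = (\<Sum>y\<in>X x L. max l y - max x y) - real m * (\<Sum>y\<in>Y x L. max l y - max x y)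
       - real j * (l - x)"
    have \<Phi>: "c / 2 * (D\<^sup>2 - 3 * D) - (C + 2) * D - real m * (D / \<eta> + 1) \<le> \<Phi>"
    proof -
      have "real j = real (card {y\<in>X x L. y < x}) - real m * real (card {y\<in>Y x L. y < x})"
        using j by simp
      then show ?thesis
        using window_potential[OF \<Lambda> \<Gamma> c C cnt lL(1)] unfolding \<Phi>_def D_def X_def Y_def by simp
    qed
    have "norm (of_real (exp (a * (x - l))) * (s l / s x) ^ j
       * (\<Prod>g\<in>Y x L. poly Q (of_real (exp (\<kappa> * (l - g)))) / poly Q (of_real (exp (\<kappa> * (x - g)))))
       * (\<Prod>n\<in>X x L - {l}. (s x - s n) / (s l - s n)))
      \<le> exp (\<bar>a\<bar> * D) * exp (\<kappa> * real j * (l - x))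
        * exp (\<kappa> * (real m * (\<Sum>g\<in>Y x L. max l g - max x g)) + E * (D / \<eta> + 1) + 2 * Cq * S)
        * exp (- \<kappa> * (\<Sum>n\<in>X x L. max l n - max x n) + S' / y0)" (is "?coefficient \<le> _")
      unfolding norm_mult[where 'a = complex] n2 using n1 n3 n4 by (intro mult_mono) auto
    also have "\<dots> = exp (- \<kappa> * \<Phi> + \<bar>a\<bar> * D + E * (D / \<eta> + 1) + 2 * Cq * S + S' / y0)"
      by (simp add: \<Phi>_def algebra_simps flip: exp_add)
    also have "\<dots> \<le> exp (r + (qq + 1)\<^sup>2 / (4 * p) - D)"
    proof -
      have "- \<kappa> * \<Phi> \<le> - \<kappa> * (c / 2 * (D\<^sup>2 - 3 * D) - (C + 2) * D - real m * (D / \<eta> + 1))"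
        using \<Phi> \<kappa> by simp
      also have "\<dots> + \<bar>a\<bar> * D + E * (D / \<eta> + 1) + 2 * Cq * S + S' / y0 = - p * D\<^sup>2 + qq * D + r"
        by (simp add: p_def qq_def r_def algebra_simps add_divide_distrib)
      finally have "- \<kappa> * \<Phi> + \<bar>a\<bar> * D + E * (D / \<eta> + 1) + 2 * Cq * S + S' / y0 \<le> - p * D\<^sup>2 + qq * D + r"
        by simp
      also have "\<dots> \<le> r + (qq + 1)\<^sup>2 / (4 * p) - D"
      proof -
        \<comment> \<open>Complete the square, sparing one \<open>D\<close> for the decay.\<close>
        have "0 \<le> (2 * p * D - (qq + 1))\<^sup>2" by simp
        also have "\<dots> = 4 * p * (p * D\<^sup>2 - (qq + 1) * D) + (qq + 1)\<^sup>2"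
          by (simp add: power2_eq_square algebra_simps)
        finally have "(qq + 1) * D - p * D\<^sup>2 \<le> (qq + 1)\<^sup>2 / (4 * p)" using p by (simp add: field_simps)
        then show ?thesis by (simp add: algebra_simps)
      qed
      finally show ?thesis by simp
    qed
    also have "\<dots> = K * exp (- \<bar>x - l\<bar>)"
      unfolding K_def D_def by (simp add: abs_minus_commute flip: exp_add)
    finally show "?coefficient \<le> K * exp (- \<bar>x - l\<bar>)" .
  qed
qed

text \<open>
  Samples on \<open>\<Lambda>\<close> control a finite sum of shifts locally: in a window large enough to contain
  all \<open>g \<in> F\<close> the sum is, in the variable \<open>exp (\<kappa> x)\<close> and up to an exponential factor, a rational
  function that is reproduced exactly from its values at the points of \<open>\<Lambda>\<close>, and the coefficients are bounded
  uniformly in the window.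
\<close>

theorem sampling_reconstruction_bound:
  fixes m :: nat and P Q :: "complex poly" and G :: "complex \<Rightarrow> complex"
  assumes \<kappa>: "0 < \<kappa>" and nz: "\<And>s::real. 0 \<le> s \<Longrightarrow> poly Q (of_real s) \<noteq> 0" and dQ: "degree Q = m"
    and dP: "degree P < m"
    and G: "\<And>x::real. G (of_real x) = of_real (exp (a * x)) *
              (poly P (of_real (exp (\<kappa> * x))) / poly Q (of_real (exp (\<kappa> * x))))"
    and \<Lambda>: "gap \<delta> \<Lambda>" and \<Gamma>: "gap \<eta> \<Gamma>" and c: "0 < c"
    and cnt: "\<And>a b. a \<le> b \<Longrightarrow>
      real m * real (card (\<Gamma> \<inter> {a..b})) + c * (b - a) - C \<le> real (card (\<Lambda> \<inter> {a..b}))"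
  obtains K where "0 \<le> K" "\<And>x F v. finite F \<Longrightarrow> F \<subseteq> \<Gamma> \<Longrightarrow>
    \<exists>X. finite X \<and> X \<subseteq> \<Lambda> \<and> norm (\<Sum>g\<in>F. v g * G (of_real (x - g)))
      \<le> K * (\<Sum>l\<in>X. exp (- \<bar>x - l\<bar>) * norm (\<Sum>g\<in>F. v g * G (of_real (l - g))))"
proof -
  have cnt': "\<And>a b. a \<le> b \<Longrightarrow>
      real m * real (card (\<Gamma> \<inter> {a..b})) + c * (b - a) - \<bar>C\<bar> \<le> real (card (\<Lambda> \<inter> {a..b}))"
    using cnt by (smt (verit))
  define s where "s x = complex_of_real (exp (\<kappa> * x))" for x
  define W where "W S x L = S \<inter> {x - L..x + L}" for S :: "real set" and x L
  obtain K where K: "0 \<le> K" "\<And>x L l j. l \<in> W \<Lambda> x L \<Longrightarrow>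
    card {y\<in>W \<Lambda> x L. y < x} = j + m * card {y\<in>W \<Gamma> x L. y < x} \<Longrightarrow>
    norm (of_real (exp (a * (x - l))) * (s l / s x) ^ j
       * (\<Prod>g\<in>W \<Gamma> x L. poly Q (of_real (exp (\<kappa> * (l - g)))) / poly Q (of_real (exp (\<kappa> * (x - g)))))
       * (\<Prod>n\<in>W \<Lambda> x L - {l}. (s x - s n) / (s l - s n))) \<le> K * exp (- \<bar>x - l\<bar>)"
    unfolding W_def s_def
    by (rule interpolation_coefficient_decay[OF \<kappa> nz dQ \<Lambda> \<Gamma> c abs_ge_zero cnt', of a])
      (assumption, assumption, rule that, assumption, simp only: W_def s_def)
  show thesis
  proof (rule that[OF K(1)])
    fix x F and v :: "real \<Rightarrow> complex" assume F: "finite F" "F \<subseteq> \<Gamma>"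
    \<comment> \<open>The first summand makes the window contain \<open>F\<close>; the second one produces enough surplus nodes on either side of \<open>x\<close>.\<close>
    define L where "L = (\<Sum>g\<in>F. \<bar>x - g\<bar>) + (\<bar>C\<bar> + 2) / c"
    have L0: "0 \<le> L" unfolding L_def using c by (intro add_nonneg_nonneg sum_nonneg divide_nonneg_pos) auto
    have "(\<bar>C\<bar> + 2) / c \<le> L" by (simp add: L_def sum_nonneg)
    then have cL: "\<bar>C\<bar> + 2 \<le> c * L" using c by (simp add: field_simps)
    define X where "X = W \<Lambda> x L"
    define Y where "Y = W \<Gamma> x L"
    have fin: "finite X" "finite Y"
      unfolding X_def Y_def W_def using gap_count(1)[OF \<Lambda>] gap_count(1)[OF \<Gamma>] L0 by auto
    have FY: "F \<subseteq> Y"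
    proof
      fix g assume g: "g \<in> F"
      have "\<bar>x - g\<bar> \<le> (\<Sum>g\<in>F. \<bar>x - g\<bar>)" by (rule member_le_sum) (use g F in auto)
      also have "\<dots> \<le> L" using c by (simp add: L_def)
      finally show "g \<in> Y" using g F by (auto simp: Y_def W_def abs_le_iff)
    qed
    have left: "m * card {y\<in>Y. y < x} \<le> card {y\<in>X. y < x}"
    proof -
      have "card {y\<in>Y. y < x} \<le> card (\<Gamma> \<inter> {x - L..x})"
        by (rule card_mono) (use gap_count(1)[OF \<Gamma>] L0 in \<open>auto simp: Y_def W_def\<close>)
      then have "real m * real (card {y\<in>Y. y < x}) \<le> real m * real (card (\<Gamma> \<inter> {x - L..x}))"
        by (intro mult_left_mono) auto
      moreover have "card (\<Lambda> \<inter> {x - L..x}) \<le> card (insert x {y\<in>X. y < x})"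
      proof (rule card_mono)
        show "finite (insert x {y\<in>X. y < x})" using fin by simp
      qed (auto simp: X_def W_def)
      then have "card (\<Lambda> \<inter> {x - L..x}) \<le> card {y\<in>X. y < x} + 1"
        using fin(1) by (simp add: card_insert_if split: if_splits)
      ultimately have "real m * real (card {y\<in>Y. y < x}) \<le> real (card {y\<in>X. y < x})"
        using cnt'[of "x - L" x] L0 cL by simp
      then show ?thesis by (metis of_nat_le_iff of_nat_mult)
    qed
    have right: "m * card {y\<in>Y. x \<le> y} \<le> card {y\<in>X. x \<le> y}"
    proof -
      have "{y\<in>Y. x \<le> y} = \<Gamma> \<inter> {x..x + L}" "{y\<in>X. x \<le> y} = \<Lambda> \<inter> {x..x + L}"
        using L0 by (auto simp: X_def Y_def W_def)
      then have "real m * real (card {y\<in>Y. x \<le> y}) \<le> real (card {y\<in>X. x \<le> y})"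
        using cnt'[of x "x + L"] L0 cL by simp
      then show ?thesis by (metis of_nat_le_iff of_nat_mult)
    qed
    define j where "j = card {y\<in>X. y < x} - m * card {y\<in>Y. y < x}"
    have j: "card {y\<in>X. y < x} = j + m * card {y\<in>Y. y < x}" using left by (simp add: j_def)
    have split: "card S = card {y\<in>S. y < x} + card {y\<in>S. x \<le> y}" if "finite S" for S
      using that by (subst card_Un_disjoint[symmetric]) (auto intro!: arg_cong[where f = card])
    have cardXY: "m * card Y + j \<le> card X"
      using split[OF fin(1)] split[OF fin(2)] j right by (simp add: distrib_left)
    define Pg where "Pg g = P \<circ>\<^sub>p [:0, of_real (exp (- \<kappa> * g)):]" for g
    define Qg where "Qg g = Q \<circ>\<^sub>p [:0, of_real (exp (- \<kappa> * g)):]" for g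
    have pq: "poly (Pg g) (s y) = poly P (of_real (exp (\<kappa> * (y - g))))"
      "poly (Qg g) (s y) = poly Q (of_real (exp (\<kappa> * (y - g))))" for g y
    proof -
      have "s y * of_real (exp (- \<kappa> * g)) = of_real (exp (\<kappa> * (y - g)))"
        unfolding s_def of_real_mult[symmetric] by (simp add: right_diff_distrib flip: exp_add)
      then show "poly (Pg g) (s y) = poly P (of_real (exp (\<kappa> * (y - g))))"
        "poly (Qg g) (s y) = poly Q (of_real (exp (\<kappa> * (y - g))))"
        by (simp_all add: Pg_def Qg_def poly_pcompose)
    qed
    define w where "w g = (if g \<in> F then v g * of_real (exp (- (a * g))) else 0)" for g
    define f where "f y = (\<Sum>g\<in>F. v g * G (of_real (y - g)))" for y
    have f: "f y = of_real (exp (a * y)) * (\<Sum>g\<in>Y. w g * (poly (Pg g) (s y) / poly (Qg g) (s y)))" for y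
    proof -
      have "f y = (\<Sum>g\<in>F. of_real (exp (a * y)) * (w g * (poly (Pg g) (s y) / poly (Qg g) (s y))))"
        unfolding f_def
      proof (rule sum.cong[OF refl])
        fix g assume "g \<in> F"
        have "exp (a * (y - g)) = exp (a * y) * exp (- (a * g))"
          by (simp add: right_diff_distrib flip: exp_add)
        then show "v g * G (of_real (y - g))
            = of_real (exp (a * y)) * (w g * (poly (Pg g) (s y) / poly (Qg g) (s y)))"
          using \<open>g \<in> F\<close> unfolding G pq w_def by (simp del: of_real_exp)
      qed
      also have "\<dots> = (\<Sum>g\<in>Y. of_real (exp (a * y)) * (w g * (poly (Pg g) (s y) / poly (Qg g) (s y))))"
        by (rule sum.mono_neutral_left) (use fin FY in \<open>auto simp: w_def\<close>)
      finally show ?thesis by (simp only: sum_distrib_left)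
    qed
    have inj: "inj_on s X"
    proof (rule inj_onI)
      fix y z assume "s y = s z"
      then have "exp (\<kappa> * y) = exp (\<kappa> * z)" unfolding s_def of_real_eq_iff .
      then show "y = z" using \<kappa> by simp
    qed
    have interp: "(\<Sum>g\<in>Y. w g * (poly (Pg g) (s x) / poly (Qg g) (s x))) =
      (\<Sum>l\<in>X. (s l / s x) ^ j * (\<Prod>g\<in>Y. poly (Qg g) (s l) / poly (Qg g) (s x))
        * (\<Prod>n\<in>X - {l}. (s x - s n) / (s l - s n))
        * (\<Sum>g\<in>Y. w g * (poly (Pg g) (s l) / poly (Qg g) (s l))))"
    proof (rule rational_interpolation[OF fin inj _ _ cardXY])
      show "degree (Pg g) < m" for g using dP by (simp add: Pg_def degree_pcompose)
      show "degree (Qg g) \<le> m" for g using dQ by (simp add: Qg_def degree_pcompose)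
      show "poly (Qg g) (s y) \<noteq> 0" for g y unfolding pq by (rule nz) simp
      show "poly (Qg g) (s x) \<noteq> 0" for g unfolding pq by (rule nz) simp
      show "s x \<noteq> 0" by (simp add: s_def)
    qed
    define k where "k l = of_real (exp (a * (x - l))) * (s l / s x) ^ j
       * (\<Prod>g\<in>Y. poly Q (of_real (exp (\<kappa> * (l - g)))) / poly Q (of_real (exp (\<kappa> * (x - g)))))
       * (\<Prod>n\<in>X - {l}. (s x - s n) / (s l - s n))" for l
    have "f x = (\<Sum>l\<in>X. of_real (exp (a * x)) * ((s l / s x) ^ j * (\<Prod>g\<in>Y. poly (Qg g) (s l) / poly (Qg g) (s x))
        * (\<Prod>n\<in>X - {l}. (s x - s n) / (s l - s n))
        * (\<Sum>g\<in>Y. w g * (poly (Pg g) (s l) / poly (Qg g) (s l)))))"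
      unfolding f[of x] interp by (rule sum_distrib_left)
    also have "\<dots> = (\<Sum>l\<in>X. k l * f l)"
    proof (rule sum.cong[OF refl])
      fix l
      have "complex_of_real (exp (a * x)) = of_real (exp (a * (x - l))) * of_real (exp (a * l))"
        unfolding of_real_mult[symmetric] by (simp add: right_diff_distrib flip: exp_add)
      then show "of_real (exp (a * x)) * ((s l / s x) ^ j * (\<Prod>g\<in>Y. poly (Qg g) (s l) / poly (Qg g) (s x))
        * (\<Prod>n\<in>X - {l}. (s x - s n) / (s l - s n))
        * (\<Sum>g\<in>Y. w g * (poly (Pg g) (s l) / poly (Qg g) (s l)))) = k l * f l"
        unfolding f[of l] k_def pq by (simp only: mult_ac)
    qed
    finally have "norm (f x) \<le> (\<Sum>l\<in>X. norm (k l) * norm (f l))"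
      using norm_sum[of "\<lambda>l. k l * f l" X] by (simp add: norm_mult)
    also have "\<dots> \<le> (\<Sum>l\<in>X. K * exp (- \<bar>x - l\<bar>) * norm (f l))"
      using K(2) j unfolding k_def X_def Y_def by (intro sum_mono mult_right_mono) auto
    also have "\<dots> = K * (\<Sum>l\<in>X. exp (- \<bar>x - l\<bar>) * norm (f l))" by (simp add: sum_distrib_left mult.assoc)
    finally show "\<exists>X. finite X \<and> X \<subseteq> \<Lambda> \<and> norm (\<Sum>g\<in>F. v g * G (of_real (x - g)))
      \<le> K * (\<Sum>l\<in>X. exp (- \<bar>x - l\<bar>) * norm (\<Sum>g\<in>F. v g * G (of_real (l - g))))"
      using fin(1) unfolding f_def X_def W_def by blast
  qed
qed

section \<open>Inverses of matrices with exponential off-diagonal decay\<close>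

abbreviation norm_summable_on :: "('a \<Rightarrow> 'b::real_normed_vector) \<Rightarrow> 'a set \<Rightarrow> bool"
    (infix "norm'_summable'_on" 50) where
  "f norm_summable_on A \<equiv> (\<lambda>x. norm (f x)) summable_on A"

lemma exp_kernel_abs_summable:
  fixes k :: "real \<Rightarrow> complex"
  assumes "gap \<delta> S" "0 < \<beta>" "\<And>y. y \<in> S \<Longrightarrow> norm (k y) \<le> K * exp (- \<beta> * \<bar>x - y\<bar>)"
  shows "k norm_summable_on S"
proof -
  obtain C where C: "0 < C" "\<And>x F. finite F \<Longrightarrow> F \<subseteq> S \<Longrightarrow> (\<Sum>y\<in>F. exp (- \<beta> * \<bar>x - y\<bar>)) \<le> C"
    using gap_exp_sum_bound[OF assms(1,2)] by metis
  show ?thesis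
  proof (rule nonneg_bdd_above_summable_on)
    show "bdd_above (sum (\<lambda>y. norm (k y)) ` {F. F \<subseteq> S \<and> finite F})"
    proof (rule bdd_aboveI2)
      fix F assume F: "F \<in> {F. F \<subseteq> S \<and> finite F}"
      have "(\<Sum>y\<in>F. norm (k y)) \<le> (\<Sum>y\<in>F. \<bar>K\<bar> * exp (- \<beta> * \<bar>x - y\<bar>))"
      proof (rule sum_mono)
        fix y assume "y \<in> F"
        then have "norm (k y) \<le> K * exp (- \<beta> * \<bar>x - y\<bar>)" using assms(3) F by blast
        also have "\<dots> \<le> \<bar>K\<bar> * exp (- \<beta> * \<bar>x - y\<bar>)" by (intro mult_right_mono) auto
        finally show "norm (k y) \<le> \<bar>K\<bar> * exp (- \<beta> * \<bar>x - y\<bar>)" .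
      qed
      also have "\<dots> \<le> \<bar>K\<bar> * C"
        unfolding sum_distrib_left[symmetric] using C(2) F by (intro mult_left_mono) auto
      finally show "(\<Sum>y\<in>F. norm (k y)) \<le> \<bar>K\<bar> * C" .
    qed
  qed simp
qed

text \<open>
  One half of the decay rate of the first factor is spent on summability.
\<close>

lemma exp_kernel_compose:
  fixes k h :: "real \<Rightarrow> complex"
  assumes S: "\<And>F. finite F \<Longrightarrow> F \<subseteq> S \<Longrightarrow> (\<Sum>t\<in>F. exp (- \<beta> * \<bar>x - t\<bar>)) \<le> C"
    and \<beta>: "0 < \<beta>"
    and k: "\<And>t. t \<in> S \<Longrightarrow> norm (k t) \<le> a * exp (- (2 * \<beta>) * \<bar>x - t\<bar>)"
    and h: "\<And>t. t \<in> S \<Longrightarrow> norm (h t) \<le> b * exp (- \<beta> * \<bar>t - y\<bar>)"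
    and nn: "0 \<le> a" "0 \<le> b"
  shows "(\<lambda>t. k t * h t) norm_summable_on S"
    and "norm (infsum (\<lambda>t. k t * h t) S) \<le> a * b * C * exp (- \<beta> * \<bar>x - y\<bar>)"
proof -
  have le: "(\<Sum>t\<in>F. norm (k t * h t)) \<le> a * b * C * exp (- \<beta> * \<bar>x - y\<bar>)"
    if F: "finite F" "F \<subseteq> S" for F
  proof -
    have "(\<Sum>t\<in>F. norm (k t * h t)) \<le> (\<Sum>t\<in>F. a * b * exp (- \<beta> * \<bar>x - y\<bar>) * exp (- \<beta> * \<bar>x - t\<bar>))"
    proof (rule sum_mono)
      fix t assume t: "t \<in> F"
      have "norm (k t * h t) \<le> (a * exp (- (2 * \<beta>) * \<bar>x - t\<bar>)) * (b * exp (- \<beta> * \<bar>t - y\<bar>))"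
        unfolding norm_mult using k h t F nn by (intro mult_mono) auto
      also have "\<dots> = a * b * exp (- (2 * \<beta>) * \<bar>x - t\<bar> - \<beta> * \<bar>t - y\<bar>)" by (simp add: exp_diff exp_minus field_simps)
      also have "\<dots> \<le> a * b * exp (- \<beta> * \<bar>x - y\<bar> - \<beta> * \<bar>x - t\<bar>)"
      proof -
        have "\<beta> * \<bar>x - y\<bar> \<le> \<beta> * (\<bar>x - t\<bar> + \<bar>t - y\<bar>)" using \<beta> by (intro mult_left_mono) auto
        then show ?thesis using nn by (intro mult_left_mono) (auto simp: algebra_simps)
      qed
      also have "\<dots> = a * b * exp (- \<beta> * \<bar>x - y\<bar>) * exp (- \<beta> * \<bar>x - t\<bar>)"
        by (simp add: exp_diff exp_minus field_simps)
      finally show "norm (k t * h t) \<le> a * b * exp (- \<beta> * \<bar>x - y\<bar>) * exp (- \<beta> * \<bar>x - t\<bar>)" .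
    qed
    also have "\<dots> \<le> a * b * exp (- \<beta> * \<bar>x - y\<bar>) * C"
      unfolding sum_distrib_left[symmetric] using S[OF F] nn by (intro mult_left_mono) auto
    finally show ?thesis by (simp add: mult_ac)
  qed
  show summ: "(\<lambda>t. k t * h t) norm_summable_on S"
    by (rule nonneg_bdd_above_summable_on) (use le in \<open>auto intro!: bdd_aboveI2\<close>)
  have "norm (infsum (\<lambda>t. k t * h t) S) \<le> infsum (\<lambda>t. norm (k t * h t)) S"
    by (rule norm_infsum_bound[OF summ])
  also have "\<dots> \<le> a * b * C * exp (- \<beta> * \<bar>x - y\<bar>)"
    by (rule infsum_le_finite_sums[OF summ]) (use le in auto)
  finally show "norm (infsum (\<lambda>t. k t * h t) S) \<le> a * b * C * exp (- \<beta> * \<bar>x - y\<bar>)" .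
qed

lemma infsum_swap_dominated:
  fixes k :: "'a \<Rightarrow> complex" and h :: "'a \<Rightarrow> 'b \<Rightarrow> complex"
  assumes k: "k norm_summable_on A"
    and h: "\<And>y F. y \<in> A \<Longrightarrow> finite F \<Longrightarrow> F \<subseteq> B \<Longrightarrow> (\<Sum>z\<in>F. norm (h y z)) \<le> M"
  shows "infsum (\<lambda>y. k y * infsum (h y) B) A = infsum (\<lambda>z. infsum (\<lambda>y. k y * h y z) A) B"
    and "(\<lambda>z. infsum (\<lambda>y. k y * h y z) A) norm_summable_on B"
proof -
  have hs: "h y norm_summable_on B" if "y \<in> A" for y
    by (rule nonneg_bdd_above_summable_on) (use h[OF that] in \<open>auto intro!: bdd_aboveI2\<close>)
  have hM: "infsum (\<lambda>z. norm (h y z)) B \<le> M" if "y \<in> A" for y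
    by (rule infsum_le_finite_sums[OF hs[OF that]]) (use h[OF that] in auto)
  have kM: "(\<lambda>y. norm (k y) * M) summable_on A" using k by (rule summable_on_cmult_left)
  have "(\<lambda>(y, z). k y * h y z) norm_summable_on A \<times> B"
    unfolding Infinite_Sum.abs_summable_on_Sigma_iff
  proof (intro conjI ballI)
    fix y assume y: "y \<in> A"
    show "(\<lambda>z. case (y, z) of (y, z) \<Rightarrow> k y * h y z) norm_summable_on B"
      using summable_on_cmult_right[OF hs[OF y], of "norm (k y)"] by (simp add: norm_mult)
  next
    have e: "infsum (\<lambda>z. norm (k y * h y z)) B = norm (k y) * infsum (\<lambda>z. norm (h y z)) B" if "y \<in> A" for y
      by (simp add: norm_mult infsum_cmult_right')
    show "(\<lambda>y. \<Sum>\<^sub>\<infinity>z\<in>B. norm (case (y, z) of (y, z) \<Rightarrow> k y * h y z)) norm_summable_on A"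
      by (rule Infinite_Sum.abs_summable_on_comparison_test'[OF kM])
        (auto simp: e abs_mult infsum_nonneg intro!: mult_left_mono hM)
  qed
  then have sm: "(\<lambda>(y, z). k y * h y z) summable_on A \<times> B" by (rule abs_summable_summable)
  have sm': "(\<lambda>(z, y). k y * h y z) norm_summable_on B \<times> A"
  proof -
    have "(\<lambda>p. norm (case p of (y, z) \<Rightarrow> k y * h y z)) summable_on prod.swap ` (B \<times> A)"
      using \<open>(\<lambda>(y, z). k y * h y z) norm_summable_on A \<times> B\<close> by (simp add: product_swap)
    then show ?thesis
      by (subst (asm) summable_on_reindex) (auto simp: o_def case_prod_unfold)
  qed
  show "infsum (\<lambda>y. k y * infsum (h y) B) A = infsum (\<lambda>z. infsum (\<lambda>y. k y * h y z) A) B"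
    using infsum_swap_banach[OF sm] by (simp add: infsum_cmult_right')
  have "(\<lambda>z. infsum (\<lambda>y. norm (k y * h y z)) A) norm_summable_on B"
    and sy: "\<And>z. z \<in> B \<Longrightarrow> (\<lambda>y. k y * h y z) norm_summable_on A"
    using sm' unfolding Infinite_Sum.abs_summable_on_Sigma_iff by auto
  then show "(\<lambda>z. infsum (\<lambda>y. k y * h y z) A) norm_summable_on B"
    by (elim Infinite_Sum.abs_summable_on_comparison_test) (auto intro: norm_infsum_bound[THEN order_trans])
qed

text \<open>
  For a positive semidefinite matrix, a bound on the quadratic form bounds the operator on square
  summable sequences. Finite sections suffice: evaluate the form at \<open>v - y / \<rho>\<close> with \<open>y\<close> a finite part
  of \<open>E v\<close>, and let the section grow.
\<close>

lemma positive_contraction_square_sum: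
  fixes E :: "real \<Rightarrow> real \<Rightarrow> complex"
  assumes \<rho>: "0 < \<rho>"
    and herm: "\<And>g h. g \<in> S \<Longrightarrow> h \<in> S \<Longrightarrow> E h g = cnj (E g h)"
    and form: "\<And>F u. finite F \<Longrightarrow> F \<subseteq> S \<Longrightarrow> 0 \<le> Re (\<Sum>g\<in>F. \<Sum>h\<in>F. cnj (u g) * E g h * u h)"
      "\<And>F u. finite F \<Longrightarrow> F \<subseteq> S \<Longrightarrow>
        Re (\<Sum>g\<in>F. \<Sum>h\<in>F. cnj (u g) * E g h * u h) \<le> \<rho> * (\<Sum>g\<in>F. (norm (u g))\<^sup>2)"
    and M: "\<And>F. finite F \<Longrightarrow> F \<subseteq> S \<Longrightarrow> (\<Sum>g\<in>F. (norm (v g))\<^sup>2) \<le> M"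
    and summ: "\<And>g. g \<in> S \<Longrightarrow> (\<lambda>t. E g t * v t) summable_on S"
    and F1: "finite F1" "F1 \<subseteq> S"
  shows "(\<Sum>g\<in>F1. (norm (infsum (\<lambda>t. E g t * v t) S))\<^sup>2) \<le> \<rho>\<^sup>2 * M"
proof -
  define y where "y g = (if g \<in> F1 then infsum (\<lambda>t. E g t * v t) S else 0)" for g
  define Y where "Y = (\<Sum>g\<in>F1. (norm (y g))\<^sup>2)"
  have key: "2 / \<rho> * Re (\<Sum>g\<in>F1. cnj (y g) * (\<Sum>t\<in>F. E g t * v t)) \<le> \<rho> * M + Y / \<rho>"
    if F: "finite F" "F \<subseteq> S" "F1 \<subseteq> F" for F
  proof -
    define q where "q a b = (\<Sum>g\<in>F. \<Sum>h\<in>F. cnj (a g) * E g h * b h)" for a b :: "real \<Rightarrow> complex"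
    define w where "w g = y g / of_real \<rho>" for g
    have qsym: "q b a = cnj (q a b)" for a b
    proof -
      have "q b a = (\<Sum>h\<in>F. \<Sum>g\<in>F. cnj (b g) * E g h * a h)" unfolding q_def by (rule sum.swap)
      also have "\<dots> = cnj (q a b)"
        unfolding q_def cnj_sum
      proof (intro sum.cong refl)
        fix h g assume "h \<in> F" "g \<in> F"
        then have "E g h = cnj (E h g)" using herm F by blast
        then show "cnj (b g) * E g h * a h = cnj (cnj (a h) * E h g * b g)" by (simp add: mult_ac)
      qed
      finally show ?thesis .
    qed
    have "q (\<lambda>g. v g - w g) (\<lambda>g. v g - w g) = q v v - q w v - q v w + q w w"
      unfolding q_def by (simp add: algebra_simps sum.distrib sum_subtractf)
    then have "2 * Re (q w v) = Re (q v v) + Re (q w w) - Re (q (\<lambda>g. v g - w g) (\<lambda>g. v g - w g))"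
      using qsym[of w v] by simp
    also have "\<dots> \<le> \<rho> * (\<Sum>g\<in>F. (norm (v g))\<^sup>2) + \<rho> * (\<Sum>g\<in>F. (norm (w g))\<^sup>2)"
      using form(1)[OF F(1,2), of "\<lambda>g. v g - w g"] form(2)[OF F(1,2), of v] form(2)[OF F(1,2), of w]
      unfolding q_def by linarith
    also have "\<dots> \<le> \<rho> * M + Y / \<rho>"
    proof -
      have "(\<Sum>g\<in>F. (norm (w g))\<^sup>2) = (\<Sum>g\<in>F1. (norm (w g))\<^sup>2)"
        by (rule sum.mono_neutral_right) (use F in \<open>auto simp: w_def y_def\<close>)
      also have "\<dots> = Y / \<rho>\<^sup>2"
        unfolding Y_def sum_divide_distrib by (simp add: w_def norm_divide power_divide)
      finally have "\<rho> * (\<Sum>g\<in>F. (norm (w g))\<^sup>2) = Y / \<rho>" using \<rho> by (simp add: power2_eq_square)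
      moreover have "\<rho> * (\<Sum>g\<in>F. (norm (v g))\<^sup>2) \<le> \<rho> * M" using M[OF F(1,2)] \<rho> by simp
      ultimately show ?thesis by linarith
    qed
    finally have "2 * Re (q w v) \<le> \<rho> * M + Y / \<rho>" .
    moreover have "q w v = (\<Sum>g\<in>F1. cnj (y g) * (\<Sum>t\<in>F. E g t * v t)) / of_real \<rho>"
    proof -
      have "q w v = (\<Sum>g\<in>F. cnj (w g) * (\<Sum>t\<in>F. E g t * v t))"
        unfolding q_def by (simp add: sum_distrib_left mult.assoc)
      also have "\<dots> = (\<Sum>g\<in>F1. cnj (w g) * (\<Sum>t\<in>F. E g t * v t))"
        by (rule sum.mono_neutral_right) (use F in \<open>auto simp: w_def y_def\<close>)
      finally show ?thesis by (simp add: w_def sum_divide_distrib)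
    qed
    ultimately show ?thesis by (simp add: Re_divide_of_real)
  qed
  have lim: "((\<lambda>F. 2 / \<rho> * Re (\<Sum>g\<in>F1. cnj (y g) * (\<Sum>t\<in>F. E g t * v t))) \<longlongrightarrow>
      2 / \<rho> * Re (\<Sum>g\<in>F1. cnj (y g) * infsum (\<lambda>t. E g t * v t) S)) (finite_subsets_at_top S)"
    using summ F1 by (intro tendsto_intros infsum_tendsto) auto
  have "\<forall>\<^sub>F F in finite_subsets_at_top S.
      2 / \<rho> * Re (\<Sum>g\<in>F1. cnj (y g) * (\<Sum>t\<in>F. E g t * v t)) \<le> \<rho> * M + Y / \<rho>"
    unfolding eventually_finite_subsets_at_top using key F1 by blast
  then have "2 / \<rho> * Re (\<Sum>g\<in>F1. cnj (y g) * infsum (\<lambda>t. E g t * v t) S) \<le> \<rho> * M + Y / \<rho>"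
    by (rule tendsto_upperbound[OF lim]) simp
  moreover have "(\<Sum>g\<in>F1. cnj (y g) * infsum (\<lambda>t. E g t * v t) S) = of_real Y"
    unfolding Y_def of_real_sum
  proof (intro sum.cong refl)
    fix g assume "g \<in> F1"
    then have "infsum (\<lambda>t. E g t * v t) S = y g" by (simp add: y_def)
    then show "cnj (y g) * infsum (\<lambda>t. E g t * v t) S = of_real ((norm (y g))\<^sup>2)"
      by (metis complex_norm_square mult.commute)
  qed
  ultimately have "2 / \<rho> * Y \<le> \<rho> * M + Y / \<rho>" by simp
  then have "Y \<le> \<rho>\<^sup>2 * M" using \<rho> by (simp add: field_simps power2_eq_square)
  then show ?thesis by (simp add: Y_def y_def)
qed

text \<open>
  A bound that decays in \<open>n\<close> but not in \<open>d\<close>, and one that decays in \<open>d\<close> but may grow with \<open>n\<close>: a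
  geometric mean of the two that leans towards the first decays in both.
\<close>

lemma decay_interpolation:
  fixes x :: real
  assumes a: "0 < a" and b: "0 \<le> b" and x: "x \<le> exp (- a * n)" "x \<le> exp (b * n - d)" "0 < x"
  shows "x \<le> exp (- (a / 2) * n - a / (2 * (a + b)) * d)"
proof -
  define \<theta> where "\<theta> = a / (2 * (a + b))"
  have \<theta>: "0 \<le> \<theta>" "\<theta> \<le> 1" "\<theta> * (a + b) = a / 2" using a b by (auto simp: \<theta>_def field_simps)
  have l: "ln x \<le> - a * n" "ln x \<le> b * n - d"
    using x by (metis ln_exp ln_le_cancel_iff exp_gt_zero)+
  have "ln x = (1 - \<theta>) * ln x + \<theta> * ln x" by (simp add: algebra_simps)
  also have "\<dots> \<le> (1 - \<theta>) * (- a * n) + \<theta> * (b * n - d)"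
    using l \<theta> by (intro add_mono mult_left_mono) auto
  also have "\<dots> = (\<theta> * (a + b) - a) * n - \<theta> * d" by (simp add: algebra_simps)
  also have "\<dots> = - (a / 2) * n - \<theta> * d" unfolding \<theta>(3) by simp
  finally have "ln x \<le> - (a / 2) * n - \<theta> * d" .
  then show ?thesis using x by (metis \<theta>_def exp_le_cancel_iff exp_ln)
qed

text \<open>
  Schur's test in its symmetric form, by \<open>2 \<bar>u g u h\<bar> \<le> \<bar>u g\<bar>\<^sup>2 + \<bar>u h\<bar>\<^sup>2\<close>.
\<close>

lemma quadratic_form_schur:
  fixes A :: "real \<Rightarrow> real \<Rightarrow> complex"
  assumes S: "\<And>x F. finite F \<Longrightarrow> F \<subseteq> \<Gamma> \<Longrightarrow> (\<Sum>t\<in>F. exp (- \<beta> * \<bar>x - t\<bar>)) \<le> C"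
    and A: "\<And>g h. g \<in> \<Gamma> \<Longrightarrow> h \<in> \<Gamma> \<Longrightarrow> norm (A g h) \<le> K * exp (- \<beta> * \<bar>g - h\<bar>)"
    and K: "0 \<le> K" and F: "finite F" "F \<subseteq> \<Gamma>"
  shows "Re (\<Sum>g\<in>F. \<Sum>h\<in>F. cnj (u g) * A g h * u h) \<le> K * C * (\<Sum>g\<in>F. (norm (u g))\<^sup>2)"
proof -
  let ?e = "\<lambda>g h. exp (- \<beta> * \<bar>g - h\<bar>)"
  have "Re (\<Sum>g\<in>F. \<Sum>h\<in>F. cnj (u g) * A g h * u h)
      \<le> (\<Sum>g\<in>F. \<Sum>h\<in>F. K / 2 * ((norm (u g))\<^sup>2 * ?e g h) + K / 2 * ((norm (u h))\<^sup>2 * ?e h g))"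
    unfolding Re_sum
  proof (intro sum_mono)
    fix g h assume gh: "g \<in> F" "h \<in> F"
    have "Re (cnj (u g) * A g h * u h) \<le> norm (cnj (u g) * A g h * u h)" by (rule complex_Re_le_cmod)
    also have "\<dots> = norm (A g h) * (norm (u g) * norm (u h))" by (simp add: norm_mult)
    also have "\<dots> \<le> (K * ?e g h) * (((norm (u g))\<^sup>2 + (norm (u h))\<^sup>2) / 2)"
      using A gh F K sum_squares_bound[of "norm (u g)" "norm (u h)"] by (intro mult_mono) auto
    also have "\<dots> = K / 2 * ((norm (u g))\<^sup>2 * ?e g h) + K / 2 * ((norm (u h))\<^sup>2 * ?e h g)"
      by (simp add: abs_minus_commute algebra_simps add_divide_distrib)
    finally show "Re (cnj (u g) * A g h * u h) \<le> \<dots>" .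
  qed
  also have "\<dots> = K / 2 * (\<Sum>g\<in>F. (norm (u g))\<^sup>2 * (\<Sum>h\<in>F. ?e g h))
      + K / 2 * (\<Sum>h\<in>F. (norm (u h))\<^sup>2 * (\<Sum>g\<in>F. ?e h g))"
    unfolding sum.distrib by (subst (2) sum.swap) (simp add: sum_distrib_left)
  also have "\<dots> \<le> K / 2 * (\<Sum>g\<in>F. (norm (u g))\<^sup>2 * C) + K / 2 * (\<Sum>h\<in>F. (norm (u h))\<^sup>2 * C)"
    using S[OF F] K by (intro add_mono mult_left_mono sum_mono) auto
  also have "\<dots> = K * C * (\<Sum>g\<in>F. (norm (u g))\<^sup>2)" by (simp add: sum_distrib_right[symmetric])
  finally show ?thesis .
qed

text \<open>
  A positive definite matrix with exponential off-diagonal decay has an inverse of the same kind.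
  Scaled by a constant \<open>c2\<close> above its largest spectral value, it is \<open>1 - E\<close> with \<open>0 \<le> E \<le> \<rho> < 1\<close>, and the
  inverse is the Neumann series. The entries of \<open>E ^ n\<close> are at most \<open>\<rho> ^ n\<close> by the
  operator bound, and at most \<open>K2 ^ n * exp (- \<beta> * \<bar>g - h\<bar>)\<close> by composing kernels; the geometric mean of
  these bounds can be summed over \<open>n\<close> and still decays. Here \<open>u n h\<close> is the column \<open>h\<close> of \<open>E ^ n\<close>.
\<close>

theorem exp_decay_right_inverse:
  fixes A :: "real \<Rightarrow> real \<Rightarrow> complex"
  assumes \<Gamma>: "gap \<eta> \<Gamma>" and \<beta>: "0 < \<beta>" and K: "0 \<le> K"
    and A: "\<And>g h. g \<in> \<Gamma> \<Longrightarrow> h \<in> \<Gamma> \<Longrightarrow> norm (A g h) \<le> K * exp (- (2 * \<beta>) * \<bar>g - h\<bar>)"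
    and herm: "\<And>g h. g \<in> \<Gamma> \<Longrightarrow> h \<in> \<Gamma> \<Longrightarrow> A h g = cnj (A g h)"
    and c1: "0 < c1"
    and form: "\<And>F u. finite F \<Longrightarrow> F \<subseteq> \<Gamma> \<Longrightarrow>
      c1 * (\<Sum>g\<in>F. (norm (u g))\<^sup>2) \<le> Re (\<Sum>g\<in>F. \<Sum>h\<in>F. cnj (u g) * A g h * u h)"
  obtains B \<beta>' K' where "0 < \<beta>'" "0 \<le> K'"
    "\<And>g h. g \<in> \<Gamma> \<Longrightarrow> h \<in> \<Gamma> \<Longrightarrow> norm (B g h) \<le> K' * exp (- \<beta>' * \<bar>g - h\<bar>)"
    "\<And>g h. g \<in> \<Gamma> \<Longrightarrow> h \<in> \<Gamma> \<Longrightarrow> infsum (\<lambda>t. A g t * B t h) \<Gamma> = (if g = h then 1 else 0)"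
proof -
  obtain S where S: "0 < S" "\<And>x F. finite F \<Longrightarrow> F \<subseteq> \<Gamma> \<Longrightarrow> (\<Sum>y\<in>F. exp (- \<beta> * \<bar>x - y\<bar>)) \<le> S"
    using gap_exp_sum_bound[OF \<Gamma> \<beta>] by metis
  define c2 where "c2 = K * S + c1 + 1"
  have "0 \<le> K * S" using K S by simp
  then have c2: "0 < c2" "c1 < c2" using c1 by (auto simp: c2_def)
  define \<rho> where "\<rho> = 1 - c1 / c2"
  have \<rho>: "0 < \<rho>" "\<rho> < 1" using c1 c2 by (auto simp: \<rho>_def)
  define E where "E g h = (if g = h then 1 else 0) - A g h / of_real c2" for g h
  define K1 where "K1 = 1 + K / c2"
  define K2 where "K2 = K1 * max S 1"
  have K1: "1 \<le> K1" using K c2 by (simp add: K1_def)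
  have K2: "1 \<le> K2" using mult_mono[OF K1, of 1 "max S 1"] K1 by (simp add: K2_def)
  have E: "norm (E g h) \<le> K1 * exp (- (2 * \<beta>) * \<bar>g - h\<bar>)" if "g \<in> \<Gamma>" "h \<in> \<Gamma>" for g h
  proof -
    have "norm (E g h) \<le> norm (if g = h then 1 else 0 :: complex) + norm (A g h / of_real c2)"
      unfolding E_def by (rule norm_triangle_ineq4)
    also have "\<dots> \<le> exp (- (2 * \<beta>) * \<bar>g - h\<bar>) + K * exp (- (2 * \<beta>) * \<bar>g - h\<bar>) / c2"
      using A[OF that] c2 by (intro add_mono) (auto simp: norm_divide intro!: divide_right_mono)
    finally show ?thesis by (simp add: K1_def algebra_simps)
  qed
  have Eherm: "E h g = cnj (E g h)" if "g \<in> \<Gamma>" "h \<in> \<Gamma>" for g h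
    using herm[OF that] by (auto simp: E_def)
  have Eform: "Re (\<Sum>g\<in>F. \<Sum>h\<in>F. cnj (u g) * E g h * u h)
      = (\<Sum>g\<in>F. (norm (u g))\<^sup>2) - Re (\<Sum>g\<in>F. \<Sum>h\<in>F. cnj (u g) * A g h * u h) / c2"
    if F: "finite F" for F u
  proof -
    have "(\<Sum>h\<in>F. cnj (u g) * E g h * u h)
        = of_real ((norm (u g))\<^sup>2) - (\<Sum>h\<in>F. cnj (u g) * A g h * u h) / of_real c2" if "g \<in> F" for g
    proof -
      have "(\<Sum>h\<in>F. cnj (u g) * E g h * u h)
          = (\<Sum>h\<in>F. if g = h then cnj (u g) * u h else 0) - (\<Sum>h\<in>F. cnj (u g) * A g h * u h / of_real c2)"
        unfolding sum_subtractf[symmetric] by (intro sum.cong refl) (auto simp: E_def algebra_simps)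
      also have "(\<Sum>h\<in>F. if g = h then cnj (u g) * u h else 0) = of_real ((norm (u g))\<^sup>2)"
        using F that by (simp add: complex_norm_square mult.commute del: of_real_power)
      finally show ?thesis by (simp add: sum_divide_distrib)
    qed
    then have "(\<Sum>g\<in>F. \<Sum>h\<in>F. cnj (u g) * E g h * u h)
        = of_real (\<Sum>g\<in>F. (norm (u g))\<^sup>2) - (\<Sum>g\<in>F. \<Sum>h\<in>F. cnj (u g) * A g h * u h) / of_real c2"
      by (simp add: sum_subtractf sum_divide_distrib)
    then show ?thesis by (simp only: minus_complex.sel Re_complex_of_real Re_divide_of_real)
  qed
  have A': "norm (A g h) \<le> K * exp (- \<beta> * \<bar>g - h\<bar>)" if "g \<in> \<Gamma>" "h \<in> \<Gamma>" for g h
  proof -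
    have "- (2 * \<beta>) * \<bar>g - h\<bar> \<le> - \<beta> * \<bar>g - h\<bar>" using \<beta> by (simp add: mult_right_mono)
    then have "K * exp (- (2 * \<beta>) * \<bar>g - h\<bar>) \<le> K * exp (- \<beta> * \<bar>g - h\<bar>)" using K by (intro mult_left_mono) auto
    then show ?thesis using A[OF that] by linarith
  qed
  have Epos: "0 \<le> Re (\<Sum>g\<in>F. \<Sum>h\<in>F. cnj (u g) * E g h * u h)" if F: "finite F" "F \<subseteq> \<Gamma>" for F u
  proof -
    have "Re (\<Sum>g\<in>F. \<Sum>h\<in>F. cnj (u g) * A g h * u h) \<le> K * S * (\<Sum>g\<in>F. (norm (u g))\<^sup>2)"
      by (rule quadratic_form_schur[OF S(2) A' K F])
    also have "\<dots> \<le> c2 * (\<Sum>g\<in>F. (norm (u g))\<^sup>2)"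
      using c1 by (intro mult_right_mono sum_nonneg) (auto simp: c2_def)
    finally show ?thesis unfolding Eform[OF F(1)] using c2 by (simp add: field_simps)
  qed
  have Eup: "Re (\<Sum>g\<in>F. \<Sum>h\<in>F. cnj (u g) * E g h * u h) \<le> \<rho> * (\<Sum>g\<in>F. (norm (u g))\<^sup>2)"
    if F: "finite F" "F \<subseteq> \<Gamma>" for F u
    unfolding Eform[OF F(1)] \<rho>_def using form[OF F, of u] c2 by (simp add: field_simps)
  define u where "u n h = ((\<lambda>v g. infsum (\<lambda>t. E g t * v t) \<Gamma>) ^^ n) (\<lambda>g. if g = h then 1 else 0)" for n h
  have u0: "u 0 h g = (if g = h then 1 else 0)" for h g by (simp add: u_def)
  have uS: "u (Suc n) h g = infsum (\<lambda>t. E g t * u n h t) \<Gamma>" for n h g by (simp add: u_def)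
  have udecay: "norm (u n h g) \<le> K2 ^ n * exp (- \<beta> * \<bar>g - h\<bar>)" if "g \<in> \<Gamma>" "h \<in> \<Gamma>" for n g h
    using that
  proof (induction n arbitrary: g)
    case 0 then show ?case by (simp add: u0)
  next
    case (Suc n)
    have "norm (u (Suc n) h g) \<le> K1 * K2 ^ n * S * exp (- \<beta> * \<bar>g - h\<bar>)"
      unfolding uS by (rule exp_kernel_compose(2)[OF S(2) \<beta> E[OF Suc.prems(1)] Suc.IH])
        (use Suc.prems K1 K2 in auto)
    also have "\<dots> \<le> K2 ^ Suc n * exp (- \<beta> * \<bar>g - h\<bar>)"
    proof (rule mult_right_mono)
      have "K1 * S \<le> K2" using K1 by (simp add: K2_def)
      then have "K1 * S * K2 ^ n \<le> K2 * K2 ^ n" using K2 by (intro mult_right_mono) auto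
      then show "K1 * K2 ^ n * S \<le> K2 ^ Suc n" by (simp add: mult_ac)
    qed simp
    finally show ?case .
  qed
  have usum: "(\<lambda>t. E g t * u n h t) norm_summable_on \<Gamma>" if "g \<in> \<Gamma>" "h \<in> \<Gamma>" for n g h
    by (rule exp_kernel_compose(1)[OF S(2) \<beta> E[OF that(1)] udecay[OF _ that(2)]]) (use K1 K2 in auto)
  have usq: "(\<Sum>g\<in>F. (norm (u n h g))\<^sup>2) \<le> (\<rho>\<^sup>2) ^ n" if "finite F" "F \<subseteq> \<Gamma>" "h \<in> \<Gamma>" for F n h
    using that(1,2)
  proof (induction n arbitrary: F)
    case 0
    have "(\<Sum>g\<in>F. (norm (u 0 h g))\<^sup>2) = (\<Sum>g\<in>F. if g = h then 1 else 0)"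
      by (intro sum.cong refl) (simp add: u0)
    also have "\<dots> \<le> 1" using 0 by simp
    finally show ?case by simp
  next
    case (Suc n)
    have "(\<Sum>g\<in>F. (norm (infsum (\<lambda>t. E g t * u n h t) \<Gamma>))\<^sup>2) \<le> \<rho>\<^sup>2 * (\<rho>\<^sup>2) ^ n"
      by (rule positive_contraction_square_sum[OF \<rho>(1) Eherm Epos Eup Suc.IH abs_summable_summable[OF usum] Suc.prems])
        (use that in auto)
    then show ?case by (simp add: uS)
  qed
  have unorm: "norm (u n h g) \<le> \<rho> ^ n" if "g \<in> \<Gamma>" "h \<in> \<Gamma>" for n g h
  proof -
    have "(norm (u n h g))\<^sup>2 \<le> (\<rho> ^ n)\<^sup>2" using usq[of "{g}" h n] that by (simp add: power_mult[symmetric] mult.commute)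
    then show ?thesis using \<rho> by (simp add: power2_le_iff_abs_le)
  qed
  define a where "a = - ln \<rho>"
  define b where "b = ln K2"
  have a: "0 < a" and b: "0 \<le> b" using \<rho> K2 by (auto simp: a_def b_def)
  define \<beta>' where "\<beta>' = a / (2 * (a + b)) * \<beta>"
  have \<beta>': "0 < \<beta>'" using a b \<beta> by (simp add: \<beta>'_def add_pos_nonneg)
  define r where "r = exp (- (a / 2))"
  have r: "0 < r" "r < 1" using a by (auto simp: r_def)
  have ub: "norm (u n h g) \<le> r ^ n * exp (- \<beta>' * \<bar>g - h\<bar>)" if gh: "g \<in> \<Gamma>" "h \<in> \<Gamma>" for n g h
  proof (cases "u n h g = 0")
    case False
    have "\<rho> ^ n = exp (- a * real n)"
      using \<rho> by (simp add: a_def exp_of_nat_mult mult.commute[of _ "real n"])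
    moreover have "K2 ^ n * exp (- \<beta> * \<bar>g - h\<bar>) = exp (b * real n - \<beta> * \<bar>g - h\<bar>)"
      using K2 by (simp add: b_def exp_diff exp_minus divide_inverse exp_of_nat_mult mult.commute[of _ "real n"])
    ultimately have "norm (u n h g) \<le> exp (- (a / 2) * real n - a / (2 * (a + b)) * (\<beta> * \<bar>g - h\<bar>))"
      using unorm[OF gh, of n] udecay[OF gh, of n] False
      by (intro decay_interpolation[OF a b]) auto
    also have "\<dots> = r ^ n * exp (- \<beta>' * \<bar>g - h\<bar>)"
    proof -
      have "r ^ n = exp (real n * (- (a / 2)))" by (simp only: r_def exp_of_nat_mult)
      moreover have "- (a / 2) * real n - a / (2 * (a + b)) * (\<beta> * \<bar>g - h\<bar>)
          = real n * (- (a / 2)) + (- \<beta>' * \<bar>g - h\<bar>)" by (simp add: \<beta>'_def mult_ac)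
      ultimately show ?thesis by (simp only: exp_add)
    qed
    finally show ?thesis .
  qed (use r in simp)
  have fin_r: "(\<Sum>n\<in>N. r ^ n) \<le> 1 / (1 - r)" if "finite N" for N
  proof -
    have "(\<Sum>n\<in>N. r ^ n) \<le> (\<Sum>n. r ^ n)"
      by (rule sum_le_suminf) (use r that in \<open>auto intro: summable_geometric\<close>)
    then show ?thesis using r by (simp add: suminf_geometric)
  qed
  have uN: "(\<Sum>n\<in>N. norm (u n h g)) \<le> 1 / (1 - r) * exp (- \<beta>' * \<bar>g - h\<bar>)"
    if gh: "g \<in> \<Gamma>" "h \<in> \<Gamma>" and N: "finite N" for g h N
  proof -
    have "(\<Sum>n\<in>N. norm (u n h g)) \<le> (\<Sum>n\<in>N. r ^ n * exp (- \<beta>' * \<bar>g - h\<bar>))" by (rule sum_mono) (rule ub[OF gh])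
    also have "\<dots> \<le> 1 / (1 - r) * exp (- \<beta>' * \<bar>g - h\<bar>)"
      unfolding sum_distrib_right[symmetric] using fin_r[OF N] by (rule mult_right_mono) simp
    finally show ?thesis .
  qed
  have usn: "(\<lambda>n. u n h g) norm_summable_on UNIV" if gh: "g \<in> \<Gamma>" "h \<in> \<Gamma>" for g h
    by (rule nonneg_bdd_above_summable_on) (use uN[OF gh] in \<open>auto intro!: bdd_aboveI2\<close>)
  define B where "B g h = infsum (\<lambda>n. u n h g) UNIV / of_real c2" for g h
  show thesis
  proof (rule that[of \<beta>' "1 / (1 - r) / c2" B])
    show "0 \<le> 1 / (1 - r) / c2" using r c2 by simp
    fix g h assume gh: "g \<in> \<Gamma>" "h \<in> \<Gamma>"
    have "norm (infsum (\<lambda>n. u n h g) UNIV) \<le> infsum (\<lambda>n. norm (u n h g)) UNIV"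
      by (rule norm_infsum_bound[OF usn[OF gh]])
    also have "\<dots> \<le> 1 / (1 - r) * exp (- \<beta>' * \<bar>g - h\<bar>)"
      by (rule infsum_le_finite_sums[OF usn[OF gh]]) (use uN[OF gh] in auto)
    finally show "norm (B g h) \<le> 1 / (1 - r) / c2 * exp (- \<beta>' * \<bar>g - h\<bar>)"
      using divide_right_mono[of _ _ c2] c2 unfolding B_def norm_divide by fastforce
    have Asum: "(\<lambda>t. A g t) norm_summable_on \<Gamma>"
      by (rule exp_kernel_abs_summable[OF \<Gamma> \<beta> A'[OF gh(1)]])
    have ubd: "(\<Sum>n\<in>N. norm (u n h t / of_real c2)) \<le> 1 / (1 - r) / c2" if "t \<in> \<Gamma>" "finite N" for t N
    proof -
      have "1 / (1 - r) * exp (- \<beta>' * \<bar>t - h\<bar>) \<le> 1 / (1 - r) * 1"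
        using r \<beta>' by (intro mult_left_mono) auto
      then have "(\<Sum>n\<in>N. norm (u n h t)) \<le> 1 / (1 - r)" using uN[OF that(1) gh(2) that(2)] by linarith
      from divide_right_mono[OF this, of c2] show ?thesis
        using c2 by (simp add: norm_divide sum_divide_distrib[symmetric])
    qed
    \<comment> \<open>\<open>A = c2 (1 - E)\<close> makes the series telescope.\<close>
    have step: "infsum (\<lambda>t. A g t * (u n h t / of_real c2)) \<Gamma> = u n h g - u (Suc n) h g" for n
    proof -
      have "((\<lambda>t. if t = g then u n h g else 0) has_sum u n h g) \<Gamma>"
        by (rule has_sum_finite_neutralI[of "{g}"]) (use gh in auto)
      moreover have "((\<lambda>t. - (E g t * u n h t)) has_sum - infsum (\<lambda>t. E g t * u n h t) \<Gamma>) \<Gamma>"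
        by (rule has_sum_uminusI[OF has_sum_infsum[OF abs_summable_summable[OF usum[OF gh]]]])
      ultimately have "((\<lambda>t. (if t = g then u n h g else 0) + - (E g t * u n h t)) has_sum
          (u n h g + - infsum (\<lambda>t. E g t * u n h t) \<Gamma>)) \<Gamma>" by (rule has_sum_add)
      moreover have "(if t = g then u n h g else 0) + - (E g t * u n h t) = A g t * (u n h t / of_real c2)" for t
        using c2 by (auto simp: E_def algebra_simps)
      ultimately show ?thesis by (simp add: uS infsumI)
    qed
    have "infsum (\<lambda>t. A g t * B t h) \<Gamma> = infsum (\<lambda>t. A g t * infsum (\<lambda>n. u n h t / of_real c2) UNIV) \<Gamma>"
      by (simp add: B_def divide_inverse infsum_cmult_left')
    also have "\<dots> = infsum (\<lambda>n. u n h g - u (Suc n) h g) UNIV"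
      using infsum_swap_dominated(1)[OF Asum, of UNIV "\<lambda>t n. u n h t / of_real c2"] ubd
      unfolding step by blast
    also have "\<dots> = (if g = h then 1 else 0)"
    proof -
      have "(\<lambda>n. u n h g - u (Suc n) h g) summable_on UNIV"
        using infsum_swap_dominated(2)[OF Asum, of UNIV "\<lambda>t n. u n h t / of_real c2"] ubd
        unfolding step by (blast intro: abs_summable_summable)
      then have "(\<lambda>n. u n h g - u (Suc n) h g) sums infsum (\<lambda>n. u n h g - u (Suc n) h g) UNIV"
        by (intro has_sum_imp_sums has_sum_infsum)
      moreover have "(\<lambda>n. u n h g) \<longlonglongrightarrow> 0"
      proof (rule Lim_null_comparison)
        show "\<forall>\<^sub>F n in sequentially. norm (u n h g) \<le> \<rho> ^ n" using unorm[OF gh] by simp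
        show "(\<lambda>n. \<rho> ^ n) \<longlonglongrightarrow> 0" using \<rho> by (intro LIMSEQ_power_zero) simp
      qed
      then have "(\<lambda>n. u n h g - u (Suc n) h g) sums (u 0 h g - 0)" by (rule telescope_sums')
      ultimately show ?thesis by (simp add: sums_iff u0)
    qed
    finally show "infsum (\<lambda>t. A g t * B t h) \<Gamma> = (if g = h then 1 else 0)" .
  qed (rule \<beta>')
qed

section \<open>A lower bound for the Gram matrix\<close>

lemma continuous_on_translate:
  fixes G :: "complex \<Rightarrow> complex"
  assumes cont: "continuous_on UNIV (\<lambda>x::real. G (of_real x))"
  shows "continuous_on UNIV (\<lambda>x::real. G (of_real (x - g)))" "continuous_on UNIV (\<lambda>x::real. G (of_real (g - x)))"
proof -
  have "continuous_on UNIV (\<lambda>x::real. x - g)" "continuous_on UNIV (\<lambda>x::real. g - x)"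
    by (intro continuous_intros)+
  then show "continuous_on UNIV (\<lambda>x::real. G (of_real (x - g)))" "continuous_on UNIV (\<lambda>x::real. G (of_real (g - x)))"
    using continuous_on_compose2[OF cont] by blast+
qed

lemma has_sum_finite_sum:
  fixes f :: "'a \<Rightarrow> 'b \<Rightarrow> complex"
  assumes "finite F" "\<And>g. g \<in> F \<Longrightarrow> (f g has_sum s g) A"
  shows "((\<lambda>l. \<Sum>g\<in>F. f g l) has_sum (\<Sum>g\<in>F. s g)) A"
  using assms by (induction F rule: finite_induct) (auto intro!: has_sum_add)

lemma integrable_exp_abs:
  fixes b y :: real
  assumes b: "0 < b"
  shows "integrable lborel (\<lambda>x::real. exp (- b * \<bar>x - y\<bar>))"
proof -
  let ?e = "exponential_density b"
  have int: "integrable lborel ?e"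
  proof (rule integrableI_nonneg)
    interpret prob_space "density lborel ?e" by (rule prob_space_exponential_density[OF b])
    have "(\<integral>\<^sup>+x. ennreal (?e x) \<partial>lborel) = 1"
      using emeasure_space_1 by (simp add: emeasure_density)
    then show "(\<integral>\<^sup>+x. ennreal (?e x) \<partial>lborel) < \<infinity>" by simp
    show "AE x in lborel. 0 \<le> ?e x" using b by (auto intro: exponential_density_nonneg)
  qed simp
  have "integrable lborel (\<lambda>x. ?e ((- y) + 1 * x) + ?e (y + (- 1) * x))"
    by (intro Bochner_Integration.integrable_add lborel_integrable_real_affine int) auto
  then have "integrable lborel (\<lambda>x. (1 / b) * (?e ((- y) + 1 * x) + ?e (y + (- 1) * x)))" by (rule integrable_mult_right)
  then show ?thesis
  proof (rule Bochner_Integration.integrable_bound)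
    have le: "exp (- b * \<bar>x - y\<bar>) \<le> (1 / b) * (?e ((- y) + 1 * x) + ?e (y + (- 1) * x))" for x
      using b by (cases "x < y"; cases "y < x") (auto simp: exponential_density_def algebra_simps)
    show "AE x in lborel. norm (exp (- b * \<bar>x - y\<bar>)) \<le> norm ((1 / b) * (?e ((- y) + 1 * x) + ?e (y + (- 1) * x)))"
      unfolding real_norm_def abs_exp_cancel by (intro AE_I2 order_trans[OF le abs_ge_self])
  qed measurable
qed

lemma norm_powr_two: "norm z powr 2 = (norm z)\<^sup>2"
  by (cases "norm z = 0") auto

lemma ennroot_two: "0 \<le> a \<Longrightarrow> ennroot 2 (ennreal a) = ennreal (sqrt a)"
  by (simp add: ennroot_def powr_half_sqrt)

text \<open>
  For finitely supported coefficients the extended \<open>L\<^sup>2\<close> norms in the definition of stability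
  reduce to squares of finite sums.
\<close>

lemma stable_shifts_L2_lower:
  assumes stable: "stable_shifts \<Gamma> G" and cont: "continuous_on UNIV (\<lambda>x::real. G (of_real x))"
  obtains C where "0 < C" "\<And>F v. finite F \<Longrightarrow> F \<subseteq> \<Gamma> \<Longrightarrow> ennreal (C * (\<Sum>g\<in>F. (norm (v g))\<^sup>2))
    \<le> (\<integral>\<^sup>+x. ennreal ((norm (\<Sum>g\<in>F. v g * G (of_real (x - g))))\<^sup>2) \<partial>lborel)"
proof -
  have "(1::ennreal) \<le> 2" by simp
  then obtain C1 where C1: "0 < C1"
    and st: "\<And>c. c \<in> lp 2 \<Gamma> \<Longrightarrow> ennreal C1 * lp_norm 2 \<Gamma> c \<le> Lp_norm 2 lborel (shift_sum \<Gamma> G c)"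
    using stable unfolding stable_shifts_def by blast
  show thesis
  proof (rule that[of "C1\<^sup>2"])
    show "0 < C1\<^sup>2" using C1 by simp
    fix F and v :: "real \<Rightarrow> complex" assume F: "finite F" "F \<subseteq> \<Gamma>"
    define c where "c x = (if x \<in> F then v x else 0)" for x
    define a where "a = (\<Sum>g\<in>F. (norm (v g))\<^sup>2)"
    define f where "f x = (\<Sum>g\<in>F. v g * G (of_real (x - g)))" for x
    have a0: "0 \<le> a" by (simp add: a_def sum_nonneg)
    have "(\<integral>\<^sup>+x. ennreal ((norm (c x))\<^sup>2) \<partial>count_space \<Gamma>) = (\<Sum>x\<in>F. ennreal ((norm (c x))\<^sup>2))"
      by (rule nn_integral_count_space') (use F in \<open>auto simp: c_def\<close>)
    also have "\<dots> = ennreal a" by (simp add: a_def c_def sum_ennreal)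
    finally have lpc: "lp_norm 2 \<Gamma> c = ennreal (sqrt a)"
      using a0 by (simp add: Lp_norm_def norm_powr_two ennroot_two)
    then have c: "c \<in> lp 2 \<Gamma>" by (simp add: lp_def)
    have fs: "shift_sum \<Gamma> G c = f"
    proof
      fix x
      have "shift_sum \<Gamma> G c x = infsum (\<lambda>l. c l * G (of_real (x - l))) F"
        unfolding shift_sum_def by (rule infsum_cong_neutral) (use F in \<open>auto simp: c_def\<close>)
      then show "shift_sum \<Gamma> G c x = f x" using F by (simp add: f_def c_def)
    qed
    have "continuous_on UNIV f" unfolding f_def by (intro continuous_intros continuous_on_translate[OF cont])
    then have fm: "f \<in> borel_measurable lborel" by (simp add: borel_measurable_continuous_onI)
    show "ennreal (C1\<^sup>2 * (\<Sum>g\<in>F. (norm (v g))\<^sup>2))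
      \<le> (\<integral>\<^sup>+x. ennreal ((norm (\<Sum>g\<in>F. v g * G (of_real (x - g))))\<^sup>2) \<partial>lborel)"
      unfolding f_def[symmetric] a_def[symmetric]
    proof (cases "(\<integral>\<^sup>+x. ennreal ((norm (f x))\<^sup>2) \<partial>lborel)")
      case (real i)
      have "ennreal C1 * ennreal (sqrt a) \<le> ennreal (sqrt i)"
        using st[OF c] fm real unfolding lpc fs by (simp add: Lp_norm_def norm_powr_two ennroot_two)
      then have "C1 * sqrt a \<le> sqrt i"
        using C1 a0 real by (simp flip: ennreal_mult)
      then have "(C1 * sqrt a)\<^sup>2 \<le> (sqrt i)\<^sup>2" using C1 a0 by (intro power_mono) auto
      then show "ennreal (C1\<^sup>2 * a) \<le> (\<integral>\<^sup>+x. ennreal ((norm (f x))\<^sup>2) \<partial>lborel)"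
        using a0 real by (simp add: power_mult_distrib)
    qed simp
  qed
qed

text \<open>
  Stability concerns the shifts \<open>G (x - g)\<close>, while interpolation at \<open>\<Gamma>\<close> involves \<open>G (g - x)\<close>. In
  \<open>L\<^sup>2\<close> there is no difference: by the substitution \<open>x \<mapsto> g + h - x\<close>, the correlation of the shifts by \<open>g\<close> and
  \<open>h\<close> becomes that of the reflected shifts by \<open>h\<close> and \<open>g\<close>, and conjugating the coefficients
  restores the order.
\<close>

lemma reflection_preserves_L2:
  fixes G :: "complex \<Rightarrow> complex"
  assumes \<alpha>: "0 < \<alpha>" and cont: "continuous_on UNIV (\<lambda>x::real. G (of_real x))"
    and dec: "\<And>x::real. norm (G (of_real x)) \<le> K * exp (- \<alpha> * \<bar>x\<bar>)"
    and F: "finite F"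
  shows "(\<integral>\<^sup>+x. ennreal ((norm (\<Sum>g\<in>F. v g * G (of_real (x - g))))\<^sup>2) \<partial>lborel)
       = (\<integral>\<^sup>+x. ennreal ((norm (\<Sum>g\<in>F. cnj (v g) * G (of_real (g - x))))\<^sup>2) \<partial>lborel)"
proof -
  have K: "0 \<le> K" using order_trans[OF norm_ge_zero dec[of 0]] by simp
  have bd: "norm (G (of_real u) * cnj (G (of_real w))) \<le> K * K * exp (- \<alpha> * \<bar>u\<bar>)" for u w :: real
  proof -
    have "norm (G (of_real w)) \<le> K * exp (- \<alpha> * \<bar>w\<bar>)" by (rule dec)
    also have "\<dots> \<le> K * 1" using K \<alpha> by (intro mult_left_mono) auto
    finally have "norm (G (of_real u)) * norm (G (of_real w)) \<le> (K * exp (- \<alpha> * \<bar>u\<bar>)) * K"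
      using dec[of u] K by (intro mult_mono) auto
    then show ?thesis by (simp add: norm_mult mult_ac)
  qed
  have int1: "integrable lborel (\<lambda>x. G (of_real (x - g)) * cnj (G (of_real (x - h))))" for g h
  proof (rule Bochner_Integration.integrable_bound)
    show "integrable lborel (\<lambda>x. K * K * exp (- \<alpha> * \<bar>x - g\<bar>))" using integrable_exp_abs[OF \<alpha>] by simp
    show "(\<lambda>x. G (of_real (x - g)) * cnj (G (of_real (x - h)))) \<in> borel_measurable lborel"
      unfolding measurable_lborel2
      by (intro borel_measurable_continuous_onI continuous_intros continuous_on_translate[OF cont])
    show "AE x in lborel. norm (G (of_real (x - g)) * cnj (G (of_real (x - h)))) \<le> norm (K * K * exp (- \<alpha> * \<bar>x - g\<bar>))"
    proof (rule AE_I2)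
      fix x
      show "norm (G (of_real (x - g)) * cnj (G (of_real (x - h)))) \<le> norm (K * K * exp (- \<alpha> * \<bar>x - g\<bar>))"
        using bd[of "x - g" "x - h"] K by (simp del: of_real_diff)
    qed
  qed
  define I where "I g h = (\<integral>x. G (of_real (x - g)) * cnj (G (of_real (x - h))) \<partial>lborel)" for g h
  have flip: "(\<integral>x. G (of_real (g - x)) * cnj (G (of_real (h - x))) \<partial>lborel) = I h g"
    and int2: "integrable lborel (\<lambda>x. G (of_real (g - x)) * cnj (G (of_real (h - x))))" for g h
  proof -
    have e: "G (of_real (g + h + - 1 * x - h)) * cnj (G (of_real (g + h + - 1 * x - g)))
        = G (of_real (g - x)) * cnj (G (of_real (h - x)))" for x
      by (simp add: algebra_simps)
    show "(\<integral>x. G (of_real (g - x)) * cnj (G (of_real (h - x))) \<partial>lborel) = I h g"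
      unfolding I_def using lborel_integral_real_affine[of "- 1" "\<lambda>x. G (of_real (x - h)) * cnj (G (of_real (x - g)))" "g + h"]
      unfolding e by simp
    show "integrable lborel (\<lambda>x. G (of_real (g - x)) * cnj (G (of_real (h - x))))"
      using lborel_integrable_real_affine[OF int1[of h g], of "- 1" "g + h"] unfolding e by simp
  qed
  have sq: "(\<integral>\<^sup>+x. ennreal ((norm (\<Sum>g\<in>F. w g * H g x))\<^sup>2) \<partial>lborel)
      = ennreal (Re (\<Sum>g\<in>F. \<Sum>h\<in>F. w g * cnj (w h) * (\<integral>x. H g x * cnj (H h x) \<partial>lborel)))"
    if int: "\<And>g h. integrable lborel (\<lambda>x. H g x * cnj (H h x))"
    for w :: "real \<Rightarrow> complex" and H :: "real \<Rightarrow> real \<Rightarrow> complex"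
  proof -
    have e: "complex_of_real ((norm (\<Sum>g\<in>F. w g * H g x))\<^sup>2)
        = (\<Sum>g\<in>F. \<Sum>h\<in>F. w g * cnj (w h) * (H g x * cnj (H h x)))" for x
      unfolding complex_norm_square cnj_sum sum_product by (simp add: mult_ac)
    have ic: "integrable lborel (\<lambda>x. complex_of_real ((norm (\<Sum>g\<in>F. w g * H g x))\<^sup>2))"
      unfolding e using int by (intro Bochner_Integration.integrable_sum integrable_mult_right) auto
    then have ir: "integrable lborel (\<lambda>x. (norm (\<Sum>g\<in>F. w g * H g x))\<^sup>2)"
      using integrable_Re[OF ic] by (simp only: Re_complex_of_real)
    have "complex_of_real (\<integral>x. (norm (\<Sum>g\<in>F. w g * H g x))\<^sup>2 \<partial>lborel)
        = (\<integral>x. complex_of_real ((norm (\<Sum>g\<in>F. w g * H g x))\<^sup>2) \<partial>lborel)" by (rule integral_complex_of_real[symmetric])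
    also have "\<dots> = (\<Sum>g\<in>F. \<Sum>h\<in>F. w g * cnj (w h) * (\<integral>x. H g x * cnj (H h x) \<partial>lborel))"
      unfolding e using int by (simp add: Bochner_Integration.integral_sum)
    finally have "(\<integral>x. (norm (\<Sum>g\<in>F. w g * H g x))\<^sup>2 \<partial>lborel)
        = Re (\<Sum>g\<in>F. \<Sum>h\<in>F. w g * cnj (w h) * (\<integral>x. H g x * cnj (H h x) \<partial>lborel))"
      by (metis Re_complex_of_real)
    then show ?thesis using nn_integral_eq_integral[OF ir] by simp
  qed
  have "(\<Sum>g\<in>F. \<Sum>h\<in>F. v g * cnj (v h) * I g h) = (\<Sum>g\<in>F. \<Sum>h\<in>F. cnj (v g) * cnj (cnj (v h)) * I h g)"
    by (subst sum.swap) (simp add: mult_ac)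
  then show ?thesis unfolding sq[OF int1] sq[OF int2] flip I_def[symmetric] by simp
qed

text \<open>
  The Cauchy--Schwarz inequality with the weight \<open>exp (- \<bar>x - l\<bar>)\<close> split into halves, by
  bounding each weighted term by the square root of the sum of squares.
\<close>

lemma exp_weighted_square:
  fixes v :: "real \<Rightarrow> real"
  assumes X: "finite X" and S: "(\<Sum>l\<in>X. exp (- (1/2) * \<bar>x - l\<bar>)) \<le> S" and v: "\<And>l. 0 \<le> v l"
  shows "(\<Sum>l\<in>X. exp (- \<bar>x - l\<bar>) * v l)\<^sup>2 \<le> S\<^sup>2 * (\<Sum>l\<in>X. exp (- \<bar>x - l\<bar>) * (v l)\<^sup>2)"
proof -
  define T where "T = (\<Sum>l\<in>X. exp (- \<bar>x - l\<bar>) * (v l)\<^sup>2)"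
  have T0: "0 \<le> T" by (simp add: T_def sum_nonneg)
  have half: "exp (- \<bar>x - l\<bar>) = exp (- (1/2) * \<bar>x - l\<bar>) * exp (- (1/2) * \<bar>x - l\<bar>)" for l
    by (simp flip: exp_add)
  have le: "exp (- (1/2) * \<bar>x - l\<bar>) * v l \<le> sqrt T" if "l \<in> X" for l
  proof (rule real_le_rsqrt)
    have "(exp (- (1/2) * \<bar>x - l\<bar>) * v l)\<^sup>2 = exp (- \<bar>x - l\<bar>) * (v l)\<^sup>2"
      unfolding half by (simp add: power2_eq_square mult_ac)
    also have "\<dots> \<le> T" unfolding T_def by (rule member_le_sum) (use that X in auto)
    finally show "(exp (- (1/2) * \<bar>x - l\<bar>) * v l)\<^sup>2 \<le> T" .
  qed
  have "(\<Sum>l\<in>X. exp (- \<bar>x - l\<bar>) * v l) = (\<Sum>l\<in>X. exp (- (1/2) * \<bar>x - l\<bar>) * (exp (- (1/2) * \<bar>x - l\<bar>) * v l))"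
    unfolding half by (simp only: mult.assoc)
  also have "\<dots> \<le> (\<Sum>l\<in>X. exp (- (1/2) * \<bar>x - l\<bar>) * sqrt T)"
    using le by (intro sum_mono mult_left_mono) auto
  also have "\<dots> \<le> S * sqrt T" unfolding sum_distrib_right[symmetric] using S T0 by (intro mult_right_mono) auto
  finally have "(\<Sum>l\<in>X. exp (- \<bar>x - l\<bar>) * v l)\<^sup>2 \<le> (S * sqrt T)\<^sup>2"
    using v by (intro power_mono sum_nonneg) auto
  then show ?thesis using T0 by (simp add: power_mult_distrib T_def)
qed

lemma sum_le_nn_integral_count_space:
  assumes "finite X" "X \<subseteq> \<Lambda>"
  shows "(\<Sum>l\<in>X. f l) \<le> (\<integral>\<^sup>+l. f l \<partial>count_space \<Lambda>)"
proof -
  have "(\<Sum>l\<in>X. f l) = (\<integral>\<^sup>+l. (if l \<in> X then f l else 0) \<partial>count_space \<Lambda>)"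
    using assms by (subst nn_integral_count_space'[of X]) auto
  also have "\<dots> \<le> (\<integral>\<^sup>+l. f l \<partial>count_space \<Lambda>)" by (intro nn_integral_mono) auto
  finally show ?thesis .
qed

lemma nn_integral_exp_abs:
  obtains j where "0 \<le> j" "\<And>l::real. (\<integral>\<^sup>+x. ennreal (exp (- \<bar>x - l\<bar>)) \<partial>lborel) = ennreal j"
proof -
  have int: "integrable lborel (\<lambda>x::real. exp (- \<bar>x\<bar>))" using integrable_exp_abs[of 1 0] by simp
  define j where "j = (\<integral>x. exp (- \<bar>x\<bar>) \<partial>(lborel :: real measure))"
  have 0: "(\<integral>\<^sup>+x. ennreal (exp (- \<bar>x::real\<bar>)) \<partial>lborel) = ennreal j"
    unfolding j_def by (rule nn_integral_eq_integral[OF int]) simp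
  show thesis
  proof (rule that[of j])
    show "0 \<le> j" by (simp add: j_def)
    fix l :: real
    show "(\<integral>\<^sup>+x. ennreal (exp (- \<bar>x - l\<bar>)) \<partial>lborel) = ennreal j"
      using nn_integral_real_affine[of "\<lambda>x::real. ennreal (exp (- \<bar>x\<bar>))" 1 "- l"] 0 by simp
  qed
qed

definition gram_kernel :: "(complex \<Rightarrow> complex) \<Rightarrow> real set \<Rightarrow> real \<Rightarrow> real \<Rightarrow> complex" where
  "gram_kernel G \<Lambda> g h = infsum (\<lambda>l. G (of_real (g - l)) * cnj (G (of_real (h - l)))) \<Lambda>"

lemma gram_kernel_form:
  fixes G :: "complex \<Rightarrow> complex"
  assumes \<Lambda>: "gap \<delta> \<Lambda>" and \<alpha>: "0 < \<alpha>" and dec: "\<And>x::real. norm (G (of_real x)) \<le> K * exp (- \<alpha> * \<bar>x\<bar>)"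
    and F: "finite F"
  shows "((\<lambda>l. (norm (\<Sum>g\<in>F. w g * G (of_real (g - l))))\<^sup>2) has_sum
      Re (\<Sum>g\<in>F. \<Sum>h\<in>F. w g * gram_kernel G \<Lambda> g h * cnj (w h))) \<Lambda>"
proof -
  have K: "0 \<le> K" using order_trans[OF norm_ge_zero dec[of 0]] by simp
  have "(\<lambda>l. G (of_real (g - l)) * cnj (G (of_real (h - l)))) norm_summable_on \<Lambda>" for g h
  proof (rule exp_kernel_abs_summable[OF \<Lambda> \<alpha>])
    fix l
    have "norm (G (of_real (h - l))) \<le> K * exp (- \<alpha> * \<bar>h - l\<bar>)" by (rule dec)
    also have "\<dots> \<le> K * 1" using K \<alpha> by (intro mult_left_mono) auto
    finally have "norm (G (of_real (g - l))) * norm (G (of_real (h - l))) \<le> (K * exp (- \<alpha> * \<bar>g - l\<bar>)) * K"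
      using dec[of "g - l"] K by (intro mult_mono) auto
    then show "norm (G (of_real (g - l)) * cnj (G (of_real (h - l)))) \<le> K * K * exp (- \<alpha> * \<bar>g - l\<bar>)"
      by (simp add: norm_mult mult_ac)
  qed
  then have hs: "((\<lambda>l. G (of_real (g - l)) * cnj (G (of_real (h - l)))) has_sum gram_kernel G \<Lambda> g h) \<Lambda>" for g h
    unfolding gram_kernel_def by (rule has_sum_infsum[OF abs_summable_summable])
  have "((\<lambda>l. \<Sum>g\<in>F. \<Sum>h\<in>F. (w g * cnj (w h)) * (G (of_real (g - l)) * cnj (G (of_real (h - l)))))
      has_sum (\<Sum>g\<in>F. \<Sum>h\<in>F. (w g * cnj (w h)) * gram_kernel G \<Lambda> g h)) \<Lambda>"
    by (intro has_sum_finite_sum has_sum_cmult_right hs F)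
  moreover have "(\<Sum>g\<in>F. \<Sum>h\<in>F. (w g * cnj (w h)) * (G (of_real (g - l)) * cnj (G (of_real (h - l)))))
      = of_real ((norm (\<Sum>g\<in>F. w g * G (of_real (g - l))))\<^sup>2)" for l
    unfolding complex_norm_square cnj_sum sum_product by (simp add: mult_ac)
  ultimately have "((\<lambda>l. complex_of_real ((norm (\<Sum>g\<in>F. w g * G (of_real (g - l))))\<^sup>2))
      has_sum (\<Sum>g\<in>F. \<Sum>h\<in>F. w g * gram_kernel G \<Lambda> g h * cnj (w h))) \<Lambda>" by (simp add: mult_ac)
  from has_sum_Re[OF this] show ?thesis by (simp only: Re_complex_of_real)
qed

text \<open>
  Squaring the pointwise sampling bound and integrating it over \<open>x\<close> bounds the \<open>L\<^sup>2\<close> norm of a sum of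
  reflected shifts by the \<open>l\<^sup>2\<close> norm of its samples on \<open>\<Lambda>\<close>, whose square is the Gram form. By
  stability and reflection, the \<open>L\<^sup>2\<close> norm dominates the coefficients.
\<close>

lemma gram_kernel_lower_bound:
  fixes G :: "complex \<Rightarrow> complex"
  assumes \<Lambda>: "gap \<delta> \<Lambda>" "countable \<Lambda>" and \<alpha>: "0 < \<alpha>"
    and dec: "\<And>x::real. norm (G (of_real x)) \<le> K * exp (- \<alpha> * \<bar>x\<bar>)"
    and cont: "continuous_on UNIV (\<lambda>x::real. G (of_real x))"
    and stable: "stable_shifts \<Gamma> G" and M: "0 \<le> M"
    and samp: "\<And>x F v. finite F \<Longrightarrow> F \<subseteq> \<Gamma> \<Longrightarrow>
      \<exists>X. finite X \<and> X \<subseteq> \<Lambda> \<and> norm (\<Sum>g\<in>F. v g * G (of_real (g - x)))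
        \<le> M * (\<Sum>l\<in>X. exp (- \<bar>x - l\<bar>) * norm (\<Sum>g\<in>F. v g * G (of_real (g - l))))"
  obtains c where "0 < c" "\<And>F u. finite F \<Longrightarrow> F \<subseteq> \<Gamma> \<Longrightarrow> c * (\<Sum>g\<in>F. (norm (u g))\<^sup>2)
    \<le> Re (\<Sum>g\<in>F. \<Sum>h\<in>F. cnj (u g) * gram_kernel G \<Lambda> g h * u h)"
proof -
  obtain C where C: "0 < C" "\<And>F v. finite F \<Longrightarrow> F \<subseteq> \<Gamma> \<Longrightarrow> ennreal (C * (\<Sum>g\<in>F. (norm (v g))\<^sup>2))
    \<le> (\<integral>\<^sup>+x. ennreal ((norm (\<Sum>g\<in>F. v g * G (of_real (x - g))))\<^sup>2) \<partial>lborel)"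
    by (rule stable_shifts_L2_lower[OF stable cont]) (rule that)
  obtain S where S: "0 < S" "\<And>x F. finite F \<Longrightarrow> F \<subseteq> \<Lambda> \<Longrightarrow> (\<Sum>y\<in>F. exp (- (1/2) * \<bar>x - y\<bar>)) \<le> S"
    by (rule gap_exp_sum_bound[OF \<Lambda>(1), of "1/2"]) (simp, rule that)
  obtain j where j: "0 \<le> j" "\<And>l::real. (\<integral>\<^sup>+x. ennreal (exp (- \<bar>x - l\<bar>)) \<partial>lborel) = ennreal j"
    by (rule nn_integral_exp_abs) (rule that)
  define R where "R = M\<^sup>2 * S\<^sup>2 * j + 1"
  have R: "0 < R" using j by (simp add: R_def add_nonneg_pos)
  show thesis
  proof (rule that[of "C / R"])
    show "0 < C / R" using C R by simp
    fix F u assume F: "finite F" "F \<subseteq> \<Gamma>"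
    define f where "f x = norm (\<Sum>g\<in>F. cnj (u g) * G (of_real (g - x)))" for x
    define s where "s = Re (\<Sum>g\<in>F. \<Sum>h\<in>F. cnj (u g) * gram_kernel G \<Lambda> g h * u h)"
    have hs: "((\<lambda>l. (f l)\<^sup>2) has_sum s) \<Lambda>"
      using gram_kernel_form[OF \<Lambda>(1) \<alpha> dec F(1), of "\<lambda>g. cnj (u g)"] unfolding f_def s_def by simp
    have s0: "0 \<le> s" using has_sum_nonneg[OF hs] by simp
    have pt: "ennreal ((f x)\<^sup>2) \<le> (\<integral>\<^sup>+l. ennreal (M\<^sup>2 * S\<^sup>2 * (f l)\<^sup>2) * ennreal (exp (- \<bar>x - l\<bar>)) \<partial>count_space \<Lambda>)" for x
    proof -
      obtain X where X: "finite X" "X \<subseteq> \<Lambda>" "f x \<le> M * (\<Sum>l\<in>X. exp (- \<bar>x - l\<bar>) * f l)"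
        using samp[OF F, of "\<lambda>g. cnj (u g)" x] unfolding f_def by blast
      have "(f x)\<^sup>2 \<le> (M * (\<Sum>l\<in>X. exp (- \<bar>x - l\<bar>) * f l))\<^sup>2"
        using X(3) by (intro power_mono) (auto simp: f_def)
      also have "\<dots> \<le> M\<^sup>2 * (S\<^sup>2 * (\<Sum>l\<in>X. exp (- \<bar>x - l\<bar>) * (f l)\<^sup>2))"
        unfolding power_mult_distrib
        by (intro mult_left_mono exp_weighted_square[OF X(1) S(2)[OF X(1,2)]]) (auto simp: f_def)
      also have "\<dots> = (\<Sum>l\<in>X. M\<^sup>2 * S\<^sup>2 * (f l)\<^sup>2 * exp (- \<bar>x - l\<bar>))"
        by (simp add: sum_distrib_left mult_ac)
      finally have "ennreal ((f x)\<^sup>2) \<le> (\<Sum>l\<in>X. ennreal (M\<^sup>2 * S\<^sup>2 * (f l)\<^sup>2 * exp (- \<bar>x - l\<bar>)))"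
        by (simp add: sum_ennreal ennreal_leI)
      also have "\<dots> \<le> (\<integral>\<^sup>+l. ennreal (M\<^sup>2 * S\<^sup>2 * (f l)\<^sup>2 * exp (- \<bar>x - l\<bar>)) \<partial>count_space \<Lambda>)"
        by (rule sum_le_nn_integral_count_space[OF X(1,2)])
      finally show ?thesis by (simp add: ennreal_mult)
    qed
    have "ennreal (C * (\<Sum>g\<in>F. (norm (u g))\<^sup>2)) \<le> (\<integral>\<^sup>+x. ennreal ((f x)\<^sup>2) \<partial>lborel)"
      using C(2)[OF F, of u] unfolding reflection_preserves_L2[OF \<alpha> cont dec F(1)] f_def .
    also have "\<dots> \<le> (\<integral>\<^sup>+x. \<integral>\<^sup>+l. ennreal (M\<^sup>2 * S\<^sup>2 * (f l)\<^sup>2) * ennreal (exp (- \<bar>x - l\<bar>)) \<partial>count_space \<Lambda> \<partial>lborel)"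
      by (rule nn_integral_mono) (rule pt)
    also have "\<dots> = (\<integral>\<^sup>+l. \<integral>\<^sup>+x. ennreal (M\<^sup>2 * S\<^sup>2 * (f l)\<^sup>2) * ennreal (exp (- \<bar>x - l\<bar>)) \<partial>lborel \<partial>count_space \<Lambda>)"
      by (rule nn_integral_count_space_nn_integral[OF \<Lambda>(2)]) measurable
    also have "\<dots> = (\<integral>\<^sup>+l. ennreal (M\<^sup>2 * S\<^sup>2 * j * (f l)\<^sup>2) \<partial>count_space \<Lambda>)"
    proof (rule nn_integral_cong)
      fix l
      have "(\<integral>\<^sup>+x. ennreal (M\<^sup>2 * S\<^sup>2 * (f l)\<^sup>2) * ennreal (exp (- \<bar>x - l\<bar>)) \<partial>lborel)
          = ennreal (M\<^sup>2 * S\<^sup>2 * (f l)\<^sup>2) * ennreal j"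
        by (subst nn_integral_cmult) (simp_all add: j)
      then show "(\<integral>\<^sup>+x. ennreal (M\<^sup>2 * S\<^sup>2 * (f l)\<^sup>2) * ennreal (exp (- \<bar>x - l\<bar>)) \<partial>lborel)
          = ennreal (M\<^sup>2 * S\<^sup>2 * j * (f l)\<^sup>2)" using j(1) by (simp add: ennreal_mult[symmetric] mult_ac)
    qed
    also have "\<dots> = ennreal (M\<^sup>2 * S\<^sup>2 * j * s)"
    proof -
      have hs': "((\<lambda>l. M\<^sup>2 * S\<^sup>2 * j * (f l)\<^sup>2) has_sum M\<^sup>2 * S\<^sup>2 * j * s) \<Lambda>" by (rule has_sum_cmult_right[OF hs])
      then have "(\<lambda>l. M\<^sup>2 * S\<^sup>2 * j * (f l)\<^sup>2) norm_summable_on \<Lambda>"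
        using j(1) by (auto simp: abs_mult dest: has_sum_imp_summable)
      then have "Infinite_Set_Sum.abs_summable_on (\<lambda>l. M\<^sup>2 * S\<^sup>2 * j * (f l)\<^sup>2) \<Lambda>"
        by (simp only: abs_summable_equivalent)
      then show ?thesis
        using nn_integral_conv_infsetsum[of "\<lambda>l. M\<^sup>2 * S\<^sup>2 * j * (f l)\<^sup>2" \<Lambda>] j(1) infsetsum_infsum infsumI[OF hs'] by fastforce
    qed
    also have "\<dots> \<le> ennreal (R * s)" using s0 by (intro ennreal_leI mult_right_mono) (auto simp: R_def)
    finally have "C * (\<Sum>g\<in>F. (norm (u g))\<^sup>2) \<le> R * s" using R s0 by (simp add: ennreal_le_iff)
    then show "C / R * (\<Sum>g\<in>F. (norm (u g))\<^sup>2) \<le> s" using R by (simp add: field_simps)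
  qed
qed

section \<open>Interpolation by a right inverse\<close>

lemma lp_top_iff: "c \<in> lp \<infinity> \<Gamma> \<longleftrightarrow> (\<exists>M. \<forall>g\<in>\<Gamma>. norm (c g) \<le> M)"
proof -
  let ?s = "esssup (count_space \<Gamma>) (\<lambda>x. ennreal (norm (c x)))"
  have "?s < \<infinity> \<longleftrightarrow> (\<exists>M. \<forall>g\<in>\<Gamma>. norm (c g) \<le> M)"
  proof
    assume fin: "?s < \<infinity>"
    have "ennreal (norm (c g)) \<le> ?s" if "g \<in> \<Gamma>" for g
      using esssup_AE[where M = "count_space \<Gamma>" and f = "\<lambda>x. ennreal (norm (c x))"] that by (simp add: AE_count_space)
    then have "norm (c g) \<le> enn2real ?s" if "g \<in> \<Gamma>" for g
      using that fin by (metis enn2real_ennreal enn2real_mono infinity_ennreal_def norm_ge_zero)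
    then show "\<exists>M. \<forall>g\<in>\<Gamma>. norm (c g) \<le> M" by blast
  next
    assume "\<exists>M. \<forall>g\<in>\<Gamma>. norm (c g) \<le> M"
    then obtain M where "\<forall>g\<in>\<Gamma>. norm (c g) \<le> M" ..
    then have "?s \<le> ennreal M" by (intro esssup_I) (auto simp: AE_count_space intro: ennreal_leI)
    then show "?s < \<infinity>" using le_less_trans by fastforce
  qed
  then show ?thesis by (simp add: lp_def Lp_norm_def)
qed

lemma lp_finite_iff:
  assumes "p \<noteq> \<infinity>"
  shows "c \<in> lp p \<Gamma> \<longleftrightarrow> (\<integral>\<^sup>+x. ennreal (norm (c x) powr enn2real p) \<partial>count_space \<Gamma>) < \<infinity>"
  using assms by (auto simp: lp_def Lp_norm_def ennroot_def less_top[symmetric])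

lemma exponent_ge_one:
  fixes p :: ennreal
  assumes "1 \<le> p" "p \<noteq> \<infinity>" shows "1 \<le> enn2real p"
  using assms enn2real_mono[of 1 p] by (simp add: less_top)

lemma le_nn_integral_count_space: "y \<in> S \<Longrightarrow> f y \<le> (\<integral>\<^sup>+x. f x \<partial>count_space S)"
  using sum_le_nn_integral_count_space[of "{y}" S f] by simp

lemma lp_bounded:
  assumes "1 \<le> p" "c \<in> lp p \<Gamma>"
  obtains M where "0 \<le> M" "\<And>g. g \<in> \<Gamma> \<Longrightarrow> norm (c g) \<le> M"
proof (cases "p = \<infinity>")
  case True
  then obtain M where "\<forall>g\<in>\<Gamma>. norm (c g) \<le> M" using assms lp_top_iff by metis
  then show thesis by (intro that[of "\<bar>M\<bar>"]) force+
next
  case False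
  define q where "q = enn2real p"
  have q: "1 \<le> q" using exponent_ge_one[OF assms(1) False] by (simp add: q_def)
  define N where "N = (\<integral>\<^sup>+x. ennreal (norm (c x) powr q) \<partial>count_space \<Gamma>)"
  have N: "N < \<infinity>" using assms(2) lp_finite_iff[OF False] by (simp add: N_def q_def)
  show thesis
  proof (rule that[of "enn2real N powr (1 / q)"])
    fix g assume g: "g \<in> \<Gamma>"
    have "ennreal (norm (c g) powr q) \<le> N"
      unfolding N_def by (rule le_nn_integral_count_space[OF g])
    then have "norm (c g) powr q \<le> enn2real N"
      using N enn2real_mono[of "ennreal (norm (c g) powr q)" N] by simp
    then have "(norm (c g) powr q) powr (1 / q) \<le> enn2real N powr (1 / q)" using q by (intro powr_mono2) auto
    then show "norm (c g) \<le> enn2real N powr (1 / q)" using q by (simp add: powr_powr)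
  qed simp
qed

text \<open>
  A kernel with exponential decay acts on every \<open>l\<^sup>p\<close>. Half of the decay makes the sum over \<open>g\<close> at most
  a constant times the largest weighted term. The \<open>q\<close>-th power of that term is at most the
  sum of all \<open>q\<close>-th powers, which replaces Hoelder's inequality and leaves a double sum of nonnegative terms.
\<close>

lemma lp_exp_kernel:
  assumes \<Gamma>: "gap \<eta> \<Gamma>" "countable \<Gamma>" and \<Lambda>: "gap \<delta> \<Lambda>" "countable \<Lambda>" and \<beta>: "0 < \<beta>" and K: "0 \<le> K"
    and k: "\<And>l g. l \<in> \<Lambda> \<Longrightarrow> g \<in> \<Gamma> \<Longrightarrow> norm (k l g) \<le> K * exp (- \<beta> * \<bar>l - g\<bar>)"
    and p: "1 \<le> p" and c: "c \<in> lp p \<Gamma>"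
  shows "(\<lambda>l. infsum (\<lambda>g. k l g * c g) \<Gamma>) \<in> lp p \<Lambda>"
proof -
  define b where "b l = infsum (\<lambda>g. k l g * c g) \<Gamma>" for l
  define \<gamma> where "\<gamma> = \<beta> / 2"
  have \<gamma>: "0 < \<gamma>" "\<beta> = 2 * \<gamma>" using \<beta> by (auto simp: \<gamma>_def)
  obtain S where S: "0 < S" "\<And>x F. finite F \<Longrightarrow> F \<subseteq> \<Gamma> \<Longrightarrow> (\<Sum>y\<in>F. exp (- \<gamma> * \<bar>x - y\<bar>)) \<le> S"
    by (rule gap_exp_sum_bound[OF \<Gamma>(1) \<gamma>(1)]) (rule that)
  have bound: "norm (b l) \<le> K * S * m"
    if l: "l \<in> \<Lambda>" and m: "\<And>g. g \<in> \<Gamma> \<Longrightarrow> exp (- \<gamma> * \<bar>l - g\<bar>) * norm (c g) \<le> m" and m0: "0 \<le> m" for l m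
  proof -
    have fb: "(\<Sum>g\<in>F. norm (k l g * c g)) \<le> K * S * m" if F: "finite F" "F \<subseteq> \<Gamma>" for F
    proof -
      have "(\<Sum>g\<in>F. norm (k l g * c g)) \<le> (\<Sum>g\<in>F. K * exp (- \<gamma> * \<bar>l - g\<bar>) * m)"
      proof (rule sum_mono)
        fix g assume "g \<in> F"
        then have g: "g \<in> \<Gamma>" using F by blast
        have "norm (k l g * c g) \<le> K * exp (- \<beta> * \<bar>l - g\<bar>) * norm (c g)"
          unfolding norm_mult by (intro mult_right_mono k l g) simp
        also have "\<dots> = K * exp (- \<gamma> * \<bar>l - g\<bar>) * (exp (- \<gamma> * \<bar>l - g\<bar>) * norm (c g))"
          by (simp add: \<gamma>(2) mult.assoc[symmetric]) (simp add: mult.assoc flip: exp_add)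
        also have "\<dots> \<le> K * exp (- \<gamma> * \<bar>l - g\<bar>) * m" using m[OF g] K by (intro mult_left_mono) auto
        finally show "norm (k l g * c g) \<le> K * exp (- \<gamma> * \<bar>l - g\<bar>) * m" .
      qed
      also have "\<dots> = (K * m) * (\<Sum>g\<in>F. exp (- \<gamma> * \<bar>l - g\<bar>))" by (simp add: sum_distrib_left mult_ac)
      also have "\<dots> \<le> (K * m) * S" using S(2)[OF F] K m0 by (intro mult_left_mono) auto
      finally show ?thesis by (simp add: mult_ac)
    qed
    have sm: "(\<lambda>g. k l g * c g) norm_summable_on \<Gamma>"
      by (rule nonneg_bdd_above_summable_on) (use fb in \<open>auto intro!: bdd_aboveI2\<close>)
    have "norm (b l) \<le> infsum (\<lambda>g. norm (k l g * c g)) \<Gamma>" unfolding b_def by (rule norm_infsum_bound[OF sm])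
    also have "\<dots> \<le> K * S * m" by (rule infsum_le_finite_sums[OF sm]) (use fb in auto)
    finally show ?thesis .
  qed
  have "b \<in> lp p \<Lambda>"
  proof (cases "p = \<infinity>")
    case True
    obtain M where M: "0 \<le> M" "\<And>g. g \<in> \<Gamma> \<Longrightarrow> norm (c g) \<le> M" by (rule lp_bounded[OF p c]) (rule that)
    have "exp (- \<gamma> * \<bar>l - g\<bar>) * norm (c g) \<le> M" if "g \<in> \<Gamma>" for l g
      using mult_mono[of "exp (- \<gamma> * \<bar>l - g\<bar>)" 1 "norm (c g)" M] M that \<gamma> by simp
    then have "\<forall>l\<in>\<Lambda>. norm (b l) \<le> K * S * M" using bound M by blast
    then show ?thesis unfolding True lp_top_iff by blast
  next
    case False
    define q where "q = enn2real p"
    have q: "1 \<le> q" using exponent_ge_one[OF p False] by (simp add: q_def)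
    have q\<gamma>: "0 < q * \<gamma>" using q \<gamma> by simp
    obtain T where T: "0 < T" "\<And>x F. finite F \<Longrightarrow> F \<subseteq> \<Lambda> \<Longrightarrow> (\<Sum>y\<in>F. exp (- (q * \<gamma>) * \<bar>x - y\<bar>)) \<le> T"
      by (rule gap_exp_sum_bound[OF \<Lambda>(1) q\<gamma>]) (rule that)
    let ?w = "\<lambda>l g. ennreal (exp (- (q * \<gamma>) * \<bar>g - l\<bar>)) * ennreal (norm (c g) powr q)"
    have pt: "ennreal (norm (b l) powr q) \<le> ennreal ((K * S) powr q) * (\<integral>\<^sup>+g. ?w l g \<partial>count_space \<Gamma>)"
      if l: "l \<in> \<Lambda>" and fin: "(\<integral>\<^sup>+g. ?w l g \<partial>count_space \<Gamma>) < \<infinity>" for l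
    proof -
      define \<mu> where "\<mu> = enn2real (\<integral>\<^sup>+g. ?w l g \<partial>count_space \<Gamma>)"
      have \<mu>: "(\<integral>\<^sup>+g. ?w l g \<partial>count_space \<Gamma>) = ennreal \<mu>" "0 \<le> \<mu>" using fin by (auto simp: \<mu>_def)
      have "exp (- \<gamma> * \<bar>l - g\<bar>) * norm (c g) \<le> \<mu> powr (1 / q)" if g: "g \<in> \<Gamma>" for g
      proof -
        have "?w l g \<le> ennreal \<mu>" unfolding \<mu>(1)[symmetric] by (rule le_nn_integral_count_space[OF g])
        then have "exp (- (q * \<gamma>) * \<bar>g - l\<bar>) * norm (c g) powr q \<le> \<mu>"
          using \<mu>(2) by (simp flip: ennreal_mult)
        moreover have "exp (- (q * \<gamma>) * \<bar>g - l\<bar>) = exp (- \<gamma> * \<bar>l - g\<bar>) powr q"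
          by (simp add: powr_def abs_minus_commute mult_ac)
        ultimately have "(exp (- \<gamma> * \<bar>l - g\<bar>) * norm (c g)) powr q \<le> \<mu>" by (simp add: powr_mult)
        then have "((exp (- \<gamma> * \<bar>l - g\<bar>) * norm (c g)) powr q) powr (1 / q) \<le> \<mu> powr (1 / q)"
          using q by (intro powr_mono2) auto
        then show ?thesis using q by (simp add: powr_powr)
      qed
      then have "norm (b l) \<le> K * S * \<mu> powr (1 / q)" by (intro bound l) auto
      then have "norm (b l) powr q \<le> (K * S * \<mu> powr (1 / q)) powr q" using q by (intro powr_mono2) auto
      also have "\<dots> = (K * S) powr q * \<mu>" using K S q \<mu>(2) by (simp add: powr_mult powr_powr)
      finally show ?thesis unfolding \<mu>(1) using \<mu>(2) by (simp flip: ennreal_mult add: ennreal_leI)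
    qed
    have swap: "(\<integral>\<^sup>+l. \<integral>\<^sup>+g. ?w l g \<partial>count_space \<Gamma> \<partial>count_space \<Lambda>)
        \<le> ennreal T * (\<integral>\<^sup>+g. ennreal (norm (c g) powr q) \<partial>count_space \<Gamma>)"
    proof -
      have inner: "(\<integral>\<^sup>+l. ennreal (exp (- (q * \<gamma>) * \<bar>g - l\<bar>)) \<partial>count_space \<Lambda>) \<le> ennreal T" for g
      proof -
        have sm: "(\<lambda>l. exp (- (q * \<gamma>) * \<bar>g - l\<bar>)) norm_summable_on \<Lambda>"
          by (rule nonneg_bdd_above_summable_on) (use T(2)[of _ g] in \<open>auto intro!: bdd_aboveI2\<close>)
        then have "Infinite_Set_Sum.abs_summable_on (\<lambda>l. exp (- (q * \<gamma>) * \<bar>g - l\<bar>)) \<Lambda>"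
          by (simp only: abs_summable_equivalent)
        then have "(\<integral>\<^sup>+l. ennreal (exp (- (q * \<gamma>) * \<bar>g - l\<bar>)) \<partial>count_space \<Lambda>)
            = ennreal (infsum (\<lambda>l. exp (- (q * \<gamma>) * \<bar>g - l\<bar>)) \<Lambda>)"
          by (simp add: nn_integral_conv_infsetsum infsetsum_infsum)
        also have "infsum (\<lambda>l. exp (- (q * \<gamma>) * \<bar>g - l\<bar>)) \<Lambda> \<le> T"
          by (rule infsum_le_finite_sums[OF abs_summable_summable[OF sm]]) (use T(2) in auto)
        finally show ?thesis by (simp add: ennreal_leI)
      qed
      have "(\<integral>\<^sup>+l. \<integral>\<^sup>+g. ?w l g \<partial>count_space \<Gamma> \<partial>count_space \<Lambda>)
          = (\<integral>\<^sup>+g. \<integral>\<^sup>+l. ?w l g \<partial>count_space \<Lambda> \<partial>count_space \<Gamma>)"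
        by (rule nn_integral_count_space_nn_integral[OF \<Gamma>(2)]) simp
      also have "\<dots> \<le> (\<integral>\<^sup>+g. ennreal T * ennreal (norm (c g) powr q) \<partial>count_space \<Gamma>)"
      proof (rule nn_integral_mono)
        fix g
        have "(\<integral>\<^sup>+l. ?w l g \<partial>count_space \<Lambda>)
            = (\<integral>\<^sup>+l. ennreal (exp (- (q * \<gamma>) * \<bar>g - l\<bar>)) \<partial>count_space \<Lambda>) * ennreal (norm (c g) powr q)"
          by (rule nn_integral_multc) simp
        then show "(\<integral>\<^sup>+l. ?w l g \<partial>count_space \<Lambda>) \<le> ennreal T * ennreal (norm (c g) powr q)"
          using inner[of g] by (simp add: mult_right_mono)
      qed
      also have "\<dots> = ennreal T * (\<integral>\<^sup>+g. ennreal (norm (c g) powr q) \<partial>count_space \<Gamma>)"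
        by (rule nn_integral_cmult) simp
      finally show ?thesis .
    qed
    have cfin: "(\<integral>\<^sup>+g. ennreal (norm (c g) powr q) \<partial>count_space \<Gamma>) < \<infinity>"
      using c lp_finite_iff[OF False] by (simp add: q_def)
    have wfin: "(\<integral>\<^sup>+g. ?w l g \<partial>count_space \<Gamma>) < \<infinity>" for l
    proof -
      have "(\<integral>\<^sup>+g. ?w l g \<partial>count_space \<Gamma>) \<le> (\<integral>\<^sup>+g. 1 * ennreal (norm (c g) powr q) \<partial>count_space \<Gamma>)"
        using q\<gamma> by (intro nn_integral_mono mult_right_mono) auto
      then show ?thesis using cfin by (simp add: le_less_trans)
    qed
    have "(\<integral>\<^sup>+l. ennreal (norm (b l) powr q) \<partial>count_space \<Lambda>)
        \<le> (\<integral>\<^sup>+l. ennreal ((K * S) powr q) * (\<integral>\<^sup>+g. ?w l g \<partial>count_space \<Gamma>) \<partial>count_space \<Lambda>)"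
      by (intro nn_integral_mono pt wfin) simp
    also have "\<dots> = ennreal ((K * S) powr q) * (\<integral>\<^sup>+l. \<integral>\<^sup>+g. ?w l g \<partial>count_space \<Gamma> \<partial>count_space \<Lambda>)"
      by (rule nn_integral_cmult) simp
    also have "\<dots> \<le> ennreal ((K * S) powr q) * (ennreal T * (\<integral>\<^sup>+g. ennreal (norm (c g) powr q) \<partial>count_space \<Gamma>))"
      by (intro mult_left_mono swap) simp
    also have "\<dots> < \<infinity>" using cfin by (simp add: ennreal_mult_less_top)
    finally show ?thesis using lp_finite_iff[OF False] by (simp add: q_def)
  qed
  then show ?thesis unfolding b_def .
qed

lemma gram_kernel_decay:
  fixes G :: "complex \<Rightarrow> complex"
  assumes \<Lambda>: "gap \<delta> \<Lambda>" and \<alpha>: "0 < \<alpha>" and dec: "\<And>x::real. norm (G (of_real x)) \<le> K * exp (- \<alpha> * \<bar>x\<bar>)"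
  obtains K' where "0 \<le> K'" "\<And>g h. norm (gram_kernel G \<Lambda> g h)
    \<le> K' * exp (- (\<alpha> / 2) * \<bar>g - h\<bar>)"
proof -
  have K: "0 \<le> K" using order_trans[OF norm_ge_zero dec[of 0]] by simp
  have \<alpha>2: "0 < \<alpha> / 2" using \<alpha> by simp
  obtain S where S: "0 < S" "\<And>x F. finite F \<Longrightarrow> F \<subseteq> \<Lambda> \<Longrightarrow> (\<Sum>y\<in>F. exp (- (\<alpha> / 2) * \<bar>x - y\<bar>)) \<le> S"
    by (rule gap_exp_sum_bound[OF \<Lambda> \<alpha>2]) (rule that)
  show thesis
  proof (rule that[of "K * K * S"])
    show "0 \<le> K * K * S" using K S by simp
    fix g h
    show "norm (gram_kernel G \<Lambda> g h)
      \<le> K * K * S * exp (- (\<alpha> / 2) * \<bar>g - h\<bar>)"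
      unfolding gram_kernel_def
    proof (rule exp_kernel_compose(2)[OF S(2) \<alpha>2])
      fix l
      show "norm (G (of_real (g - l))) \<le> K * exp (- (2 * (\<alpha> / 2)) * \<bar>g - l\<bar>)" using dec[of "g - l"] by simp
      have "norm (G (of_real (h - l))) \<le> K * exp (- \<alpha> * \<bar>h - l\<bar>)" by (rule dec)
      also have "\<dots> \<le> K * exp (- (\<alpha> / 2) * \<bar>l - h\<bar>)"
        using K \<alpha> by (intro mult_left_mono) (auto simp: abs_minus_commute mult_right_mono)
      finally show "norm (cnj (G (of_real (h - l)))) \<le> K * exp (- (\<alpha> / 2) * \<bar>l - h\<bar>)" by simp
    qed (use K in auto)
  qed
qed

text \<open>
  With \<open>B\<close> a right inverse of the Gram matrix, \<open>b = B c\<close> and \<open>d l = \<Sum>t. cnj (G (t - l)) * b t\<close>, the function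
  with coefficients \<open>d\<close> has the values \<open>A b = c\<close> on \<open>\<Gamma>\<close>. Both \<open>B\<close> and the kernel \<open>cnj (G (t - l))\<close> decay
  exponentially, and so \<open>d\<close> is in the same \<open>l\<^sup>p\<close> as \<open>c\<close>.
\<close>

theorem interpolation_of_stable_gram:
  fixes G :: "complex \<Rightarrow> complex"
  assumes \<Lambda>: "gap \<delta> \<Lambda>" "countable \<Lambda>" and \<Gamma>: "gap \<eta> \<Gamma>" "countable \<Gamma>"
    and \<alpha>: "0 < \<alpha>" and dec: "\<And>x::real. norm (G (of_real x)) \<le> K * exp (- \<alpha> * \<bar>x\<bar>)"
    and c1: "0 < c1" and form: "\<And>F u. finite F \<Longrightarrow> F \<subseteq> \<Gamma> \<Longrightarrow> c1 * (\<Sum>g\<in>F. (norm (u g))\<^sup>2)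
    \<le> Re (\<Sum>g\<in>F. \<Sum>h\<in>F. cnj (u g) * gram_kernel G \<Lambda> g h * u h)"
    and p: "1 \<le> p"
  shows "interpolation_set \<Gamma> p \<Lambda> G"
proof -
  have K: "0 \<le> K" using order_trans[OF norm_ge_zero dec[of 0]] by simp
  define A where "A = gram_kernel G \<Lambda>"
  obtain KA where KA: "0 \<le> KA" "\<And>g h. norm (A g h) \<le> KA * exp (- (\<alpha> / 2) * \<bar>g - h\<bar>)"
    by (rule gram_kernel_decay[OF \<Lambda>(1) \<alpha> dec]) (rule that, assumption, simp only: A_def)
  have herm: "A h g = cnj (A g h)" for g h
    unfolding A_def gram_kernel_def infsum_cnj[symmetric] by (simp add: mult.commute)
  have \<alpha>4: "0 < \<alpha> / 4" using \<alpha> by simp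
  have A4: "norm (A g h) \<le> KA * exp (- (2 * (\<alpha> / 4)) * \<bar>g - h\<bar>)" for g h
    using KA(2)[of g h] by simp
  obtain B \<beta> KB where \<beta>: "0 < \<beta>" and KB: "0 \<le> KB"
    and B: "\<And>g h. g \<in> \<Gamma> \<Longrightarrow> h \<in> \<Gamma> \<Longrightarrow> norm (B g h) \<le> KB * exp (- \<beta> * \<bar>g - h\<bar>)"
    and AB: "\<And>g h. g \<in> \<Gamma> \<Longrightarrow> h \<in> \<Gamma> \<Longrightarrow> infsum (\<lambda>t. A g t * B t h) \<Gamma> = (if g = h then 1 else 0)"
    by (rule exp_decay_right_inverse[OF \<Gamma>(1) \<alpha>4 KA(1) A4 herm c1 form[folded A_def]]) (assumption, assumption, rule that)
  show ?thesis
    unfolding interpolation_set_def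
  proof
    fix c assume c: "c \<in> lp p \<Gamma>"
    define b where "b t = infsum (\<lambda>h. B t h * c h) \<Gamma>" for t
    define d where "d l = infsum (\<lambda>t. cnj (G (of_real (t - l))) * b t) \<Gamma>" for l
    have b: "b \<in> lp p \<Gamma>" unfolding b_def by (rule lp_exp_kernel[OF \<Gamma> \<Gamma> \<beta> KB B p c])
    have d: "d \<in> lp p \<Lambda>"
      unfolding d_def
    proof (rule lp_exp_kernel[OF \<Gamma> \<Lambda> \<alpha> K _ p b])
      fix l t show "norm (cnj (G (of_real (t - l)))) \<le> K * exp (- \<alpha> * \<bar>l - t\<bar>)"
        using dec[of "t - l"] by (simp add: abs_minus_commute)
    qed
    obtain Mb where Mb: "0 \<le> Mb" "\<And>g. g \<in> \<Gamma> \<Longrightarrow> norm (b g) \<le> Mb" by (rule lp_bounded[OF p b]) (rule that)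
    obtain Mc where Mc: "0 \<le> Mc" "\<And>g. g \<in> \<Gamma> \<Longrightarrow> norm (c g) \<le> Mc" by (rule lp_bounded[OF p c]) (rule that)
    obtain S where S: "0 < S" "\<And>x F. finite F \<Longrightarrow> F \<subseteq> \<Gamma> \<Longrightarrow> (\<Sum>y\<in>F. exp (- \<alpha> * \<bar>x - y\<bar>)) \<le> S"
      by (rule gap_exp_sum_bound[OF \<Gamma>(1) \<alpha>]) (rule that)
    obtain S' where S': "0 < S'" "\<And>x F. finite F \<Longrightarrow> F \<subseteq> \<Gamma> \<Longrightarrow> (\<Sum>y\<in>F. exp (- \<beta> * \<bar>x - y\<bar>)) \<le> S'"
      by (rule gap_exp_sum_bound[OF \<Gamma>(1) \<beta>]) (rule that)
    have kernel_sum: "(\<Sum>y\<in>F. norm (k y * v y)) \<le> Kk * M * T"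
      if F: "finite F" "F \<subseteq> \<Gamma>" and k: "\<And>y. y \<in> \<Gamma> \<Longrightarrow> norm (k y) \<le> Kk * exp (- r * \<bar>x - y\<bar>)"
        and v: "\<And>y. y \<in> \<Gamma> \<Longrightarrow> norm (v y) \<le> M" and T: "(\<Sum>y\<in>F. exp (- r * \<bar>x - y\<bar>)) \<le> T"
        and nn: "0 \<le> Kk" "0 \<le> M" for F Kk M T r x and k v :: "real \<Rightarrow> complex"
    proof -
      have "(\<Sum>y\<in>F. norm (k y * v y)) \<le> (\<Sum>y\<in>F. (Kk * exp (- r * \<bar>x - y\<bar>)) * M)"
        unfolding norm_mult using F nn by (intro sum_mono mult_mono k v) auto
      also have "\<dots> = Kk * M * (\<Sum>y\<in>F. exp (- r * \<bar>x - y\<bar>))" by (simp add: sum_distrib_left mult_ac)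
      also have "\<dots> \<le> Kk * M * T" using T nn by (intro mult_left_mono) auto
      finally show ?thesis .
    qed
    have "shift_sum \<Lambda> G d g = c g" if g: "g \<in> \<Gamma>" for g
    proof -
      have sG: "(\<lambda>l. G (of_real (g - l))) norm_summable_on \<Lambda>"
        by (rule exp_kernel_abs_summable[OF \<Lambda>(1) \<alpha> dec])
      have bd1: "(\<Sum>t\<in>F. norm (cnj (G (of_real (t - l))) * b t)) \<le> K * Mb * S" if "finite F" "F \<subseteq> \<Gamma>" for l F
      proof (rule kernel_sum[OF that _ Mb(2) S(2)[OF that, of l] K Mb(1)])
        fix t show "norm (cnj (G (of_real (t - l)))) \<le> K * exp (- \<alpha> * \<bar>l - t\<bar>)"
          using dec[of "t - l"] by (simp add: abs_minus_commute)
      qed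
      have "shift_sum \<Lambda> G d g = infsum (\<lambda>l. G (of_real (g - l)) * d l) \<Lambda>"
        by (simp add: shift_sum_def mult.commute)
      also have "\<dots> = infsum (\<lambda>t. infsum (\<lambda>l. G (of_real (g - l)) * (cnj (G (of_real (t - l))) * b t)) \<Lambda>) \<Gamma>"
        unfolding d_def by (rule infsum_swap_dominated(1)[OF sG bd1])
      also have "\<dots> = infsum (\<lambda>t. A g t * b t) \<Gamma>"
        by (simp only: A_def gram_kernel_def mult.assoc[symmetric] infsum_cmult_left')
      also have "\<dots> = infsum (\<lambda>h. infsum (\<lambda>t. A g t * (B t h * c h)) \<Gamma>) \<Gamma>"
        unfolding b_def
      proof (rule infsum_swap_dominated(1))
        show "(\<lambda>t. A g t) norm_summable_on \<Gamma>"
          by (rule exp_kernel_abs_summable[OF \<Gamma>(1) _ KA(2)]) (use \<alpha> in simp)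
        fix t F assume "t \<in> \<Gamma>" and F: "finite F" "F \<subseteq> \<Gamma>"
        then show "(\<Sum>h\<in>F. norm (B t h * c h)) \<le> KB * Mc * S'"
          by (intro kernel_sum[OF F _ Mc(2) S'(2)[OF F, of t] KB Mc(1)] B)
      qed
      also have "\<dots> = infsum (\<lambda>h. (if g = h then 1 else 0) * c h) \<Gamma>"
        by (intro infsum_cong) (simp add: mult.assoc[symmetric] infsum_cmult_left' AB[OF g])
      also have "\<dots> = c g"
        by (rule infsumI, rule has_sum_finite_neutralI[of "{g}"]) (use g in auto)
      finally show ?thesis .
    qed
    then show "\<exists>f\<in>V_space p \<Lambda> G. \<forall>g\<in>\<Gamma>. f g = c g" unfolding V_space_def using d by blast
  qed
qed

lemma card_uminus_Int_atLeastAtMost: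
  fixes S :: "real set"
  shows "card (uminus ` S \<inter> {a..b}) = card (S \<inter> {- b..- a})"
proof -
  have "uminus ` S \<inter> {a..b} = uminus ` (S \<inter> {- b..- a})" by force
  then show ?thesis by (simp add: card_image)
qed

theorem corollary1p12:
  fixes \<alpha> :: real and G :: "complex \<Rightarrow> complex" and \<Lambda> \<Gamma> :: "real set"
  assumes "\<alpha> > 0"
    and "G \<in> class_K \<alpha>"
    and "separated \<Lambda>" and "separated \<Gamma>"
    and "relatively_dense \<Gamma>"
    and "stable_shifts \<Gamma> G"
    and "lower_density \<Lambda> > real (q_num \<alpha> G) / real (k_num \<alpha> G) * upper_density \<Gamma>"
  shows "\<forall>p::ennreal. 1 \<le> p \<longrightarrow> interpolation_set \<Gamma> p \<Lambda> G"
proof -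
  note \<alpha> = \<open>\<alpha> > 0\<close>
  obtain P Q where rep: "represents \<alpha> P Q G" using assms(2) unfolding class_K_def by blast
  define k where "k = k_num \<alpha> G"
  obtain m a P1 Q1 where k: "0 < k" and q: "degree Q = k * m" "0 < m"
    and deg: "degree Q1 = m" "degree P1 < m"
    and nz: "\<And>s::real. 0 \<le> s \<Longrightarrow> poly Q1 (of_real s) \<noteq> 0"
    and PQ: "\<And>w. poly P w = w ^ a * poly P1 (w ^ k)" "\<And>w. poly Q w = poly Q1 (w ^ k)"
    by (rule rotation_number_structure[OF \<alpha> rep, folded k_def]) (rule that)
  have G: "G (of_real x) = of_real (exp (real a * \<alpha> * x)) *
      (poly P1 (of_real (exp (\<alpha> * real k * x))) / poly Q1 (of_real (exp (\<alpha> * real k * x))))" for x :: real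
  proof -
    have w: "exp (complex_of_real \<alpha> * of_real x) = of_real (exp (\<alpha> * x))" by (metis exp_of_real of_real_mult)
    have pw: "of_real (exp (\<alpha> * x)) ^ n = complex_of_real (exp (real n * \<alpha> * x))" for n
      by (simp only: of_real_power[symmetric] exp_of_nat_mult[symmetric] mult.assoc)
    have "G (of_real x) = poly P (of_real (exp (\<alpha> * x))) / poly Q (of_real (exp (\<alpha> * x)))"
      using rep by (simp add: represents_def w)
    then show ?thesis unfolding PQ pw by (simp add: mult.commute)
  qed
  obtain \<delta> where \<delta>: "gap \<delta> \<Lambda>" by (rule separated_gap[OF assms(3)])
  obtain \<eta> where \<eta>: "gap \<eta> \<Gamma>" by (rule separated_gap[OF assms(4)])
  have cntb: "countable \<Lambda>" "countable \<Gamma>" using assms(3,4) by (auto simp: separated_def)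
  have "real (q_num \<alpha> G) / real (k_num \<alpha> G) = real m"
    unfolding q_num_eq[OF \<alpha> rep] q(1) using k by (simp add: k_def)
  then have "real m * upper_density \<Gamma> < lower_density \<Lambda>" using assms(7) by simp
  then obtain c C where c: "0 < c" and excess: "\<And>a b. a \<le> b \<Longrightarrow>
      real m * real (card (\<Gamma> \<inter> {a..b})) + c * (b - a) - C \<le> real (card (\<Lambda> \<inter> {a..b}))"
    by (rule density_excess[OF \<delta> \<eta>]) (rule that)
  obtain K where dec: "\<And>x::real. norm (G (of_real x)) \<le> K * exp (- \<alpha> * \<bar>x\<bar>)"
    by (rule generator_decay[OF \<alpha> rep]) (rule that)
  note cont = generator_continuous[OF rep]
  have \<kappa>: "0 < \<alpha> * real k" using \<alpha> k by simp
  have excess': "real m * real (card (uminus ` \<Gamma> \<inter> {a..b})) + c * (b - a) - C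
      \<le> real (card (uminus ` \<Lambda> \<inter> {a..b}))" if "a \<le> b" for a b
    using excess[of "- b" "- a"] that by (simp add: card_uminus_Int_atLeastAtMost)
  obtain M where M: "0 \<le> M" and samp: "\<And>x F v. finite F \<Longrightarrow> F \<subseteq> uminus ` \<Gamma> \<Longrightarrow>
    \<exists>X. finite X \<and> X \<subseteq> uminus ` \<Lambda> \<and> norm (\<Sum>g\<in>F. v g * G (of_real (x - g)))
      \<le> M * (\<Sum>l\<in>X. exp (- \<bar>x - l\<bar>) * norm (\<Sum>g\<in>F. v g * G (of_real (l - g))))"
    by (rule sampling_reconstruction_bound[OF \<kappa> nz deg G gap_uminus[OF \<delta>] gap_uminus[OF \<eta>] c excess'])
      (assumption, assumption, rule that)
  \<comment> \<open>The sampling bound is applied to the reflected sets, because the rows of the interpolation problem are \<open>G (g - l)\<close>.\<close>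
  have reflected: "\<exists>X. finite X \<and> X \<subseteq> \<Lambda> \<and> norm (\<Sum>g\<in>F. v g * G (of_real (g - x)))
        \<le> M * (\<Sum>l\<in>X. exp (- \<bar>x - l\<bar>) * norm (\<Sum>g\<in>F. v g * G (of_real (g - l))))"
    if F: "finite F" "F \<subseteq> \<Gamma>" for x F and v :: "real \<Rightarrow> complex"
  proof -
    have e: "(\<Sum>g\<in>uminus ` F. v (- g) * G (of_real (y - g))) = (\<Sum>g\<in>F. v g * G (of_real (g - (- y))))" for y
      by (subst sum.reindex) (auto intro!: sum.cong simp: add.commute)
    obtain X where X: "finite X" "X \<subseteq> uminus ` \<Lambda>"
      "norm (\<Sum>g\<in>uminus ` F. v (- g) * G (of_real (- x - g)))
        \<le> M * (\<Sum>l\<in>X. exp (- \<bar>- x - l\<bar>) * norm (\<Sum>g\<in>uminus ` F. v (- g) * G (of_real (l - g))))"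
      using samp[of "uminus ` F" "\<lambda>g. v (- g)" "- x"] F by blast
    have "(\<Sum>l\<in>X. exp (- \<bar>- x - l\<bar>) * norm (\<Sum>g\<in>F. v g * G (of_real (g - (- l)))))
        = (\<Sum>l\<in>uminus ` X. exp (- \<bar>x - l\<bar>) * norm (\<Sum>g\<in>F. v g * G (of_real (g - l))))"
      by (subst sum.reindex) (auto intro!: sum.cong simp: abs_minus_commute add.commute)
    then have "norm (\<Sum>g\<in>F. v g * G (of_real (g - x)))
        \<le> M * (\<Sum>l\<in>uminus ` X. exp (- \<bar>x - l\<bar>) * norm (\<Sum>g\<in>F. v g * G (of_real (g - l))))"
      using X(3) unfolding e by simp
    moreover have "finite (uminus ` X)" "uminus ` X \<subseteq> \<Lambda>" using X by auto
    ultimately show ?thesis by blast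
  qed
  obtain c1 where "0 < c1" "\<And>F u. finite F \<Longrightarrow> F \<subseteq> \<Gamma> \<Longrightarrow> c1 * (\<Sum>g\<in>F. (norm (u g))\<^sup>2)
    \<le> Re (\<Sum>g\<in>F. \<Sum>h\<in>F. cnj (u g) * gram_kernel G \<Lambda> g h * u h)"
    by (rule gram_kernel_lower_bound[OF \<delta> cntb(1) \<alpha> dec cont assms(6) M reflected]) (assumption, assumption, rule that)
  then show ?thesis
    using interpolation_of_stable_gram[OF \<delta> cntb(1) \<eta> cntb(2) \<alpha> dec] by blast
qed

end
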